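(* Let $p \in C^1([0,1];(0,+\infty))$, $r \in C^0([0,1];(0,+\infty))$, $q \in C^0([0,1];\mathbb{R})$, and let $a_1,a_2,b_1,b_2$ be real constants with $|a_1|+|a_2|>0$, $|b_1|+|b_2|>0$. Let $A$ be the Sturm-Liouville operator $$(Af)(z) = -\frac{1}{r(z)}\frac{d}{dz}\left(p(z)\frac{df}{dz}(z)\right)+\frac{q(z)}{r(z)}f(z),\quad z\in(0,1),$$ with domain $D$ the set of all $f\in C^2([0,1];\mathbb{R})$ with $b_1f(0)+b_2\frac{df}{dz}(0)=a_1f(1)+a_2\frac{df}{dz}(1)=0$. Let $\lambda_1<\lambda_2<\dots$ be its eigenvalues and $\phi_1,\phi_2,\dots$ the corresponding eigenfunctions, orthonormal in $L^2_r([0,1])$. Assume that $$\lambda_1>0 \quad\text{and}\quad \sum_{n=1}^\infty \lambda_n^{-1}\max_{0\le z\le 1}|\phi_n(z)|<+\infty .$$ For $\mu\in\mathbb{R}$ let $$X_\mu=\left\{x\in C^2([0,1];\mathbb{R}) : b_1x(0)+b_2\frac{dx}{dz}(0)=\mu,\ a_1x(1)+a_2\frac{dx}{dz}(1)=0\right\}.$$ Then for every $d\in C^2(\mathbb{R}_+;\mathbb{R})$ and every $x_0\in X_{d(0)}$ there is a unique function $x\in C^0(\mathbb{R}_+\times[0,1];\mathbb{R})\cap C^1((0,+\infty)\times[0,1];\mathbb{R})$ such that $x[t]\in X_{d(t)}$ for all $t\ge 0$, $x(0,z)=x_0(z)$ for all $z\in[0,1]$, and $$\frac{\partial x}{\partial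 t}(t,z)-\frac{1}{r(z)}\frac{\partial}{\partial z}\left(p(z)\frac{\partial x}{\partial z}(t,z)\right)+\frac{q(z)}{r(z)}x(t,z)=0\quad\text{for all }(t,z)\in(0,+\infty)\times(0,1).$$ Moreover, this solution satisfies, for all $t\ge 0$ and all $\varepsilon>0$, $$\|x[t]\|_r\le\sqrt{1+\varepsilon}\,\exp(-\lambda_1t)\,\|x[0]\|_r+C\sqrt{\frac{1+\varepsilon^{-1}}{b_1^2+b_2^2}}\,\max_{0\le s\le t}|d(s)|,$$ where $$C:=\frac{p(0)}{\sqrt{b_1^2+b_2^2}}\sqrt{\sum_{n=1}^\infty\lambda_n^{-2}\left|b_1\frac{d\phi_n}{dz}(0)-b_2\phi_n(0)\right|^2}=\sqrt{\int_0^1r(z)\tilde x^2(z)\,dz}$$ and $\tilde x\in C^2([0,1];\mathbb{R})$ is the unique solution of the boundary value problem $$\frac{d}{dz}\left(p(z)\frac{d\tilde x}{dz}(z)\right)-q(z)\tilde x(z)=0\ \text{ for all } z\in[0,1],\qquad b_1\tilde x(0)+b_2\frac{d\tilde x}{dz}(0)=\sqrt{b_1^2+b_2^2},\qquad a_1\tilde x(1)+a_2\frac{d\tilde x}{dz}(1)=0 .$$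
   Context: $\mathbb{R}_+=[0,+\infty)$. $L^2_r([0,1])$ is the Hilbert space of (classes of) measurable $f:[0,1]\to\mathbb{R}$ with $\|f\|_r=\left(\int_0^1r(z)|f(z)|^2dz\right)^{1/2}<+\infty$ and inner product $\langle f,g\rangle=\int_0^1r(z)f(z)g(z)dz$. For a function $x$ on $\mathbb{R}_+\times[0,1]$, $x[t]$ denotes the profile $z\mapsto x(t,z)$. Standard fact on Sturm-Liouville operators: all eigenvalues of $A$ are real and form an infinite increasing sequence $\lambda_1<\lambda_2<\dots$ with $\lambda_n\to+\infty$; to each $\lambda_n$ corresponds exactly one (up to scaling) eigenfunction $\phi_n\in D$ with $A\phi_n=\lambda_n\phi_n$; normalized, the eigenfunctions form an orthonormal basis of $L^2_r([0,1])$. *)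

theory Defs
  imports "HOL-Analysis.Analysis"
begin

text \<open>
  A function on an interval \<open>S\<close> is a total function of which only the values on \<open>S\<close> matter.
  At an endpoint belonging to \<open>S\<close> the derivative is one-sided; it is unique at every point of a
  nondegenerate interval. At interior points it is the ordinary derivative.
\<close>

definition deriv_on :: "real set \<Rightarrow> (real \<Rightarrow> real) \<Rightarrow> real \<Rightarrow> real" where
  "deriv_on S f z = vector_derivative f (at z within S)"

primrec Ck_on :: "nat \<Rightarrow> real set \<Rightarrow> (real \<Rightarrow> real) \<Rightarrow> bool" where
  "Ck_on 0 S f \<longleftrightarrow> continuous_on S f"
| "Ck_on (Suc k) S f \<longleftrightarrow> f differentiable_on S \<and> Ck_on k S (deriv_on S f)"

definition inner_r :: "(real \<Rightarrow> real) \<Rightarrow> (real \<Rightarrow> real) \<Rightarrow> (real \<Rightarrow> real) \<Rightarrow> real" where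
  "inner_r r f g = (LINT z:{0..1}|lebesgue. r z * f z * g z)"

definition norm_r :: "(real \<Rightarrow> real) \<Rightarrow> (real \<Rightarrow> real) \<Rightarrow> real" where
  "norm_r r f = sqrt (LINT z:{0..1}|lebesgue. r z * \<bar>f z\<bar>\<^sup>2)"

definition sl_operator ::
  "(real \<Rightarrow> real) \<Rightarrow> (real \<Rightarrow> real) \<Rightarrow> (real \<Rightarrow> real) \<Rightarrow> (real \<Rightarrow> real) \<Rightarrow> real \<Rightarrow> real" where
  "sl_operator p q r f z =
     - (1 / r z) * deriv_on {0..1} (\<lambda>y. p y * deriv_on {0..1} f y) z + q z / r z * f z"

definition sl_domain :: "real \<Rightarrow> real \<Rightarrow> real \<Rightarrow> real \<Rightarrow> (real \<Rightarrow> real) set" where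
  "sl_domain a1 a2 b1 b2 =
     {f. Ck_on 2 {0..1} f \<and>
         b1 * f 0 + b2 * deriv_on {0..1} f 0 = 0 \<and>
         a1 * f 1 + a2 * deriv_on {0..1} f 1 = 0}"

definition sl_eigenfunction ::
  "(real \<Rightarrow> real) \<Rightarrow> (real \<Rightarrow> real) \<Rightarrow> (real \<Rightarrow> real) \<Rightarrow> real \<Rightarrow> real \<Rightarrow> real \<Rightarrow> real
     \<Rightarrow> real \<Rightarrow> (real \<Rightarrow> real) \<Rightarrow> bool" where
  "sl_eigenfunction p q r a1 a2 b1 b2 l f \<longleftrightarrow>
     f \<in> sl_domain a1 a2 b1 b2 \<and> (\<exists>z\<in>{0..1}. f z \<noteq> 0) \<and>
     (\<forall>z\<in>{0<..<1}. sl_operator p q r f z = l * f z)"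

definition sl_eigenvalues ::
  "(real \<Rightarrow> real) \<Rightarrow> (real \<Rightarrow> real) \<Rightarrow> (real \<Rightarrow> real) \<Rightarrow> real \<Rightarrow> real \<Rightarrow> real \<Rightarrow> real
     \<Rightarrow> real set" where
  "sl_eigenvalues p q r a1 a2 b1 b2 = {l. \<exists>f. sl_eigenfunction p q r a1 a2 b1 b2 l f}"

definition X_space :: "real \<Rightarrow> real \<Rightarrow> real \<Rightarrow> real \<Rightarrow> real \<Rightarrow> (real \<Rightarrow> real) set" where
  "X_space a1 a2 b1 b2 \<mu> =
     {f. Ck_on 2 {0..1} f \<and>
         b1 * f 0 + b2 * deriv_on {0..1} f 0 = \<mu> \<and>
         a1 * f 1 + a2 * deriv_on {0..1} f 1 = 0}"

text \<open>
  Functions of \<open>(t, z)\<close> are curried, so that the profile \<open>x[t]\<close> is \<open>x t\<close>.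
  The class \<open>C\<^sup>1((0,\<infinity>) \<times> [0,1])\<close>: both partial derivatives exist everywhere on the set and are
  jointly continuous there (the derivative in \<open>z\<close> is one-sided at \<open>z = 0\<close> and \<open>z = 1\<close>).
\<close>

definition C1_strip :: "(real \<Rightarrow> real \<Rightarrow> real) \<Rightarrow> bool" where
  "C1_strip x \<longleftrightarrow>
     (\<forall>t>0. \<forall>z\<in>{0..1}. (\<lambda>s. x s z) differentiable (at t)) \<and>
     (\<forall>t>0. x t differentiable_on {0..1}) \<and>
     continuous_on ({0<..} \<times> {0..1}) (\<lambda>(t, z). deriv (\<lambda>s. x s z) t) \<and>
     continuous_on ({0<..} \<times> {0..1}) (\<lambda>(t, z). deriv_on {0..1} (x t) z)"

definition pde_solution ::
  "(real \<Rightarrow> real) \<Rightarrow> (real \<Rightarrow> real) \<Rightarrow> (real \<Rightarrow> real) \<Rightarrow> real \<Rightarrow> real \<Rightarrow> real \<Rightarrow> real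
     \<Rightarrow> (real \<Rightarrow> real) \<Rightarrow> (real \<Rightarrow> real) \<Rightarrow> (real \<Rightarrow> real \<Rightarrow> real) \<Rightarrow> bool" where
  "pde_solution p q r a1 a2 b1 b2 d x0 x \<longleftrightarrow>
     continuous_on ({0..} \<times> {0..1}) (\<lambda>(t, z). x t z) \<and>
     C1_strip x \<and>
     (\<forall>t\<ge>0. x t \<in> X_space a1 a2 b1 b2 (d t)) \<and>
     (\<forall>z\<in>{0..1}. x 0 z = x0 z) \<and>
     (\<forall>t>0. \<forall>z\<in>{0<..<1}.
        deriv (\<lambda>s. x s z) t
        - 1 / r z * deriv_on {0..1} (\<lambda>y. p y * deriv_on {0..1} (x t) y) z
        + q z / r z * x t z = 0)"

definition bvp_solution ::
  "(real \<Rightarrow> real) \<Rightarrow> (real \<Rightarrow> real) \<Rightarrow> real \<Rightarrow> real \<Rightarrow> real \<Rightarrow> real \<Rightarrow> (real \<Rightarrow> real) \<Rightarrow> bool" where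
  "bvp_solution p q a1 a2 b1 b2 y \<longleftrightarrow>
     Ck_on 2 {0..1} y \<and>
     (\<forall>z\<in>{0..1}. deriv_on {0..1} (\<lambda>s. p s * deriv_on {0..1} y s) z - q z * y z = 0) \<and>
     b1 * y 0 + b2 * deriv_on {0..1} y 0 = sqrt (b1\<^sup>2 + b2\<^sup>2) \<and>
     a1 * y 1 + a2 * deriv_on {0..1} y 1 = 0"

text \<open>
  Sequences are indexed from 0: \<open>lam n\<close> and \<open>phi n\<close> are \<open>\<lambda>\<^sub>n\<^sub>+\<^sub>1\<close> and \<open>\<phi>\<^sub>n\<^sub>+\<^sub>1\<close>.
\<close>

definition gain_term ::
  "real \<Rightarrow> real \<Rightarrow> (nat \<Rightarrow> real) \<Rightarrow> (nat \<Rightarrow> real \<Rightarrow> real) \<Rightarrow> nat \<Rightarrow> real" where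
  "gain_term b1 b2 lam phi n =
     inverse ((lam n)\<^sup>2) * \<bar>b1 * deriv_on {0..1} (phi n) 0 - b2 * phi n 0\<bar>\<^sup>2"

definition gain ::
  "(real \<Rightarrow> real) \<Rightarrow> real \<Rightarrow> real \<Rightarrow> (nat \<Rightarrow> real) \<Rightarrow> (nat \<Rightarrow> real \<Rightarrow> real) \<Rightarrow> real" where
  "gain p b1 b2 lam phi =
     p 0 / sqrt (b1\<^sup>2 + b2\<^sup>2) * sqrt (\<Sum>n. gain_term b1 b2 lam phi n)"

end

(*
  The eigenfunctions are complete: where 0 is not an eigenvalue, the Green operator of the boundary
  value problem is symmetric and compact for the weighted inner product, so a maximizing sequence for
  its norm on the orthogonal complement of the eigenfunctions would produce a further eigenfunction.
  With h the solution of the stationary problem with boundary value 1, put x = w + d(t) h. The series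
  for w and for its time derivative converge uniformly by the summability assumption, and comparing
  Fourier coefficients shows that w[t] is the Green operator applied to - w_t[t] - d'(t) h; this
  yields the regularity in z without differentiating the series in z. Every solution satisfies
  x_n' = - lambda_n x_n + kappa_n d with kappa_n = lambda_n h_n, from which uniqueness and, by
  Parseval's identity, the estimate follow.
*)
theory Submission
  imports Defs "HOL-Complex_Analysis.Great_Picard"
begin

section \<open>One-sided derivatives and classes of differentiability\<close>

text \<open>The argument stays among continuous functions with the inner product \<open>ip\<close>.
  This works because the Green operator bounds y and y' in the sup norm by the weighted norm of its
  input: limits obtained by compactness are uniform, hence again continuous. The summability
  assumption weighs the eigenfunctions by 1/\<lambda>_n, so a series converges uniformly once its
  coefficients are O(1/\<lambda>_n). The factor has three sources: a function of D is a Green image;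
  a mode with bounded forcing responds with size 1/\<lambda>_n; for the time derivative the forcing
  is differentiated once more, which uses d in C^2. The initial data are damped by \<lambda> exp(-
  \<lambda> t) <= 1/t, so the time derivative is controlled away from t = 0 only. The assumption
  says nothing about \<phi>_n', which rules out termwise differentiation in z.\<close>

lemma at_within_Icc_neq_bot:
  fixes z :: real
  assumes "z \<in> {0..1}"
  shows "at z within {0..1} \<noteq> bot"
proof -
  have "z islimpt {0..1}"
  proof (rule connected_imp_perfect)
    show "{0..1} \<noteq> {x}" for x :: real
      using atLeastAtMost_singleton_iff[of 0 "1::real" x] by auto
  qed (use assms in auto)
  then show ?thesis by (simp add: trivial_limit_within)
qed

lemma at_within_Ici_pos: "t > 0 \<Longrightarrow> at t within {0..} = at (t::real)"
  by (intro at_within_interior) auto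

lemma has_deriv_on:
  assumes "f differentiable_on S" "z \<in> S"
  shows "(f has_real_derivative deriv_on S f z) (at z within S)"
  using assms unfolding differentiable_on_def deriv_on_def
  by (simp add: has_real_derivative_iff_has_vector_derivative vector_derivative_works)

text \<open>\<open>vector_derivative\<close> is a choice among all derivatives; a nontrivial filter
  makes it unique, so that any derivative found at an endpoint is the chosen one.\<close>

lemma deriv_on_eqI:
  assumes "(f has_real_derivative d) (at z within S)" "at z within S \<noteq> bot"
  shows "deriv_on S f z = d"
  using assms unfolding deriv_on_def has_real_derivative_iff_has_vector_derivative
  by (simp add: vector_derivative_within)

lemma differentiable_onI_real:
  assumes "\<And>z. z \<in> S \<Longrightarrow> (f has_real_derivative f' z) (at z within S)"
  shows "f differentiable_on S"
  using assms unfolding differentiable_on_def has_field_derivative_def differentiable_def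
  by blast

text \<open>Both functions have the same candidates for the derivative at z, so the choice operator
  returns the same value, even when there is no candidate.\<close>

lemma deriv_on_cong:
  assumes eq: "\<And>x. x \<in> S \<Longrightarrow> f x = g x" and z: "z \<in> S"
  shows "deriv_on S f z = deriv_on S g z"
proof -
  have "(f has_vector_derivative d) (at z within S) = (g has_vector_derivative d) (at z within S)"
    for d
    unfolding has_vector_derivative_def
    using has_derivative_transform[OF z, of g f] has_derivative_transform[OF z, of f g] eq
    by (intro iffI) auto
  then show ?thesis unfolding deriv_on_def vector_derivative_def by simp
qed

lemma Ck_on_cong:
  assumes "\<And>x. x \<in> S \<Longrightarrow> f x = g x"
  shows "Ck_on k S f \<longleftrightarrow> Ck_on k S g"
  using assms
proof (induction k arbitrary: f g)
  case 0
  then show ?case by (simp cong: continuous_on_cong)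
next
  case (Suc k)
  have "Ck_on k S (deriv_on S f) = Ck_on k S (deriv_on S g)"
    by (rule Suc.IH) (rule deriv_on_cong[OF Suc.prems])
  moreover have "f differentiable_on S \<longleftrightarrow> g differentiable_on S"
    unfolding differentiable_on_def differentiable_def
    using has_derivative_transform[of _ S g f] has_derivative_transform[of _ S f g] Suc.prems
    by metis
  ultimately show ?case by simp
qed

lemma Ck_on_1D:
  assumes "Ck_on 1 S f"
  shows "\<And>z. z \<in> S \<Longrightarrow> (f has_real_derivative deriv_on S f z) (at z within S)"
    "continuous_on S f" "continuous_on S (deriv_on S f)"
  using assms has_deriv_on differentiable_imp_continuous_on by (auto simp: One_nat_def)

lemma Ck_on_2D:
  assumes "Ck_on 2 S f"
  shows "\<And>z. z \<in> S \<Longrightarrow> (f has_real_derivative deriv_on S f z) (at z within S)"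
    "\<And>z. z \<in> S \<Longrightarrow>
      (deriv_on S f has_real_derivative deriv_on S (deriv_on S f) z) (at z within S)"
    "continuous_on S f" "continuous_on S (deriv_on S f)"
    "continuous_on S (deriv_on S (deriv_on S f))"
  using assms has_deriv_on differentiable_imp_continuous_on
  by (auto simp: numeral_2_eq_2)

lemma Ck_on_2I:
  assumes f: "\<And>z. z \<in> S \<Longrightarrow> (f has_real_derivative f' z) (at z within S)"
    and f': "\<And>z. z \<in> S \<Longrightarrow> (f' has_real_derivative f'' z) (at z within S)"
    and c: "continuous_on S f''"
    and nb: "\<And>z. z \<in> S \<Longrightarrow> at z within S \<noteq> bot"
  shows "Ck_on 2 S f"
proof -
  have 1: "deriv_on S f z = f' z" if "z \<in> S" for z
    using f nb that deriv_on_eqI by blast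
  have "Ck_on 1 S f'"
  proof -
    have "deriv_on S f' z = f'' z" if "z \<in> S" for z
      using f' nb that deriv_on_eqI by blast
    then show ?thesis
      using c f' by (auto simp: One_nat_def intro: differentiable_onI_real cong: continuous_on_cong)
  qed
  then have "Ck_on 1 S (deriv_on S f)"
    using 1 Ck_on_cong by blast
  then show ?thesis
    using f by (auto simp: numeral_2_eq_2 intro: differentiable_onI_real)
qed

lemma Ck_on_2_mult:
  assumes f: "Ck_on 2 {0..1} f" and g: "Ck_on 2 {0..1} g"
  shows "Ck_on 2 {0..1} (\<lambda>z. f z * g z)"
proof -
  let ?D = "deriv_on {0..1}"
  note f' = Ck_on_2D[OF f] and g' = Ck_on_2D[OF g]
  show ?thesis
  proof (rule Ck_on_2I)
    fix z :: real assume z: "z \<in> {0..1}"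
    show "((\<lambda>z. f z * g z) has_real_derivative ?D f z * g z + ?D g z * f z) (at z within {0..1})"
      by (intro DERIV_mult f' g' z)
    show "((\<lambda>z. ?D f z * g z + ?D g z * f z) has_real_derivative
        (?D (?D f) z * g z + ?D g z * ?D f z) + (?D (?D g) z * f z + ?D f z * ?D g z))
        (at z within {0..1})"
      by (intro DERIV_add DERIV_mult f' g' z)
    show "at z within {0..1} \<noteq> bot" by (rule at_within_Icc_neq_bot[OF z])
  next
    show "continuous_on {0..1} (\<lambda>z. (?D (?D f) z * g z + ?D g z * ?D f z)
        + (?D (?D g) z * f z + ?D f z * ?D g z))"
      by (intro continuous_intros f' g')
  qed
qed

text \<open>Eigenfunctions satisfy their equation on the open interval only; density of (0,1) in
  [0,1] carries it to the endpoints.\<close>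

lemma continuous_eq_0_on_Icc:
  fixes f :: "real \<Rightarrow> real"
  assumes "continuous_on {0..1} f" "\<And>z. z \<in> {0<..<1} \<Longrightarrow> f z = 0" "z \<in> {0..1}"
  shows "f z = 0"
  using continuous_constant_on_closure[of "{0<..<1::real}" f 0 z] assms by simp

section \<open>Integrals of continuous functions on the unit interval\<close>

text \<open>The definitions use the Lebesgue integral, the proof the gauge integral; for continuous
  integrands the two agree.\<close>

lemma set_lebesgue_integral_eq_integral_continuous:
  fixes f :: "real \<Rightarrow> real"
  assumes "continuous_on {0..1} f"
  shows "(LINT z:{0..1}|lebesgue. f z) = integral {0..1} f"
  using set_lebesgue_integral_eq_integral(2)[OF absolutely_integrable_continuous_real[OF assms]] .

lemma integral_nonneg_eq_0:
  fixes f :: "real \<Rightarrow> real"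
  assumes c: "continuous_on {0..1} f" and nn: "\<And>z. z \<in> {0..1} \<Longrightarrow> f z \<ge> 0"
    and "integral {0..1} f \<le> 0" and z: "z \<in> {0..1}"
  shows "f z = 0"
proof -
  have i: "f integrable_on {0..1}" using c by (rule integrable_continuous_real)
  then have "integral {0..1} f = 0"
    using assms(3) integral_nonneg[OF i nn] by simp
  then have "(f has_integral 0) {0..1}"
    using i by (metis has_integral_integral)
  then show ?thesis
    using has_integral_0_cbox_imp_0[of 0 1 f z] c nn z by simp
qed

lemma abs_integral_le_const:
  fixes f :: "real \<Rightarrow> real"
  assumes c: "continuous_on {a..b} f" and "a \<le> b"
    and B: "\<And>z. z \<in> {a..b} \<Longrightarrow> \<bar>f z\<bar> \<le> B"
  shows "\<bar>integral {a..b} f\<bar> \<le> B * (b - a)"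
  using integral_bound[OF \<open>a \<le> b\<close> c, of B] B by simp

lemma continuous_on_Icc_bounded:
  fixes f :: "real \<Rightarrow> real"
  assumes "continuous_on {a..b} f"
  obtains B where "B > 0" "\<And>z. z \<in> {a..b} \<Longrightarrow> \<bar>f z\<bar> \<le> B"
proof -
  have "bounded (f ` {a..b})"
    using assms compact_continuous_image compact_imp_bounded by blast
  then show thesis
    using that by (auto simp: bounded_pos)
qed

section \<open>The Sturm--Liouville equation\<close>

locale sturm_liouville =
  fixes p q r :: "real \<Rightarrow> real" and a1 a2 b1 b2 :: real
  assumes p_C1: "Ck_on 1 {0..1} p" and p_pos: "z \<in> {0..1} \<Longrightarrow> p z > 0"
    and r_cont: "continuous_on {0..1} r" and r_pos: "z \<in> {0..1} \<Longrightarrow> r z > 0"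
    and q_cont: "continuous_on {0..1} q"
    and a_nontrivial: "\<bar>a1\<bar> + \<bar>a2\<bar> > 0" and b_nontrivial: "\<bar>b1\<bar> + \<bar>b2\<bar> > 0"
begin

text \<open>The quasi-derivative p f'. In the unknowns f and \<open>flux f\<close> the equation is a
  first-order system in which p' does not occur.\<close>

definition flux :: "(real \<Rightarrow> real) \<Rightarrow> real \<Rightarrow> real" where
  "flux f = (\<lambda>z. p z * deriv_on {0..1} f z)"

abbreviation flux' :: "(real \<Rightarrow> real) \<Rightarrow> real \<Rightarrow> real" where
  "flux' f \<equiv> deriv_on {0..1} (flux f)"

abbreviation dom :: "(real \<Rightarrow> real) set" where
  "dom \<equiv> sl_domain a1 a2 b1 b2"

lemma p_cont: "continuous_on {0..1} p"
  using Ck_on_1D(2)[OF p_C1] .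

lemma p_neq_0: "z \<in> {0..1} \<Longrightarrow> p z \<noteq> 0"
  using p_pos by fastforce

lemma deriv_eq_flux: "z \<in> {0..1} \<Longrightarrow> deriv_on {0..1} f z = flux f z / p z"
  using p_neq_0 by (simp add: flux_def)

lemma flux_derivatives:
  assumes "Ck_on 2 {0..1} f"
  shows "\<And>z. z \<in> {0..1} \<Longrightarrow> (flux f has_real_derivative flux' f z) (at z within {0..1})"
    "continuous_on {0..1} (flux f)" "continuous_on {0..1} (flux' f)"
proof -
  note f = Ck_on_2D[OF assms] and p = Ck_on_1D[OF p_C1]
  have *: "(flux f has_real_derivative p z * deriv_on {0..1} (deriv_on {0..1} f) z
      + deriv_on {0..1} p z * deriv_on {0..1} f z) (at z within {0..1})" if "z \<in> {0..1}" for z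
    unfolding flux_def using f(2)[OF that] p(1)[OF that]
    by (auto intro!: derivative_eq_intros)
  have eq: "flux' f z = p z * deriv_on {0..1} (deriv_on {0..1} f) z
      + deriv_on {0..1} p z * deriv_on {0..1} f z" if "z \<in> {0..1}" for z
    using deriv_on_eqI[OF *[OF that] at_within_Icc_neq_bot[OF that]] .
  show "(flux f has_real_derivative flux' f z) (at z within {0..1})" if "z \<in> {0..1}" for z
    using * eq that by simp
  show "continuous_on {0..1} (flux f)"
    unfolding flux_def using f p by (intro continuous_intros)
  show "continuous_on {0..1} (flux' f)"
    using f p by (subst continuous_on_cong[OF refl eq]) (auto intro!: continuous_intros)
qed

text \<open>Solutions are built as pairs y, v with y' = v/p; since p and v are differentiable, so is
  v/p, which gives the second derivative of y.\<close>

lemma Ck_on_2_of_system: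
  assumes y: "\<And>z. z \<in> {0..1} \<Longrightarrow> (y has_real_derivative v z / p z) (at z within {0..1})"
    and v: "\<And>z. z \<in> {0..1} \<Longrightarrow> (v has_real_derivative g z) (at z within {0..1})"
    and g: "continuous_on {0..1} g"
  shows "Ck_on 2 {0..1} y" "\<And>z. z \<in> {0..1} \<Longrightarrow> flux y z = v z"
    "\<And>z. z \<in> {0..1} \<Longrightarrow> flux' y z = g z"
proof -
  note p = Ck_on_1D[OF p_C1]
  have vc: "continuous_on {0..1} v"
    using v by (meson DERIV_continuous continuous_on_eq_continuous_within)
  show "Ck_on 2 {0..1} y"
  proof (rule Ck_on_2I[OF y])
    show "((\<lambda>z. v z / p z) has_real_derivative
        (g z * p z - v z * deriv_on {0..1} p z) / (p z * p z)) (at z within {0..1})"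
      if "z \<in> {0..1}" for z
      using v[OF that] p(1)[OF that] p_neq_0[OF that] by (auto intro!: derivative_eq_intros)
    show "continuous_on {0..1} (\<lambda>z. (g z * p z - v z * deriv_on {0..1} p z) / (p z * p z))"
      using g p vc p_neq_0 by (auto intro!: continuous_intros)
  qed (simp_all add: at_within_Icc_neq_bot)
  show eq: "flux y z = v z" if "z \<in> {0..1}" for z
    using deriv_on_eqI[OF y[OF that] at_within_Icc_neq_bot[OF that]] p_neq_0[OF that]
    by (simp add: flux_def)
  show "flux' y z = g z" if "z \<in> {0..1}" for z
    using deriv_on_cong[of "{0..1}", OF eq that] deriv_on_eqI[OF v[OF that] at_within_Icc_neq_bot[OF that]]
    by simp
qed

section \<open>Initial value problems for the homogeneous equation\<close>

lemma ivp_unique: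
  assumes y: "Ck_on 2 {0..1} y" and Q: "continuous_on {0..1} Q"
    and eq: "\<And>z. z \<in> {0<..<1} \<Longrightarrow> flux' y z = Q z * y z"
    and init: "y 0 = 0" "flux y 0 = 0" and z: "z \<in> {0..1}"
  shows "y z = 0"
proof -
  note yd = Ck_on_2D[OF y] and fd = flux_derivatives[OF y]
  have "continuous_on {0..1} (\<lambda>z. 1 / p z + Q z)"
    using p_cont p_neq_0 Q by (intro continuous_intros) auto
  then obtain K where K: "K > 0" "\<And>z. z \<in> {0..1} \<Longrightarrow> \<bar>1 / p z + Q z\<bar> \<le> K"
    using continuous_on_Icc_bounded by blast
  \<comment> \<open>Energy estimate: the derivative of y^2 + (flux y)^2 is 2 y (flux y) (1/p + Q),
    at most K times that sum, so the weighted energy cannot grow from its initial value 0.\<close>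
  define G where "G z = ((y z)\<^sup>2 + (flux y z)\<^sup>2) * exp (- K * z)" for z
  have "G z \<le> G 0"
  proof (rule DERIV_nonpos_imp_decreasing_open[of 0 z G])
    show "0 \<le> z" using z by auto
    show "continuous_on {0..z} G"
      unfolding G_def using yd(3) fd(2) z
      by (intro continuous_intros) (auto elim: continuous_on_subset)
    fix s assume s: "0 < s" "s < z"
    then have s': "s \<in> {0..1}" "s \<in> {0<..<1}" and at: "at s within {0..1} = at s"
      using z by (auto simp: at_within_Icc_at)
    have dy: "(y has_real_derivative flux y s / p s) (at s)"
      using yd(1)[OF s'(1)] deriv_eq_flux[OF s'(1)] at by metis
    have dv: "(flux y has_real_derivative Q s * y s) (at s)"
      using fd(1)[OF s'(1)] eq[OF s'(2)] at by metis
    have "(G has_real_derivative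
        (2 * (y s * flux y s) * (1 / p s + Q s) - K * ((y s)\<^sup>2 + (flux y s)\<^sup>2)) * exp (- K * s)) (at s)"
      unfolding G_def using p_neq_0[OF s'(1)]
      by (auto intro!: derivative_eq_intros dy dv simp: power2_eq_square) (simp add: field_simps)
    moreover have "2 * (y s * flux y s) * (1 / p s + Q s) \<le> K * ((y s)\<^sup>2 + (flux y s)\<^sup>2)"
    proof -
      have "2 * (y s * flux y s) * (1 / p s + Q s) \<le> \<bar>2 * (y s * flux y s)\<bar> * \<bar>1 / p s + Q s\<bar>"
        by (simp flip: abs_mult)
      also have "\<dots> \<le> ((y s)\<^sup>2 + (flux y s)\<^sup>2) * K"
      proof (rule mult_mono)
        show "\<bar>2 * (y s * flux y s)\<bar> \<le> (y s)\<^sup>2 + (flux y s)\<^sup>2"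
          using sum_squares_bound[of "y s" "flux y s"] sum_squares_bound[of "- y s" "flux y s"]
          by (simp add: abs_le_iff)
      qed (use K s' in auto)
      finally show ?thesis by (simp add: mult.commute)
    qed
    ultimately show "\<exists>d. (G has_real_derivative d) (at s) \<and> d \<le> 0"
      by (intro exI conjI) (auto simp: mult_le_0_iff)
  qed
  then have "(y z)\<^sup>2 + (flux y z)\<^sup>2 \<le> 0"
    using init by (auto simp: G_def mult_le_0_iff)
  then show ?thesis
    by (simp add: sum_power2_le_zero_iff)
qed

lemma ivp_exists:
  obtains y where "Ck_on 2 {0..1} y" "\<And>z. z \<in> {0..1} \<Longrightarrow> flux' y z = q z * y z"
    "y 0 = \<alpha>" "flux y 0 = \<gamma>"
proof -
  \<comment> \<open>Integrating flux' y = q y gives the flux as \<gamma> + \<open>inner y\<close>;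
    dividing by p and integrating again gives y = \<open>y0\<close> + \<open>step y\<close>. The
    iterates of \<open>step\<close> are summed as a Neumann series.\<close>
  define inner where "inner f s = integral {0..s} (\<lambda>x. q x * f x)" for f :: "real \<Rightarrow> real" and s
  define step where "step f z = integral {0..z} (\<lambda>s. inner f s / p s)" for f z
  define y0 where "y0 z = \<alpha> + integral {0..z} (\<lambda>s. \<gamma> / p s)" for z
  define Y where "Y k = (step ^^ k) y0" for k :: nat

  have inner_deriv: "(inner f has_real_derivative q z * f z) (at z within {0..1})"
    if "continuous_on {0..1} f" "z \<in> {0..1}" for f z
    unfolding inner_def
    by (rule integral_has_real_derivative) (use that q_cont in \<open>auto intro!: continuous_intros\<close>)
  have inner_cont: "continuous_on {0..1} (inner f)" if "continuous_on {0..1} f" for f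
    using inner_deriv[OF that] by (meson DERIV_continuous continuous_on_eq_continuous_within)
  have inner_p_cont: "continuous_on {0..1} (\<lambda>s. inner f s / p s)" if "continuous_on {0..1} f" for f
    using inner_cont[OF that] p_cont p_neq_0 by (auto intro!: continuous_intros)
  have step_deriv: "(step f has_real_derivative inner f z / p z) (at z within {0..1})"
    if "continuous_on {0..1} f" "z \<in> {0..1}" for f z
    unfolding step_def using integral_has_real_derivative[OF inner_p_cont[OF that(1)] that(2)] .
  have step_cont: "continuous_on {0..1} (step f)" if "continuous_on {0..1} f" for f
    using step_deriv[OF that] by (meson DERIV_continuous continuous_on_eq_continuous_within)
  have y0_deriv: "(y0 has_real_derivative \<gamma> / p z) (at z within {0..1})" if "z \<in> {0..1}" for z
  proof -
    have "((\<lambda>z. integral {0..z} (\<lambda>s. \<gamma> / p s)) has_real_derivative \<gamma> / p z) (at z within {0..1})"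
      by (rule integral_has_real_derivative)
        (use that p_cont p_neq_0 in \<open>auto intro!: continuous_intros\<close>)
    then show ?thesis unfolding y0_def by (auto intro!: derivative_eq_intros)
  qed
  have y0_cont: "continuous_on {0..1} y0"
    using y0_deriv by (meson DERIV_continuous continuous_on_eq_continuous_within)
  have Y_cont: "continuous_on {0..1} (Y k)" for k
    by (induction k) (use y0_cont step_cont in \<open>auto simp: Y_def\<close>)
  have step_diff: "step f z - step g z = step (\<lambda>x. f x - g x) z"
    if "continuous_on {0..1} f" "continuous_on {0..1} g" "z \<in> {0..1}" for f g z
  proof -
    have 1: "inner f s - inner g s = inner (\<lambda>x. f x - g x) s" if s: "s \<in> {0..z}" for s
    proof -
      have "continuous_on {0..s} (\<lambda>x. q x * f x)" "continuous_on {0..s} (\<lambda>x. q x * g x)"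
        using that \<open>z \<in> {0..1}\<close> \<open>continuous_on {0..1} f\<close> \<open>continuous_on {0..1} g\<close> q_cont
        by (auto intro!: continuous_intros elim!: continuous_on_subset)
      then show ?thesis
        unfolding inner_def
        by (simp add: integral_diff integrable_continuous_real algebra_simps)
    qed
    have "continuous_on {0..z} (\<lambda>s. inner f s / p s)" "continuous_on {0..z} (\<lambda>s. inner g s / p s)"
      using inner_p_cont[OF that(1)] inner_p_cont[OF that(2)] that(3)
      by (auto elim!: continuous_on_subset)
    then have "step f z - step g z = integral {0..z} (\<lambda>s. inner f s / p s - inner g s / p s)"
      unfolding step_def by (simp add: integral_diff integrable_continuous_real)
    also have "\<dots> = step (\<lambda>x. f x - g x) z"
      unfolding step_def by (rule integral_cong) (simp add: 1 flip: diff_divide_distrib)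
    finally show ?thesis .
  qed

  obtain Qm where Qm: "Qm > 0" "\<And>z. z \<in> {0..1} \<Longrightarrow> \<bar>q z\<bar> \<le> Qm"
    using continuous_on_Icc_bounded[OF q_cont] by blast
  have "continuous_on {0..1} (\<lambda>z. 1 / p z)"
    using p_cont p_neq_0 by (intro continuous_intros) auto
  then obtain Pm where Pm: "Pm > 0" "\<And>z. z \<in> {0..1} \<Longrightarrow> \<bar>1 / p z\<bar> \<le> Pm"
    using continuous_on_Icc_bounded by blast
  \<comment> \<open>Weighted sup norm: measured against exp(\<Lambda> z), the outer integral gains
    1/\<Lambda>, and this choice makes \<open>step\<close> a contraction with factor Qm Pm /
    \<Lambda> = 1/2.\<close>
  define \<Lambda> where "\<Lambda> = 2 * Qm * Pm"
  have \<Lambda>: "\<Lambda> > 0" using Qm Pm by (simp add: \<Lambda>_def)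
  have step_bound: "\<bar>step f z\<bar> \<le> B / 2 * exp (\<Lambda> * z)"
    if f: "continuous_on {0..1} f" "\<And>x. x \<in> {0..1} \<Longrightarrow> \<bar>f x\<bar> \<le> B * exp (\<Lambda> * x)"
      and "z \<in> {0..1}" for f B z
  proof -
    have "0 \<le> \<bar>f 0\<bar>" "\<bar>f 0\<bar> \<le> B" using f(2)[of 0] by auto
    then have B: "B \<ge> 0" by linarith
    have inner_le: "\<bar>inner f s\<bar> \<le> Qm * (B * exp (\<Lambda> * s))" if "s \<in> {0..1}" for s
    proof -
      have "\<bar>inner f s\<bar> \<le> Qm * (B * exp (\<Lambda> * s)) * (s - 0)"
        unfolding inner_def
      proof (rule abs_integral_le_const)
        show "continuous_on {0..s} (\<lambda>x. q x * f x)"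
          using that f q_cont by (auto intro!: continuous_intros elim!: continuous_on_subset)
        fix x assume x: "x \<in> {0..s}"
        have "\<bar>f x\<bar> \<le> B * exp (\<Lambda> * x)" using f(2) x that by auto
        also have "\<dots> \<le> B * exp (\<Lambda> * s)"
          using B x \<Lambda> by (intro mult_left_mono) auto
        finally show "\<bar>q x * f x\<bar> \<le> Qm * (B * exp (\<Lambda> * s))"
          using Qm x that by (auto simp: abs_mult intro!: mult_mono)
      qed (use that in auto)
      also have "\<dots> \<le> Qm * (B * exp (\<Lambda> * s)) * 1"
        using that Qm B by (intro mult_left_mono) auto
      finally show ?thesis by simp
    qed
    have "((\<lambda>s. Pm * Qm * B * exp (\<Lambda> * s)) has_integral
        (Pm * Qm * B * exp (\<Lambda> * z) / \<Lambda> - Pm * Qm * B * exp (\<Lambda> * 0) / \<Lambda>)) {0..z}"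
      using \<Lambda> \<open>z \<in> {0..1}\<close>
      by (intro fundamental_theorem_of_calculus)
        (auto intro!: derivative_eq_intros simp flip: has_real_derivative_iff_has_vector_derivative)
    then have I: "(\<lambda>s. Pm * Qm * B * exp (\<Lambda> * s)) integrable_on {0..z}"
      "integral {0..z} (\<lambda>s. Pm * Qm * B * exp (\<Lambda> * s)) = B / 2 * exp (\<Lambda> * z) - B / 2"
      using \<Lambda> Qm Pm by (auto simp: has_integral_iff \<Lambda>_def divide_simps)
    have "norm (step f z) \<le> integral {0..z} (\<lambda>s. Pm * Qm * B * exp (\<Lambda> * s))"
      unfolding step_def
    proof (rule integral_norm_bound_integral[OF _ I(1)])
      show "(\<lambda>s. inner f s / p s) integrable_on {0..z}"
        using inner_p_cont[OF f(1)] \<open>z \<in> {0..1}\<close>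
        by (auto intro!: integrable_continuous_real elim!: continuous_on_subset)
      fix s assume "s \<in> {0..z}"
      then have s: "s \<in> {0..1}" using \<open>z \<in> {0..1}\<close> by auto
      have "\<bar>1 / p s\<bar> * \<bar>inner f s\<bar> \<le> Pm * (Qm * (B * exp (\<Lambda> * s)))"
        using Pm(2)[OF s] inner_le[OF s] Pm by (intro mult_mono) auto
      then show "norm (inner f s / p s) \<le> Pm * Qm * B * exp (\<Lambda> * s)"
        by (simp add: abs_mult mult_ac)
    qed
    then show ?thesis using I(2) B by simp
  qed
  obtain B where B: "B > 0" "\<And>z. z \<in> {0..1} \<Longrightarrow> \<bar>y0 z\<bar> \<le> B"
    using continuous_on_Icc_bounded[OF y0_cont] by blast
  have Y_bound: "\<bar>Y k z\<bar> \<le> B * (1 / 2) ^ k * exp (\<Lambda> * z)" if "z \<in> {0..1}" for k z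
    using that
  proof (induction k arbitrary: z)
    case 0
    have "B * 1 \<le> B * exp (\<Lambda> * z)"
      using B \<Lambda> 0 by (intro mult_left_mono) auto
    then show ?case using B(2)[OF 0] by (simp add: Y_def)
  next
    case (Suc k)
    then show ?case
      using step_bound[OF Y_cont Suc.IH Suc.prems] by (simp add: Y_def)
  qed
  define y where "y z = (\<Sum>k. Y k z)" for z
  have unif: "uniform_limit {0..1} (\<lambda>n z. \<Sum>k<n. Y k z) y sequentially"
    unfolding y_def
  proof (rule Weierstrass_m_test)
    fix k z assume "z \<in> {0..1::real}"
    then have "B * (1 / 2) ^ k * exp (\<Lambda> * z) \<le> B * (1 / 2) ^ k * exp \<Lambda>"
      using B \<Lambda> by (intro mult_left_mono) auto
    then show "norm (Y k z) \<le> B * (1 / 2) ^ k * exp \<Lambda>"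
      using Y_bound[OF \<open>z \<in> {0..1}\<close>, of k] by simp
  qed (auto intro!: summable_mult summable_mult2 summable_geometric)
  have partial_cont: "continuous_on {0..1} (\<lambda>z. \<Sum>k<n. Y k z)" for n
    using Y_cont by (intro continuous_intros)
  have y_cont: "continuous_on {0..1} y"
    by (rule uniform_limit_theorem[OF _ unif]) (simp_all add: partial_cont)
  \<comment> \<open>Each partial sum is \<open>y0\<close> plus \<open>step\<close> of the previous
    one; the contraction bound lets uniform convergence pass through \<open>step\<close>.\<close>
  have fixpoint: "y z = y0 z + step y z" if z: "z \<in> {0..1}" for z
  proof -
    have partial: "(\<Sum>k<Suc n. Y k z) = y0 z + step (\<lambda>z. \<Sum>k<n. Y k z) z" if "z \<in> {0..1}" for n z
    proof (induction n)
      case 0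
      show ?case by (simp add: Y_def step_def inner_def)
    next
      case (Suc n)
      have "step (\<lambda>z. \<Sum>k<Suc n. Y k z) z - step (\<lambda>z. \<Sum>k<n. Y k z) z = step (Y n) z"
        using step_diff[OF partial_cont partial_cont that, of "Suc n" n] by simp
      moreover have "step (Y n) z = Y (Suc n) z" by (simp add: Y_def)
      ultimately show ?case using Suc by simp
    qed
    have "(\<lambda>n. step (\<lambda>z. \<Sum>k<n. Y k z) z) \<longlonglongrightarrow> step y z"
    proof (rule LIMSEQ_I)
      fix e :: real assume e: "e > 0"
      have "e / exp \<Lambda> > 0" using e by simp
      from uniform_limitD[OF unif this] obtain N where
        N: "\<And>n x. n \<ge> N \<Longrightarrow> x \<in> {0..1} \<Longrightarrow> \<bar>(\<Sum>k<n. Y k x) - y x\<bar> < e / exp \<Lambda>"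
        unfolding eventually_sequentially dist_real_def by blast
      have "norm (step (\<lambda>z. \<Sum>k<n. Y k z) z - step y z) < e" if "n \<ge> N" for n
      proof -
        have "\<bar>step (\<lambda>z. (\<Sum>k<n. Y k z) - y z) z\<bar> \<le> e / exp \<Lambda> / 2 * exp (\<Lambda> * z)"
        proof (rule step_bound)
          fix x assume x: "x \<in> {0..1::real}"
          have "e / exp \<Lambda> * 1 \<le> e / exp \<Lambda> * exp (\<Lambda> * x)"
            using e \<Lambda> x by (intro mult_left_mono) auto
          then show "\<bar>(\<Sum>k<n. Y k x) - y x\<bar> \<le> e / exp \<Lambda> * exp (\<Lambda> * x)"
            using N[OF that x] by simp
        qed (use Y_cont y_cont z in \<open>auto intro!: continuous_intros\<close>)
        also have "\<dots> \<le> e / exp \<Lambda> / 2 * exp \<Lambda>"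
          using e \<Lambda> z by (intro mult_left_mono) auto
        also have "\<dots> < e" using e by simp
        finally show ?thesis
          using step_diff[OF partial_cont y_cont z] by simp
      qed
      then show "\<exists>N. \<forall>n\<ge>N. norm (step (\<lambda>z. \<Sum>k<n. Y k z) z - step y z) < e" by blast
    qed
    then have "(\<lambda>n. \<Sum>k<Suc n. Y k z) \<longlonglongrightarrow> y0 z + step y z"
      unfolding partial[OF z] by (intro tendsto_intros)
    moreover have "(\<lambda>n. \<Sum>k<n. Y k z) \<longlonglongrightarrow> y z"
      using tendsto_uniform_limitI[OF unif z] .
    ultimately show ?thesis
      using LIMSEQ_unique LIMSEQ_Suc by blast
  qed
  have d: "(y has_real_derivative (\<gamma> + inner y z) / p z) (at z within {0..1})" if "z \<in> {0..1}" for z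
  proof -
    have "((\<lambda>z. y0 z + step y z) has_real_derivative \<gamma> / p z + inner y z / p z) (at z within {0..1})"
      by (intro DERIV_add y0_deriv step_deriv y_cont that)
    then show ?thesis
      using fixpoint that
      by (subst has_field_derivative_cong_eventually[where g = "\<lambda>z. y0 z + step y z"])
        (auto simp: eventually_at add_divide_distrib intro!: exI[of _ 1])
  qed
  have v: "((\<lambda>z. \<gamma> + inner y z) has_real_derivative q z * y z) (at z within {0..1})"
    if "z \<in> {0..1}" for z
    using inner_deriv[OF y_cont that] by (auto intro!: derivative_eq_intros)
  have c: "continuous_on {0..1} (\<lambda>z. q z * y z)"
    using q_cont y_cont by (intro continuous_intros)
  note * = Ck_on_2_of_system[OF d v c]
  show thesis
  proof (rule that)
    show "Ck_on 2 {0..1} y" using *(1) by simp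
    show "flux' y z = q z * y z" if "z \<in> {0..1}" for z using *(3)[of z] that by simp
    show "y 0 = \<alpha>" using fixpoint[of 0] by (simp add: y0_def step_def)
    show "flux y 0 = \<gamma>" using *(2)[of 0] by (simp add: inner_def)
  qed
qed

section \<open>The weighted inner product\<close>

definition ip :: "(real \<Rightarrow> real) \<Rightarrow> (real \<Rightarrow> real) \<Rightarrow> real" where
  "ip f g = integral {0..1} (\<lambda>z. r z * f z * g z)"

definition nrm :: "(real \<Rightarrow> real) \<Rightarrow> real" where
  "nrm f = sqrt (ip f f)"

lemma ip_integrable:
  assumes "continuous_on {0..1} f" "continuous_on {0..1} g"
  shows "(\<lambda>z. r z * f z * g z) integrable_on {0..1}"
  using assms r_cont by (intro integrable_continuous_real continuous_intros)

lemma inner_r_eq_ip: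
  assumes "continuous_on {0..1} f" "continuous_on {0..1} g"
  shows "inner_r r f g = ip f g"
  unfolding inner_r_def ip_def using assms r_cont
  by (intro set_lebesgue_integral_eq_integral_continuous continuous_intros)

lemma norm_r_eq_nrm:
  assumes "continuous_on {0..1} f"
  shows "norm_r r f = nrm f"
proof -
  have "(LINT z:{0..1}|lebesgue. r z * \<bar>f z\<bar>\<^sup>2) = ip f f"
    unfolding ip_def using assms r_cont
    by (subst set_lebesgue_integral_eq_integral_continuous)
      (auto simp: power2_eq_square mult.assoc intro!: continuous_intros)
  then show ?thesis by (simp add: norm_r_def nrm_def)
qed

lemma ip_cong:
  assumes "\<And>z. z \<in> {0..1} \<Longrightarrow> f z = f' z" "\<And>z. z \<in> {0..1} \<Longrightarrow> g z = g' z"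
  shows "ip f g = ip f' g'"
  unfolding ip_def using assms by (intro integral_cong) simp

lemma ip_commute: "ip f g = ip g f"
  unfolding ip_def by (simp add: mult_ac)

lemma ip_lincomb_left:
  assumes "continuous_on {0..1} f" "continuous_on {0..1} g" "continuous_on {0..1} h"
  shows "ip (\<lambda>z. a * f z + b * g z) h = a * ip f h + b * ip g h"
proof -
  have "ip (\<lambda>z. a * f z + b * g z) h
      = integral {0..1} (\<lambda>z. a * (r z * f z * h z) + b * (r z * g z * h z))"
    unfolding ip_def by (simp add: algebra_simps)
  also have "\<dots> = a * ip f h + b * ip g h"
    unfolding ip_def using ip_integrable assms
    by (subst integral_add) (auto intro!: integrable_on_mult_right)
  finally show ?thesis .
qed

lemma ip_lincomb_right:
  assumes "continuous_on {0..1} f" "continuous_on {0..1} g" "continuous_on {0..1} h"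
  shows "ip h (\<lambda>z. a * f z + b * g z) = a * ip h f + b * ip h g"
  using ip_lincomb_left[OF assms] by (simp add: ip_commute)

lemma ip_scale_left: "ip (\<lambda>z. c * f z) g = c * ip f g"
proof -
  have "ip (\<lambda>z. c * f z) g = integral {0..1} (\<lambda>z. c * (r z * f z * g z))"
    unfolding ip_def by (simp add: mult_ac)
  then show ?thesis by (simp add: ip_def)
qed

lemma ip_diff_left:
  assumes "continuous_on {0..1} f" "continuous_on {0..1} g" "continuous_on {0..1} h"
  shows "ip (\<lambda>z. f z - g z) h = ip f h - ip g h"
  using ip_lincomb_left[OF assms, of 1 "-1"] by simp

lemma ip_sum_left:
  assumes "\<And>n. n \<in> N \<Longrightarrow> continuous_on {0..1} (f n)" "continuous_on {0..1} g"
  shows "ip (\<lambda>z. \<Sum>n\<in>N. c n * f n z) g = (\<Sum>n\<in>N. c n * ip (f n) g)"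
  using assms(1)
proof (induction N rule: infinite_finite_induct)
  case (insert n N)
  have "ip (\<lambda>z. c n * f n z + 1 * (\<Sum>n\<in>N. c n * f n z)) g
      = c n * ip (f n) g + 1 * ip (\<lambda>z. \<Sum>n\<in>N. c n * f n z) g"
    using insert.prems assms(2) by (intro ip_lincomb_left continuous_intros) auto
  then show ?case using insert by simp
qed (simp_all add: ip_def)

lemma ip_self_nonneg:
  assumes "continuous_on {0..1} f"
  shows "ip f f \<ge> 0"
  unfolding ip_def using assms r_pos ip_integrable[of f f]
  by (intro integral_nonneg) (auto simp: mult.assoc less_imp_le)

lemma nrm_nonneg: "nrm f \<ge> 0" if "continuous_on {0..1} f"
  using ip_self_nonneg[OF that] by (simp add: nrm_def)

lemma nrm_power2: "(nrm f)\<^sup>2 = ip f f" if "continuous_on {0..1} f"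
  using ip_self_nonneg[OF that] by (simp add: nrm_def)

lemma nrm_cong: "(\<And>z. z \<in> {0..1} \<Longrightarrow> f z = g z) \<Longrightarrow> nrm f = nrm g"
  unfolding nrm_def by (metis ip_cong)

lemma ip_self_eq_0D:
  assumes f: "continuous_on {0..1} f" and "ip f f \<le> 0" "z \<in> {0..1}"
  shows "f z = 0"
proof -
  have "r z * f z * f z = 0"
    using assms r_pos r_cont unfolding ip_def
    by (intro integral_nonneg_eq_0[where f = "\<lambda>z. r z * f z * f z"])
      (auto intro!: continuous_intros simp: mult.assoc less_imp_le)
  then show ?thesis using r_pos assms(3) by fastforce
qed

lemma nrm_eq_0D:
  assumes "continuous_on {0..1} f" "nrm f \<le> 0" "z \<in> {0..1}"
  shows "f z = 0"
proof -
  have "ip f f \<le> 0" using assms by (simp add: nrm_def)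
  then show ?thesis using ip_self_eq_0D assms by blast
qed

text \<open>Expand the squared norm of \<open>ip g g\<close> f - \<open>ip f g\<close> g. Clearing
  the denominator of the projection leaves the case \<open>ip g g\<close> = 0 apart, in which g
  vanishes on [0,1].\<close>

lemma cauchy_schwarz:
  assumes f: "continuous_on {0..1} f" and g: "continuous_on {0..1} g"
  shows "\<bar>ip f g\<bar> \<le> nrm f * nrm g"
proof -
  let ?h = "\<lambda>z. ip g g * f z + (- ip f g) * g z"
  have h: "continuous_on {0..1} ?h" using f g by (intro continuous_intros)
  have "ip ?h ?h = ip g g * (ip g g * ip f f - (ip f g)\<^sup>2)"
    unfolding ip_lincomb_left[OF f g h] ip_lincomb_right[OF f g f] ip_lincomb_right[OF f g g]
    by (simp add: ip_commute[of g f] algebra_simps power2_eq_square)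
  then have 1: "0 \<le> ip g g * (ip g g * ip f f - (ip f g)\<^sup>2)"
    using ip_self_nonneg[OF h] by simp
  have "(ip f g)\<^sup>2 \<le> ip f f * ip g g"
  proof (cases "ip g g = 0")
    case True
    then have "ip f g = ip f (\<lambda>_. 0)"
      using ip_self_eq_0D[OF g] by (intro ip_cong) auto
    then show ?thesis using True by (simp add: ip_def)
  next
    case False
    then have "ip g g > 0" using ip_self_nonneg[OF g] by simp
    then show ?thesis using 1 by (simp add: zero_le_mult_iff mult.commute)
  qed
  then have "sqrt ((ip f g)\<^sup>2) \<le> sqrt (ip f f * ip g g)"
    by (rule real_sqrt_le_mono)
  then show ?thesis by (simp add: nrm_def real_sqrt_mult)
qed

lemma nrm_scale: "nrm (\<lambda>z. c * f z) = \<bar>c\<bar> * nrm f"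
  unfolding nrm_def ip_scale_left by (subst ip_commute)
    (simp add: ip_scale_left real_sqrt_mult mult.assoc[symmetric] real_sqrt_mult_self)

lemma nrm_le_const:
  assumes f: "continuous_on {0..1} f" and "\<And>z. z \<in> {0..1} \<Longrightarrow> \<bar>f z\<bar> \<le> B"
  shows "nrm f \<le> B * sqrt (integral {0..1} r)"
proof -
  have B: "B \<ge> 0" using assms(2)[of 0] by force
  have "ip f f \<le> integral {0..1} (\<lambda>z. B\<^sup>2 * r z)"
    unfolding ip_def
  proof (rule integral_le)
    fix z :: real assume z: "z \<in> {0..1}"
    have "(f z)\<^sup>2 \<le> B\<^sup>2"
      using assms(2)[OF z] B by (metis abs_le_square_iff abs_of_nonneg)
    then show "r z * f z * f z \<le> B\<^sup>2 * r z"
      using r_pos[OF z] by (simp add: power2_eq_square mult.commute mult.left_commute mult_le_cancel_left_pos)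
  qed (use f r_cont in \<open>auto intro!: integrable_continuous_real continuous_intros\<close>)
  then have "sqrt (ip f f) \<le> sqrt (B\<^sup>2 * integral {0..1} r)"
    by simp
  then show ?thesis using B by (simp add: nrm_def real_sqrt_mult)
qed

text \<open>The integrals in the Green function run over [0,z] and [z,1]. Absolute values come
  first, so that the integrand is nonnegative and the interval can be enlarged before
  Cauchy-Schwarz.\<close>

lemma partial_ip_le:
  assumes f: "continuous_on {0..1} f" and g: "continuous_on {0..1} g"
    and cd: "{c..d} \<subseteq> {0..1}"
  shows "\<bar>integral {c..d} (\<lambda>z. r z * f z * g z)\<bar> \<le> nrm f * nrm g"
proof -
  let ?h = "\<lambda>z. r z * \<bar>f z\<bar> * \<bar>g z\<bar>"
  have c: "continuous_on {0..1} (\<lambda>z. r z * f z * g z)" "continuous_on {0..1} ?h"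
    using f g r_cont by (intro continuous_intros; simp)+
  then have i: "(\<lambda>z. r z * f z * g z) integrable_on {c..d}" "?h integrable_on {c..d}"
    "?h integrable_on {0..1}"
    using cd by (auto intro!: integrable_continuous_real elim: continuous_on_subset)
  have "norm (integral {c..d} (\<lambda>z. r z * f z * g z)) \<le> integral {c..d} ?h"
    using i(1,2) r_pos cd
    by (intro integral_norm_bound_integral) (auto simp: abs_mult abs_of_pos subset_iff)
  also have "\<dots> \<le> integral {0..1} ?h"
    using cd i r_pos by (intro integral_subset_le) (auto simp: less_imp_le)
  also have "\<dots> = ip (\<lambda>z. \<bar>f z\<bar>) (\<lambda>z. \<bar>g z\<bar>)"
    by (simp add: ip_def)
  also have "\<dots> \<le> nrm (\<lambda>z. \<bar>f z\<bar>) * nrm (\<lambda>z. \<bar>g z\<bar>)"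
    using cauchy_schwarz[of "\<lambda>z. \<bar>f z\<bar>" "\<lambda>z. \<bar>g z\<bar>"] f g
    by (simp add: continuous_on_rabs)
  also have "\<dots> = nrm f * nrm g"
    by (simp add: nrm_def ip_def mult.assoc)
  finally show ?thesis by simp
qed

lemma nrm_triangle:
  assumes f: "continuous_on {0..1} f" and g: "continuous_on {0..1} g"
  shows "nrm (\<lambda>z. f z + g z) \<le> nrm f + nrm g"
proof -
  have c: "continuous_on {0..1} (\<lambda>z. 1 * f z + 1 * g z)" using f g by (intro continuous_intros)
  have "ip (\<lambda>z. 1 * f z + 1 * g z) (\<lambda>z. 1 * f z + 1 * g z) = ip f f + 2 * ip f g + ip g g"
    unfolding ip_lincomb_left[OF f g c] ip_lincomb_right[OF f g f] ip_lincomb_right[OF f g g]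
    by (simp add: ip_commute[of g f])
  then have "ip (\<lambda>z. f z + g z) (\<lambda>z. f z + g z) = (nrm f)\<^sup>2 + 2 * ip f g + (nrm g)\<^sup>2"
    using nrm_power2 f g by simp
  also have "\<dots> \<le> (nrm f + nrm g)\<^sup>2"
    using cauchy_schwarz[OF f g] by (simp add: power2_sum)
  finally show ?thesis
    unfolding nrm_def[of "\<lambda>z. f z + g z"] using nrm_nonneg f g by (intro real_le_lsqrt) auto
qed

lemma nrm_diff_triangle:
  assumes "continuous_on {0..1} f" "continuous_on {0..1} g" "continuous_on {0..1} h"
  shows "nrm (\<lambda>z. f z - h z) \<le> nrm (\<lambda>z. f z - g z) + nrm (\<lambda>z. g z - h z)"
  using nrm_triangle[of "\<lambda>z. f z - g z" "\<lambda>z. g z - h z"] assms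
  by (simp add: continuous_intros)

lemma nrm_le_nrm_diff:
  assumes "continuous_on {0..1} f" "continuous_on {0..1} g"
  shows "\<bar>nrm f - nrm g\<bar> \<le> nrm (\<lambda>z. f z - g z)"
proof -
  have "nrm (\<lambda>z. g z - f z) = nrm (\<lambda>z. f z - g z)"
    using nrm_scale[of "-1" "\<lambda>z. f z - g z"] by simp
  then show ?thesis
    using nrm_triangle[of "\<lambda>z. f z - g z" g] nrm_triangle[of "\<lambda>z. g z - f z" f] assms
    by (simp add: continuous_intros)
qed

section \<open>Convergence in the weighted norm\<close>

lemma nrm_uniform_limit:
  assumes unif: "uniform_limit {0..1} f g sequentially"
    and f: "\<And>n. continuous_on {0..1} (f n)"
  shows "continuous_on {0..1} g" "(\<lambda>n. nrm (\<lambda>z. f n z - g z)) \<longlonglongrightarrow> 0"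
proof -
  show g: "continuous_on {0..1} g"
    by (rule uniform_limit_theorem[OF _ unif]) (simp_all add: f)
  define R where "R = sqrt (integral {0..1} r)"
  have R: "R \<ge> 0" unfolding R_def using r_cont r_pos
    by (intro real_sqrt_ge_zero integral_nonneg integrable_continuous_real) (auto simp: less_imp_le)
  show "(\<lambda>n. nrm (\<lambda>z. f n z - g z)) \<longlonglongrightarrow> 0"
  proof (rule LIMSEQ_I)
    fix e :: real assume e: "e > 0"
    then have "e / (R + 1) > 0" using R by simp
    from uniform_limitD[OF unif this] obtain N where
      N: "\<And>n z. n \<ge> N \<Longrightarrow> z \<in> {0..1} \<Longrightarrow> \<bar>f n z - g z\<bar> < e / (R + 1)"
      unfolding eventually_sequentially dist_real_def by blast
    have "norm (nrm (\<lambda>z. f n z - g z) - 0) < e" if "n \<ge> N" for n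
    proof -
      have c: "continuous_on {0..1} (\<lambda>z. f n z - g z)" using f g by (intro continuous_intros)
      have "nrm (\<lambda>z. f n z - g z) \<le> e / (R + 1) * R"
        unfolding R_def using N[OF that] by (intro nrm_le_const c) (auto simp: R_def less_imp_le)
      also have "\<dots> < e" using e R by (simp add: field_simps)
      finally show ?thesis using nrm_nonneg[OF c] by simp
    qed
    then show "\<exists>N. \<forall>n\<ge>N. norm (nrm (\<lambda>z. f n z - g z) - 0) < e" by blast
  qed
qed

lemma ip_tendsto:
  assumes f: "\<And>n. continuous_on {0..1} (f n)" and g: "continuous_on {0..1} g"
    and h: "continuous_on {0..1} h" and lim: "(\<lambda>n. nrm (\<lambda>z. f n z - g z)) \<longlonglongrightarrow> 0"
  shows "(\<lambda>n. ip (f n) h) \<longlonglongrightarrow> ip g h"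
proof (rule LIM_zero_cancel, rule Lim_null_comparison)
  have "\<bar>ip (f n) h - ip g h\<bar> \<le> nrm (\<lambda>z. f n z - g z) * nrm h" for n
    using cauchy_schwarz[OF continuous_on_diff[OF f g] h] by (simp add: ip_diff_left[OF f g h])
  then show "\<forall>\<^sub>F n in sequentially. norm (ip (f n) h - ip g h) \<le> nrm (\<lambda>z. f n z - g z) * nrm h"
    by simp
  show "(\<lambda>n. nrm (\<lambda>z. f n z - g z) * nrm h) \<longlonglongrightarrow> 0"
    using tendsto_mult_right[OF lim, of "nrm h"] by simp
qed

section \<open>Boundary conditions and eigenfunctions\<close>

lemma domD:
  assumes "f \<in> dom"
  shows "Ck_on 2 {0..1} f" "b1 * f 0 + b2 * deriv_on {0..1} f 0 = 0"
    "a1 * f 1 + a2 * deriv_on {0..1} f 1 = 0" "continuous_on {0..1} f"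
  using assms Ck_on_2D by (auto simp: sl_domain_def)

lemma deriv_on_lincomb:
  assumes "Ck_on 2 {0..1} f" "Ck_on 2 {0..1} g" "z \<in> {0..1}"
  shows "deriv_on {0..1} (\<lambda>z. a * f z + b * g z) z
    = a * deriv_on {0..1} f z + b * deriv_on {0..1} g z"
  by (intro deriv_on_eqI DERIV_add DERIV_cmult Ck_on_2D(1) at_within_Icc_neq_bot assms)

lemma lincomb:
  assumes f: "Ck_on 2 {0..1} f" and g: "Ck_on 2 {0..1} g"
  shows "Ck_on 2 {0..1} (\<lambda>z. a * f z + b * g z)"
    "\<And>z. z \<in> {0..1} \<Longrightarrow> flux (\<lambda>z. a * f z + b * g z) z = a * flux f z + b * flux g z"
    "\<And>z. z \<in> {0..1} \<Longrightarrow> flux' (\<lambda>z. a * f z + b * g z) z = a * flux' f z + b * flux' g z"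
proof -
  have y: "((\<lambda>z. a * f z + b * g z) has_real_derivative (a * flux f z + b * flux g z) / p z)
      (at z within {0..1})" if "z \<in> {0..1}" for z
    using Ck_on_2D(1)[OF f that] Ck_on_2D(1)[OF g that] p_neq_0[OF that]
    by (auto intro!: derivative_eq_intros simp: flux_def field_simps)
  have v: "((\<lambda>z. a * flux f z + b * flux g z) has_real_derivative a * flux' f z + b * flux' g z)
      (at z within {0..1})" if "z \<in> {0..1}" for z
    using flux_derivatives(1)[OF f that] flux_derivatives(1)[OF g that]
    by (auto intro!: derivative_eq_intros)
  have c: "continuous_on {0..1} (\<lambda>z. a * flux' f z + b * flux' g z)"
    using flux_derivatives(3) f g by (intro continuous_intros)
  show "Ck_on 2 {0..1} (\<lambda>z. a * f z + b * g z)"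
    "\<And>z. z \<in> {0..1} \<Longrightarrow> flux (\<lambda>z. a * f z + b * g z) z = a * flux f z + b * flux g z"
    "\<And>z. z \<in> {0..1} \<Longrightarrow> flux' (\<lambda>z. a * f z + b * g z) z = a * flux' f z + b * flux' g z"
    using Ck_on_2_of_system[OF y v c] by blast+
qed

lemma scale:
  assumes f: "Ck_on 2 {0..1} f"
  shows "Ck_on 2 {0..1} (\<lambda>z. c * f z)"
    "\<And>z. z \<in> {0..1} \<Longrightarrow> deriv_on {0..1} (\<lambda>z. c * f z) z = c * deriv_on {0..1} f z"
    "\<And>z. z \<in> {0..1} \<Longrightarrow> flux' (\<lambda>z. c * f z) z = c * flux' f z"
  using lincomb(1)[OF f f, where a = c and b = 0] lincomb(3)[OF f f, where a = c and b = 0]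
    deriv_on_lincomb[OF f f, where a = c and b = 0]
  by simp_all

lemma dom_lincomb:
  assumes "f \<in> dom" "g \<in> dom"
  shows "(\<lambda>z. a * f z + b * g z) \<in> dom"
proof -
  note f = domD[OF assms(1)] and g = domD[OF assms(2)]
  have "b1 * (a * f 0 + b * g 0) + b2 * (a * deriv_on {0..1} f 0 + b * deriv_on {0..1} g 0)
      = a * (b1 * f 0 + b2 * deriv_on {0..1} f 0) + b * (b1 * g 0 + b2 * deriv_on {0..1} g 0)"
    "a1 * (a * f 1 + b * g 1) + a2 * (a * deriv_on {0..1} f 1 + b * deriv_on {0..1} g 1)
      = a * (a1 * f 1 + a2 * deriv_on {0..1} f 1) + b * (a1 * g 1 + a2 * deriv_on {0..1} g 1)"
    by (simp_all add: algebra_simps)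
  then show ?thesis
    using lincomb(1) f g by (simp add: sl_domain_def deriv_on_lincomb)
qed

lemma flux_cong:
  assumes "\<And>z. z \<in> {0..1} \<Longrightarrow> f z = g z" "z \<in> {0..1}"
  shows "flux f z = flux g z" "flux' f z = flux' g z"
proof -
  have *: "flux f z = flux g z" if "z \<in> {0..1}" for z
    using deriv_on_cong[of "{0..1}" f g z] assms(1) that by (simp add: flux_def)
  show "flux f z = flux g z" using * assms(2) .
  show "flux' f z = flux' g z"
    using deriv_on_cong[of "{0..1}", OF * assms(2)] by simp
qed

text \<open>Fundamental theorem of calculus for the Wronskian (flux f) g - f (flux g); the two terms
  p f' g' cancel in its derivative.\<close>

lemma green_identity:
  assumes f: "Ck_on 2 {0..1} f" and g: "Ck_on 2 {0..1} g"
  shows "integral {0..1} (\<lambda>z. flux' f z * g z - f z * flux' g z)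
    = (flux f 1 * g 1 - f 1 * flux g 1) - (flux f 0 * g 0 - f 0 * flux g 0)"
proof -
  have "((\<lambda>z. flux f z * g z - f z * flux g z) has_real_derivative
      flux' f z * g z - f z * flux' g z) (at z within {0..1})" if z: "z \<in> {0..1}" for z
  proof -
    have "((\<lambda>z. flux f z * g z - f z * flux g z) has_real_derivative
        (flux' f z * g z + deriv_on {0..1} g z * flux f z)
        - (deriv_on {0..1} f z * flux g z + flux' g z * f z)) (at z within {0..1})"
      by (intro DERIV_diff DERIV_mult Ck_on_2D(1) flux_derivatives(1) f g z)
    then show ?thesis by (simp add: flux_def algebra_simps)
  qed
  then show ?thesis
    by (intro integral_unique fundamental_theorem_of_calculus)
      (auto simp flip: has_real_derivative_iff_has_vector_derivative)
qed

text \<open>The pairs (f, f') and (g, g') are orthogonal to the nonzero vector (c1, c2), hence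
  parallel. Separated boundary conditions thus annihilate the boundary terms of Green's
  identity.\<close>

lemma boundary_wronskian:
  fixes c1 c2 f f' g g' :: real
  assumes "\<bar>c1\<bar> + \<bar>c2\<bar> > 0" "c1 * f + c2 * f' = 0" "c1 * g + c2 * g' = 0"
  shows "f' * g - f * g' = 0"
proof -
  have "c1 * (f' * g - f * g') = 0" "c2 * (f' * g - f * g') = 0"
    using assms(2,3) by algebra+
  then show ?thesis using assms(1) by auto
qed

section \<open>Eigenfunctions and their simplicity\<close>

lemma sl_operator_eq_flux:
  "sl_operator p q r f z = - flux' f z / r z + q z / r z * f z"
  by (simp add: sl_operator_def flux_def)

lemma eigenfunctionD:
  assumes "sl_eigenfunction p q r a1 a2 b1 b2 l f" "z \<in> {0..1}"
  shows "flux' f z = q z * f z - l * r z * f z"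
proof -
  have f: "f \<in> dom" and eq: "\<And>z. z \<in> {0<..<1} \<Longrightarrow> sl_operator p q r f z = l * f z"
    using assms(1) by (auto simp: sl_eigenfunction_def)
  have "flux' f z - (q z * f z - l * r z * f z) = 0"
  proof (rule continuous_eq_0_on_Icc[where f = "\<lambda>z. flux' f z - (q z * f z - l * r z * f z)"])
    show "continuous_on {0..1} (\<lambda>z. flux' f z - (q z * f z - l * r z * f z))"
      using domD[OF f] flux_derivatives(3) q_cont r_cont by (intro continuous_intros)
    fix z :: real assume "z \<in> {0<..<1}"
    then show "flux' f z - (q z * f z - l * r z * f z) = 0"
      using eq[of z] r_pos[of z] by (simp add: sl_operator_eq_flux field_simps)
  qed fact
  then show ?thesis by simp
qed

lemma eigenfunctionI:
  assumes "f \<in> dom" "z \<in> {0..1}" "f z \<noteq> 0"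
    "\<And>z. z \<in> {0<..<1} \<Longrightarrow> flux' f z = q z * f z - l * r z * f z"
  shows "sl_eigenfunction p q r a1 a2 b1 b2 l f"
  unfolding sl_eigenfunction_def
proof (intro conjI ballI)
  fix z :: real assume "z \<in> {0<..<1}"
  then show "sl_operator p q r f z = l * f z"
    using assms(4)[of z] r_pos[of z] by (simp add: sl_operator_eq_flux field_simps)
qed (use assms in auto)

text \<open>The condition at 0 fixes the initial data up to a factor, and the initial data determine
  the solution.\<close>

lemma eigenfunctions_proportional:
  assumes f: "sl_eigenfunction p q r a1 a2 b1 b2 l f" and g: "sl_eigenfunction p q r a1 a2 b1 b2 l g"
  obtains c where "\<And>z. z \<in> {0..1} \<Longrightarrow> f z = c * g z"
proof -
  have fd: "f \<in> dom" and gd: "g \<in> dom"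
    using f g by (auto simp: sl_eigenfunction_def)
  note f' = domD[OF fd] and g' = domD[OF gd]
  have zero: "y z = 0" if y: "y \<in> dom" "y 0 = 0" "flux y 0 = 0"
      "\<And>z. z \<in> {0..1} \<Longrightarrow> flux' y z = (q z - l * r z) * y z" "z \<in> {0..1}" for y z
  proof (rule ivp_unique[OF domD(1)[OF y(1)] _ _ y(2,3,5)])
    show "continuous_on {0..1} (\<lambda>z. q z - l * r z)"
      using q_cont r_cont by (intro continuous_intros)
  qed (simp add: y(4))
  have ge: "flux' g z = (q z - l * r z) * g z" if "z \<in> {0..1}" for z
    using eigenfunctionD[OF g that] by (simp add: algebra_simps)
  have W: "deriv_on {0..1} f 0 * g 0 - f 0 * deriv_on {0..1} g 0 = 0"
    using boundary_wronskian[OF b_nontrivial f'(2) g'(2)] .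
  have "g 0 \<noteq> 0 \<or> flux g 0 \<noteq> 0"
  proof (rule ccontr)
    assume "\<not> ?thesis"
    then have "g z = 0" if "z \<in> {0..1}" for z
      using zero[OF gd _ _ ge that] by auto
    then show False using g by (auto simp: sl_eigenfunction_def)
  qed
  then have g0: "g 0 \<noteq> 0 \<or> deriv_on {0..1} g 0 \<noteq> 0" by (auto simp: flux_def)
  \<comment> \<open>The data (g(0), g'(0)) cannot vanish, else g would be zero by uniqueness; the
    vanishing Wronskian \<open>W\<close> makes either quotient fit both components.\<close>
  define c where "c = (if g 0 \<noteq> 0 then f 0 / g 0 else deriv_on {0..1} f 0 / deriv_on {0..1} g 0)"
  have c: "f 0 = c * g 0" "deriv_on {0..1} f 0 = c * deriv_on {0..1} g 0"
    using W g0 by (auto simp: c_def field_simps)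
  define h where "h z = 1 * f z + (- c) * g z" for z
  have h: "h \<in> dom" using dom_lincomb[OF fd gd, of 1 "- c"] by (simp add: h_def[abs_def])
  have "h z = 0" if "z \<in> {0..1}" for z
  proof (rule zero[OF h _ _ _ that])
    show "h 0 = 0" using c by (simp add: h_def)
    show "flux h 0 = 0"
      using lincomb(2)[OF f'(1) g'(1), of 0 1 "- c"] c by (simp add: h_def[abs_def] flux_def)
    show "flux' h z = (q z - l * r z) * h z" if "z \<in> {0..1}" for z
      using lincomb(3)[OF f'(1) g'(1) that, of 1 "- c"] eigenfunctionD[OF f that] ge[OF that]
      by (simp add: h_def[abs_def] algebra_simps)
  qed
  then show thesis using that[of c] by (simp add: h_def)
qed

end

section \<open>The Green operator\<close>

locale sl_invertible = sturm_liouville +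
  assumes zero_not_eigenvalue: "0 \<notin> sl_eigenvalues p q r a1 a2 b1 b2"
begin

section \<open>Uniqueness and fundamental solutions when 0 is not an eigenvalue\<close>

lemma homogeneous_eq_0:
  assumes "y \<in> dom" "\<And>z. z \<in> {0<..<1} \<Longrightarrow> flux' y z = q z * y z" "z \<in> {0..1}"
  shows "y z = 0"
  using eigenfunctionI[of y z 0] assms zero_not_eigenvalue
  by (auto simp: sl_eigenvalues_def)

lemma inhomogeneous_unique:
  assumes "y1 \<in> dom" "y2 \<in> dom"
    and "\<And>z. z \<in> {0<..<1} \<Longrightarrow> flux' y1 z = q z * y1 z - g z"
    and "\<And>z. z \<in> {0<..<1} \<Longrightarrow> flux' y2 z = q z * y2 z - g z" and "z \<in> {0..1}"
  shows "y1 z = y2 z"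
proof -
  have "1 * y1 z + (-1) * y2 z = 0"
  proof (rule homogeneous_eq_0[OF dom_lincomb[OF assms(1,2)] _ assms(5)])
    fix z :: real assume z: "z \<in> {0<..<1}"
    show "flux' (\<lambda>z. 1 * y1 z + (-1) * y2 z) z = q z * (1 * y1 z + (-1) * y2 z)"
      using lincomb(3)[OF domD(1)[OF assms(1)] domD(1)[OF assms(2)], of z 1 "-1"]
        assms(3,4)[OF z] z
      by (simp add: algebra_simps)
  qed
  then show ?thesis by simp
qed

text \<open>Two independent solutions have a nontrivial combination satisfying the condition at 1.
  It cannot satisfy the condition at 0 as well: it would then vanish identically, against its
  nonzero initial data.\<close>

lemma right_solution:
  obtains v where "Ck_on 2 {0..1} v" "\<And>z. z \<in> {0..1} \<Longrightarrow> flux' v z = q z * v z"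
    "a1 * v 1 + a2 * deriv_on {0..1} v 1 = 0" "b1 * v 0 + b2 * deriv_on {0..1} v 0 \<noteq> 0"
proof -
  obtain y1 where y1: "Ck_on 2 {0..1} y1" "\<And>z. z \<in> {0..1} \<Longrightarrow> flux' y1 z = q z * y1 z"
    "y1 0 = 1" "flux y1 0 = 0"
    using ivp_exists[of 1 0] by blast
  obtain y2 where y2: "Ck_on 2 {0..1} y2" "\<And>z. z \<in> {0..1} \<Longrightarrow> flux' y2 z = q z * y2 z"
    "y2 0 = 0" "flux y2 0 = 1"
    using ivp_exists[of 0 1] by blast
  define R where "R y = a1 * y 1 + a2 * deriv_on {0..1} y 1" for y
  \<comment> \<open>Coefficients with c1 R(y1) + c2 R(y2) = 0; the case distinction keeps them from
    both being 0.\<close>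
  define c1 c2 where "c1 = (if R y1 = 0 then 1 else R y2)" and "c2 = (if R y1 = 0 then 0 else - R y1)"
  have nontriv: "c1 \<noteq> 0 \<or> c2 \<noteq> 0" by (simp add: c1_def c2_def)
  define v where "v z = c1 * y1 z + c2 * y2 z" for z
  note l = lincomb[OF y1(1) y2(1), where a = c1 and b = c2, folded v_def]
  have dv: "deriv_on {0..1} v z = c1 * deriv_on {0..1} y1 z + c2 * deriv_on {0..1} y2 z"
    if "z \<in> {0..1}" for z
    using deriv_on_lincomb[OF y1(1) y2(1) that] by (simp add: v_def[abs_def])
  have v: "Ck_on 2 {0..1} v" using l(1) by (simp add: v_def[abs_def])
  have eq: "flux' v z = q z * v z" if "z \<in> {0..1}" for z
    using l(3)[OF that] y1(2)[OF that] y2(2)[OF that] by (simp add: v_def[abs_def] algebra_simps)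
  have "R v = c1 * R y1 + c2 * R y2"
    using dv[of 1] by (simp add: R_def v_def algebra_simps)
  then have Rv: "R v = 0" by (simp add: c1_def c2_def)
  show thesis
  proof (rule that[OF v eq])
    show "a1 * v 1 + a2 * deriv_on {0..1} v 1 = 0" using Rv by (simp add: R_def)
    show "b1 * v 0 + b2 * deriv_on {0..1} v 0 \<noteq> 0"
    proof
      assume "b1 * v 0 + b2 * deriv_on {0..1} v 0 = 0"
      then have "v \<in> dom" using v Rv by (simp add: sl_domain_def R_def)
      then have zero: "v z = 0" if "z \<in> {0..1}" for z
        using homogeneous_eq_0[OF _ eq that] by auto
      have "flux v 0 = flux (\<lambda>_. 0) 0"
        by (rule flux_cong) (simp_all add: zero)
      also have "\<dots> = 0"
        using deriv_on_eqI[of "\<lambda>_. 0" 0 0 "{0..1}"] at_within_Icc_neq_bot[of 0]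
        by (simp add: flux_def)
      finally have "c2 = 0"
        using l(2)[of 0] y1 y2 by (simp add: v_def[abs_def])
      moreover have "c1 = 0" using zero[of 0] y1 y2 by (simp add: v_def)
      ultimately show False using nontriv by simp
    qed
  qed
qed

text \<open>u has value b2 and derivative - b1 at 0, hence satisfies the left condition. The
  Wronskian is constant by the common equation; at 0 it equals p(0) times the left boundary form of
  v, which is nonzero.\<close>

lemma fundamental_system:
  obtains u v W where "Ck_on 2 {0..1} u" "Ck_on 2 {0..1} v"
    "\<And>z. z \<in> {0..1} \<Longrightarrow> flux' u z = q z * u z" "\<And>z. z \<in> {0..1} \<Longrightarrow> flux' v z = q z * v z"
    "b1 * u 0 + b2 * deriv_on {0..1} u 0 = 0" "a1 * v 1 + a2 * deriv_on {0..1} v 1 = 0"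
    "W \<noteq> 0" "\<And>z. z \<in> {0..1} \<Longrightarrow> flux v z * u z - flux u z * v z = W"
proof -
  obtain v where v: "Ck_on 2 {0..1} v" "\<And>z. z \<in> {0..1} \<Longrightarrow> flux' v z = q z * v z"
    "a1 * v 1 + a2 * deriv_on {0..1} v 1 = 0" "b1 * v 0 + b2 * deriv_on {0..1} v 0 \<noteq> 0"
    using right_solution by blast
  obtain u where u: "Ck_on 2 {0..1} u" "\<And>z. z \<in> {0..1} \<Longrightarrow> flux' u z = q z * u z"
    "u 0 = b2" "flux u 0 = - p 0 * b1"
    using ivp_exists[of b2 "- p 0 * b1"] by blast
  have "p 0 * deriv_on {0..1} u 0 = p 0 * - b1"
    using u(4) by (simp add: flux_def)
  then have du: "deriv_on {0..1} u 0 = - b1"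
    using p_neq_0[of 0] by (subst (asm) mult_left_cancel) auto
  have "((\<lambda>z. flux v z * u z - flux u z * v z) has_real_derivative 0) (at z within {0..1})"
    if z: "z \<in> {0..1}" for z
  proof -
    have "((\<lambda>z. flux v z * u z - flux u z * v z) has_real_derivative
        (flux' v z * u z + deriv_on {0..1} u z * flux v z)
        - (flux' u z * v z + deriv_on {0..1} v z * flux u z)) (at z within {0..1})"
      by (intro DERIV_diff DERIV_mult Ck_on_2D(1) flux_derivatives(1) u v z)
    then show ?thesis using u(2)[OF z] v(2)[OF z] by (simp add: flux_def algebra_simps)
  qed
  then obtain W where W: "\<And>z. z \<in> {0..1} \<Longrightarrow> flux v z * u z - flux u z * v z = W"
    using has_field_derivative_zero_constant[of "{0..1}" "\<lambda>z. flux v z * u z - flux u z * v z"]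
    by auto
  have "W = p 0 * (b1 * v 0 + b2 * deriv_on {0..1} v 0)"
    using W[of 0] u(3) du by (simp add: flux_def algebra_simps)
  then have "W \<noteq> 0" using v(4) p_neq_0[of 0] by simp
  then show thesis
    using that[OF u(1) v(1) u(2) v(2) _ v(3) _ W] u(3) du by simp
qed

text \<open>Sup bounds on y and y' by the weighted norm of f are what makes the solution operator
  compact. They are kept apart from the choice of \<open>green\<close>, to which they pass by
  uniqueness.\<close>

definition green_bound :: "real \<Rightarrow> bool" where
  "green_bound K \<longleftrightarrow> (\<forall>f. continuous_on {0..1} f \<longrightarrow>
     (\<exists>y\<in>dom. \<forall>z\<in>{0..1}. flux' y z = q z * y z - r z * f z \<and>
        \<bar>y z\<bar> \<le> K * nrm f \<and> \<bar>deriv_on {0..1} y z\<bar> \<le> K * nrm f))"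

text \<open>Variation of parameters, with u fitted to the left end and v to the right end.\<close>

lemma green_bound_exists: "\<exists>K>0. green_bound K"
proof -
  obtain u v W where u: "Ck_on 2 {0..1} u" and v: "Ck_on 2 {0..1} v"
    and uq: "\<And>z. z \<in> {0..1} \<Longrightarrow> flux' u z = q z * u z"
    and vq: "\<And>z. z \<in> {0..1} \<Longrightarrow> flux' v z = q z * v z"
    and u0: "b1 * u 0 + b2 * deriv_on {0..1} u 0 = 0"
    and v1: "a1 * v 1 + a2 * deriv_on {0..1} v 1 = 0"
    and W: "W \<noteq> 0" "\<And>z. z \<in> {0..1} \<Longrightarrow> flux v z * u z - flux u z * v z = W"
    using fundamental_system by blast
  note ud = Ck_on_2D[OF u] and vd = Ck_on_2D[OF v]
  obtain Bu where Bu: "Bu > 0" "\<And>z. z \<in> {0..1} \<Longrightarrow> \<bar>u z\<bar> \<le> Bu"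
    using continuous_on_Icc_bounded[OF ud(3)] by blast
  obtain Bv where Bv: "Bv > 0" "\<And>z. z \<in> {0..1} \<Longrightarrow> \<bar>v z\<bar> \<le> Bv"
    using continuous_on_Icc_bounded[OF vd(3)] by blast
  obtain Cu where Cu: "Cu > 0" "\<And>z. z \<in> {0..1} \<Longrightarrow> \<bar>deriv_on {0..1} u z\<bar> \<le> Cu"
    using continuous_on_Icc_bounded[OF ud(4)] by blast
  obtain Cv where Cv: "Cv > 0" "\<And>z. z \<in> {0..1} \<Longrightarrow> \<bar>deriv_on {0..1} v z\<bar> \<le> Cv"
    using continuous_on_Icc_bounded[OF vd(4)] by blast
  define S where "S = nrm u + nrm v"
  \<comment> \<open>y and y' combine u, v or u', v' with weights \<alpha> and \<beta>, each at most
    \<open>S\<close> times the norm of f; the summand 1 makes \<open>K\<close> positive.\<close>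
  define K where "K = (Bu + Bv + Cu + Cv) * S / \<bar>W\<bar> + 1"
  have S: "nrm u \<le> S" "nrm v \<le> S" "S \<ge> 0"
    using nrm_nonneg ud(3) vd(3) by (auto simp: S_def)
  have K: "K > 0" unfolding K_def using Bu Bv Cu Cv S
    by (intro add_nonneg_pos divide_nonneg_nonneg mult_nonneg_nonneg) auto
  have "\<exists>y\<in>dom. \<forall>z\<in>{0..1}. flux' y z = q z * y z - r z * f z \<and>
        \<bar>y z\<bar> \<le> K * nrm f \<and> \<bar>deriv_on {0..1} y z\<bar> \<le> K * nrm f"
    if f: "continuous_on {0..1} f" for f
  proof -
    define \<alpha> where "\<alpha> z = integral {0..z} (\<lambda>s. r s * u s * f s)" for z
    define \<beta> where "\<beta> z = integral {z..1} (\<lambda>s. r s * v s * f s)" for z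
    have \<alpha>': "(\<alpha> has_real_derivative r z * u z * f z) (at z within {0..1})" if "z \<in> {0..1}" for z
      unfolding \<alpha>_def
      by (rule integral_has_real_derivative) (use that r_cont ud f in \<open>auto intro!: continuous_intros\<close>)
    have \<beta>': "(\<beta> has_real_derivative - (r z * v z * f z)) (at z within {0..1})" if "z \<in> {0..1}" for z
      unfolding \<beta>_def
      by (rule integral_has_real_derivative') (use that r_cont vd f in \<open>auto intro!: continuous_intros\<close>)
    have \<alpha>_le: "\<bar>\<alpha> z\<bar> \<le> S * nrm f" if "z \<in> {0..1}" for z
    proof -
      have "\<bar>\<alpha> z\<bar> \<le> nrm u * nrm f"
        unfolding \<alpha>_def using that by (intro partial_ip_le ud f) auto
      also have "\<dots> \<le> S * nrm f" using S nrm_nonneg[OF f] by (intro mult_right_mono)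
      finally show ?thesis .
    qed
    have \<beta>_le: "\<bar>\<beta> z\<bar> \<le> S * nrm f" if "z \<in> {0..1}" for z
    proof -
      have "\<bar>\<beta> z\<bar> \<le> nrm v * nrm f"
        unfolding \<beta>_def using that by (intro partial_ip_le vd f) auto
      also have "\<dots> \<le> S * nrm f" using S nrm_nonneg[OF f] by (intro mult_right_mono)
      finally show ?thesis .
    qed
    \<comment> \<open>The Green function with respect to r(s) ds is - u(s) v(z) / W for s <= z, with
      u and v exchanged for s >= z. In y' the terms with \<alpha>' and \<beta>' cancel, so
      \<open>w\<close> is the flux of y; in the derivative of \<open>w\<close> they form the
      Wronskian and produce - r f.\<close>
    define y where "y z = - (v z * \<alpha> z + u z * \<beta> z) / W" for z
    define w where "w z = - (flux v z * \<alpha> z + flux u z * \<beta> z) / W" for z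
    have uf: "deriv_on {0..1} u z = flux u z / p z" "deriv_on {0..1} v z = flux v z / p z"
      if "z \<in> {0..1}" for z
      using that p_neq_0 by (auto simp: flux_def)
    have yd: "(y has_real_derivative w z / p z) (at z within {0..1})" if z: "z \<in> {0..1}" for z
    proof -
      have "(y has_real_derivative - ((deriv_on {0..1} v z * \<alpha> z + r z * u z * f z * v z)
          + (deriv_on {0..1} u z * \<beta> z + - (r z * v z * f z) * u z)) / W) (at z within {0..1})"
        unfolding y_def
        by (intro DERIV_cdivide DERIV_minus DERIV_add DERIV_mult ud(1) vd(1) \<alpha>' \<beta>' z)
      moreover have "- ((deriv_on {0..1} v z * \<alpha> z + r z * u z * f z * v z)
          + (deriv_on {0..1} u z * \<beta> z + - (r z * v z * f z) * u z)) / W = w z / p z"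
        using z p_neq_0[OF z] W(1) by (simp add: w_def uf field_simps)
      ultimately show ?thesis by simp
    qed
    have wd: "(w has_real_derivative q z * y z - r z * f z) (at z within {0..1})"
      if z: "z \<in> {0..1}" for z
    proof -
      have "(w has_real_derivative - ((flux' v z * \<alpha> z + r z * u z * f z * flux v z)
          + (flux' u z * \<beta> z + - (r z * v z * f z) * flux u z)) / W) (at z within {0..1})"
        unfolding w_def
        by (intro DERIV_cdivide DERIV_minus DERIV_add DERIV_mult flux_derivatives(1) u v \<alpha>' \<beta>' z)
      moreover have "- ((flux' v z * \<alpha> z + r z * u z * f z * flux v z)
          + (flux' u z * \<beta> z + - (r z * v z * f z) * flux u z)) / W
          = q z * y z - r z * f z * (flux v z * u z - flux u z * v z) / W"
        using W(1) by (simp add: y_def uq[OF z] vq[OF z] field_simps)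
      ultimately show ?thesis using W(1) W(2)[OF z] by simp
    qed
    have y_cont: "continuous_on {0..1} y"
      using yd by (meson DERIV_continuous continuous_on_eq_continuous_within)
    have rhs: "continuous_on {0..1} (\<lambda>z. q z * y z - r z * f z)"
      using y_cont q_cont r_cont f by (intro continuous_intros)
    note y2 = Ck_on_2_of_system[OF yd wd rhs, simplified]
    have dy: "deriv_on {0..1} y z = - (deriv_on {0..1} v z * \<alpha> z + deriv_on {0..1} u z * \<beta> z) / W"
      if "z \<in> {0..1}" for z
      using deriv_on_eqI[OF yd[OF that] at_within_Icc_neq_bot[OF that]] that p_neq_0[OF that] W(1)
      by (simp add: w_def uf field_simps)
    \<comment> \<open>At 0 only the u term survives and at 1 only the v term, so y inherits one
      boundary condition from each.\<close>
    have \<alpha>0: "\<alpha> 0 = 0" and \<beta>1: "\<beta> 1 = 0" by (simp_all add: \<alpha>_def \<beta>_def)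
    have "b1 * y 0 + b2 * deriv_on {0..1} y 0 = - \<beta> 0 / W * (b1 * u 0 + b2 * deriv_on {0..1} u 0)"
      using W(1) by (simp add: y_def dy \<alpha>0 divide_simps) (simp add: algebra_simps)
    moreover have "a1 * y 1 + a2 * deriv_on {0..1} y 1
        = - \<alpha> 1 / W * (a1 * v 1 + a2 * deriv_on {0..1} v 1)"
      using W(1) by (simp add: y_def dy \<beta>1 divide_simps) (simp add: algebra_simps)
    ultimately have "y \<in> dom" using y2(1) u0 v1 by (simp add: sl_domain_def)
    moreover have bound: "\<bar>- (c * \<alpha> z + d * \<beta> z) / W\<bar> \<le> K * nrm f"
      if "z \<in> {0..1}" "\<bar>c\<bar> \<le> C" "\<bar>d\<bar> \<le> D" "C + D \<le> Bu + Bv + Cu + Cv" for z c d C D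
    proof -
      have "\<bar>c * \<alpha> z + d * \<beta> z\<bar> \<le> \<bar>c\<bar> * \<bar>\<alpha> z\<bar> + \<bar>d\<bar> * \<bar>\<beta> z\<bar>"
        by (metis abs_mult abs_triangle_ineq)
      also have "\<dots> \<le> C * (S * nrm f) + D * (S * nrm f)"
        using that \<alpha>_le \<beta>_le by (intro add_mono mult_mono) auto
      also have "\<dots> \<le> (Bu + Bv + Cu + Cv) * (S * nrm f)"
        using that(4) S nrm_nonneg[OF f] by (simp flip: distrib_right add: mult_right_mono)
      finally have "\<bar>- (c * \<alpha> z + d * \<beta> z) / W\<bar> \<le> (Bu + Bv + Cu + Cv) * (S * nrm f) / \<bar>W\<bar>"
        by (simp add: divide_right_mono)
      also have "\<dots> \<le> K * nrm f"
        using nrm_nonneg[OF f] by (simp add: K_def algebra_simps)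
      finally show ?thesis .
    qed
    moreover have "\<bar>y z\<bar> \<le> K * nrm f" if "z \<in> {0..1}" for z
      using bound[OF that Bv(2)[OF that] Bu(2)[OF that]] Cu(1) Cv(1) by (simp add: y_def)
    moreover have "\<bar>deriv_on {0..1} y z\<bar> \<le> K * nrm f" if "z \<in> {0..1}" for z
      using bound[OF that Cv(2)[OF that] Cu(2)[OF that]] Bu(1) Bv(1) by (simp add: dy[OF that])
    ultimately show ?thesis using y2(3) by (intro bexI[of _ y]) auto
  qed
  then show ?thesis using K by (auto simp: green_bound_def)
qed

text \<open>The inverse of A: in terms of the flux, A y = f reads flux' y = q y - r f. Values
  outside [0,1] are left to the choice.\<close>

definition green :: "(real \<Rightarrow> real) \<Rightarrow> real \<Rightarrow> real" where
  "green f = (SOME y. y \<in> dom \<and> (\<forall>z\<in>{0..1}. flux' y z = q z * y z - r z * f z))"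

definition green_const :: real where
  "green_const = (SOME K. K > 0 \<and> green_bound K)"

lemma green_const: "green_const > 0" "green_bound green_const"
  using someI_ex[of "\<lambda>K. K > 0 \<and> green_bound K"] green_bound_exists
  by (auto simp: green_const_def)

lemma green:
  assumes "continuous_on {0..1} f"
  shows "green f \<in> dom" "\<And>z. z \<in> {0..1} \<Longrightarrow> flux' (green f) z = q z * green f z - r z * f z"
proof -
  have "\<exists>y. y \<in> dom \<and> (\<forall>z\<in>{0..1}. flux' y z = q z * y z - r z * f z)"
    using green_const(2) assms unfolding green_bound_def by blast
  from someI_ex[OF this] show "green f \<in> dom"
    "\<And>z. z \<in> {0..1} \<Longrightarrow> flux' (green f) z = q z * green f z - r z * f z"
    by (auto simp: green_def)
qed

lemma green_unique:
  assumes f: "continuous_on {0..1} f" and "y \<in> dom"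
    "\<And>z. z \<in> {0<..<1} \<Longrightarrow> flux' y z = q z * y z - r z * f z" "z \<in> {0..1}"
  shows "green f z = y z"
  using inhomogeneous_unique[of "green f" y "\<lambda>z. r z * f z" z] green[OF f] assms by auto

lemma green_C2: "continuous_on {0..1} f \<Longrightarrow> Ck_on 2 {0..1} (green f)"
  using green(1) domD(1) by blast

lemma green_cont: "continuous_on {0..1} f \<Longrightarrow> continuous_on {0..1} (green f)"
  using green(1) domD(4) by blast

lemma green_abs_le:
  assumes f: "continuous_on {0..1} f" and z: "z \<in> {0..1}"
  shows "\<bar>green f z\<bar> \<le> green_const * nrm f"
    "\<bar>deriv_on {0..1} (green f) z\<bar> \<le> green_const * nrm f"
proof -
  obtain y where y: "y \<in> dom" "\<And>z. z \<in> {0..1} \<Longrightarrow> flux' y z = q z * y z - r z * f z"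
    "\<And>z. z \<in> {0..1} \<Longrightarrow> \<bar>y z\<bar> \<le> green_const * nrm f"
    "\<And>z. z \<in> {0..1} \<Longrightarrow> \<bar>deriv_on {0..1} y z\<bar> \<le> green_const * nrm f"
    using green_const(2) f unfolding green_bound_def by blast
  have eq: "green f z = y z" if "z \<in> {0..1}" for z
    using green_unique[OF f y(1) _ that] y(2) by auto
  show "\<bar>green f z\<bar> \<le> green_const * nrm f" using eq y(3) z by simp
  show "\<bar>deriv_on {0..1} (green f) z\<bar> \<le> green_const * nrm f"
    using deriv_on_cong[of "{0..1}" "green f" y z] eq y(4) z by simp
qed

lemma green_cong:
  assumes "continuous_on {0..1} f" "continuous_on {0..1} g"
    "\<And>z. z \<in> {0..1} \<Longrightarrow> f z = g z" "z \<in> {0..1}"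
  shows "green f z = green g z"
  using green_unique[OF assms(1) green(1)[OF assms(2)] _ assms(4)] green(2)[OF assms(2)] assms(3)
  by simp

lemma green_lincomb:
  assumes f: "continuous_on {0..1} f" and g: "continuous_on {0..1} g" and z: "z \<in> {0..1}"
  shows "green (\<lambda>z. a * f z + b * g z) z = a * green f z + b * green g z"
    "deriv_on {0..1} (green (\<lambda>z. a * f z + b * g z)) z
      = a * deriv_on {0..1} (green f) z + b * deriv_on {0..1} (green g) z"
proof -
  have *: "green (\<lambda>z. a * f z + b * g z) z = a * green f z + b * green g z" if "z \<in> {0..1}" for z
  proof (rule green_unique[OF _ _ _ that])
    show "continuous_on {0..1} (\<lambda>z. a * f z + b * g z)"
      using f g by (intro continuous_intros)
    show "(\<lambda>z. a * green f z + b * green g z) \<in> dom"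
      by (intro dom_lincomb green f g)
    fix z :: real assume "z \<in> {0<..<1}"
    then show "flux' (\<lambda>z. a * green f z + b * green g z) z
        = q z * (a * green f z + b * green g z) - r z * (a * f z + b * g z)"
      using lincomb(3)[OF green_C2[OF f] green_C2[OF g], of z a b] green(2)[OF f] green(2)[OF g]
      by (simp add: algebra_simps)
  qed
  show "green (\<lambda>z. a * f z + b * g z) z = a * green f z + b * green g z" using * z .
  show "deriv_on {0..1} (green (\<lambda>z. a * f z + b * g z)) z
      = a * deriv_on {0..1} (green f) z + b * deriv_on {0..1} (green g) z"
    using deriv_on_cong[of "{0..1}", OF * z] deriv_on_lincomb[OF green_C2[OF f] green_C2[OF g] z]
    by simp
qed

text \<open>Green's identity for the two images: the boundary terms vanish by the boundary
  conditions, and the terms with q cancel.\<close>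

lemma green_symmetric:
  assumes f: "continuous_on {0..1} f" and g: "continuous_on {0..1} g"
  shows "ip (green f) g = ip f (green g)"
proof -
  let ?F = "green f" and ?G = "green g"
  note F = domD[OF green(1)[OF f]] and G = domD[OF green(1)[OF g]]
  have "integral {0..1} (\<lambda>z. flux' ?F z * ?G z - ?F z * flux' ?G z) = 0"
    unfolding green_identity[OF F(1) G(1)]
    using boundary_wronskian[OF a_nontrivial F(3) G(3)] boundary_wronskian[OF b_nontrivial F(2) G(2)]
    by (simp add: flux_def mult.assoc flip: right_diff_distrib)
  moreover have "integral {0..1} (\<lambda>z. flux' ?F z * ?G z - ?F z * flux' ?G z)
      = integral {0..1} (\<lambda>z. r z * ?F z * g z - r z * f z * ?G z)"
    by (intro integral_cong) (simp add: green(2)[OF f] green(2)[OF g] algebra_simps)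
  moreover have "\<dots> = ip ?F g - ip f ?G"
    unfolding ip_def using ip_integrable f g F(4) G(4) by (subst integral_diff) auto
  ultimately show ?thesis by simp
qed

lemma eigenfunction_green:
  assumes f: "sl_eigenfunction p q r a1 a2 b1 b2 l f" and z: "z \<in> {0..1}"
  shows "l * green f z = f z"
proof -
  have fd: "f \<in> dom" using f by (simp add: sl_eigenfunction_def)
  note c = domD(4)[OF fd]
  have "green (\<lambda>z. l * f z + 0 * f z) z = f z"
  proof (rule green_unique[OF _ fd _ z])
    show "continuous_on {0..1} (\<lambda>z. l * f z + 0 * f z)"
      using c by (intro continuous_intros)
  qed (use eigenfunctionD[OF f] in \<open>auto simp: mult_ac\<close>)
  then show ?thesis using green_lincomb(1)[OF c c z, of l 0] by simp
qed

text \<open>h is only continuous, but its image is twice differentiable, satisfies the boundary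
  conditions and is a nonzero multiple of h on [0,1]; so the image serves as the
  eigenfunction.\<close>

lemma green_eigenfunction:
  assumes h: "continuous_on {0..1} h" and eq: "\<And>z. z \<in> {0..1} \<Longrightarrow> green h z = \<mu> * h z"
    and "\<mu> \<noteq> 0" and z: "z \<in> {0..1}" "h z \<noteq> 0"
  shows "sl_eigenfunction p q r a1 a2 b1 b2 (1 / \<mu>) (green h)"
proof (rule eigenfunctionI[OF green(1)[OF h] z(1)])
  show "green h z \<noteq> 0" using eq[OF z(1)] z(2) \<open>\<mu> \<noteq> 0\<close> by simp
  fix z :: real assume "z \<in> {0<..<1}"
  then show "flux' (green h) z = q z * green h z - 1 / \<mu> * r z * green h z"
    using green(2)[OF h, of z] eq[of z] \<open>\<mu> \<noteq> 0\<close> by simp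
qed

end

section \<open>Completeness of the eigenfunctions\<close>

context sl_invertible
begin

text \<open>The equation returns r f from \<open>green f\<close>, so a zero image forces f = 0. This
  makes the operator norm on the orthogonal complement positive.\<close>

lemma green_injective:
  assumes f: "continuous_on {0..1} f" and "\<And>z. z \<in> {0..1} \<Longrightarrow> green f z = 0" and z: "z \<in> {0..1}"
  shows "f z = 0"
proof -
  have "flux' (green f) z = flux' (\<lambda>z. 0 * green f z + 0 * green f z) z"
    using assms by (intro flux_cong(2)) auto
  also have "\<dots> = 0" using lincomb(3)[OF green_C2[OF f] green_C2[OF f] z, of 0 0] by simp
  finally have "r z * f z = 0" using green(2)[OF f z] assms by simp
  then show ?thesis using r_pos[OF z] by simp
qed

text \<open>Equicontinuity for Arzela-Ascoli, with one constant for all f of norm at most 1.\<close>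

lemma green_lipschitz:
  assumes f: "continuous_on {0..1} f" and "x \<in> {0..1}" "y \<in> {0..1}"
  shows "\<bar>green f x - green f y\<bar> \<le> green_const * nrm f * \<bar>x - y\<bar>"
  using field_differentiable_bound[of "{0..1}" "green f" "deriv_on {0..1} (green f)"
      "green_const * nrm f" x y]
    Ck_on_2D(1)[OF green_C2[OF f]] green_abs_le(2)[OF f] assms
  by auto

lemma green_diff:
  assumes "continuous_on {0..1} f" "continuous_on {0..1} g" "z \<in> {0..1}"
  shows "green (\<lambda>z. f z - c * g z) z = green f z - c * green g z"
    "deriv_on {0..1} (green (\<lambda>z. f z - c * g z)) z
      = deriv_on {0..1} (green f) z - c * deriv_on {0..1} (green g) z"
  using green_lincomb[OF assms, of 1 "- c"] by simp_all

text \<open>An upper bound for the operator norm, obtained from the sup bound of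
  \<open>green\<close>; it shows that the supremum over the orthogonal complement is finite.\<close>

definition green_opnorm :: real where
  "green_opnorm = green_const * sqrt (integral {0..1} r)"

lemma nrm_green_le:
  assumes f: "continuous_on {0..1} f"
  shows "nrm (green f) \<le> green_opnorm * nrm f"
  using nrm_le_const[OF green_cont[OF f] green_abs_le(1)[OF f]] by (simp add: green_opnorm_def mult_ac)

end

locale sl_basis = sl_invertible +
  fixes lam :: "nat \<Rightarrow> real" and phi :: "nat \<Rightarrow> real \<Rightarrow> real"
  assumes lam_mono: "strict_mono lam"
    and lam_range: "range lam = sl_eigenvalues p q r a1 a2 b1 b2"
    and phi_eigen: "sl_eigenfunction p q r a1 a2 b1 b2 (lam n) (phi n)"
    and phi_orthonormal: "inner_r r (phi m) (phi n) = (if m = n then 1 else 0)"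
    and lam_0_pos: "lam 0 > 0"
    and phi_summable: "summable (\<lambda>n. inverse (lam n) * (SUP z\<in>{0..1}. \<bar>phi n z\<bar>))"
begin

section \<open>Fourier coefficients with respect to the eigenfunctions\<close>

lemma phi_dom: "phi n \<in> dom"
  using phi_eigen by (simp add: sl_eigenfunction_def)

lemmas phi_cont = domD(4)[OF phi_dom]

lemma lam_ge: "lam 0 \<le> lam n"
  using lam_mono by (simp add: strict_mono_less_eq)

lemma lam_pos: "lam n > 0"
  using lam_ge[of n] lam_0_pos by linarith

lemma ip_phi: "ip (phi m) (phi n) = (if m = n then 1 else 0)"
  using inner_r_eq_ip[OF phi_cont phi_cont] phi_orthonormal by simp

definition coef :: "(real \<Rightarrow> real) \<Rightarrow> nat \<Rightarrow> real" where
  "coef f n = ip f (phi n)"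

text \<open>Symmetry moves the operator onto the eigenfunction, where it acts as division by
  \<lambda>_n.\<close>

lemma coef_green:
  assumes f: "continuous_on {0..1} f"
  shows "coef (green f) n = coef f n / lam n"
proof -
  have "coef (green f) n = ip (green (phi n)) f"
    unfolding coef_def green_symmetric[OF f phi_cont] by (rule ip_commute)
  also have "\<dots> = ip (\<lambda>z. inverse (lam n) * phi n z) f"
    using eigenfunction_green[OF phi_eigen, of _ n] lam_pos[of n]
    by (intro ip_cong) (auto simp: field_simps)
  finally show ?thesis by (simp add: ip_scale_left coef_def ip_commute divide_inverse mult.commute)
qed

lemma coef_lincomb:
  assumes "continuous_on {0..1} f" "continuous_on {0..1} g"
  shows "coef (\<lambda>z. a * f z + b * g z) n = a * coef f n + b * coef g n"
  using ip_lincomb_left[OF assms phi_cont] by (simp add: coef_def)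

lemma abs_coef_le:
  assumes "continuous_on {0..1} f"
  shows "\<bar>coef f n\<bar> \<le> nrm f"
  using cauchy_schwarz[OF assms phi_cont, of n] ip_phi[of n n] by (simp add: coef_def nrm_def)

text \<open>A nonzero such h would give the eigenvalue 1/\<mu> of A, which occurs in
  \<open>lam\<close>; simplicity then makes h a multiple of some \<open>phi n\<close>, to which it
  is orthogonal.\<close>

lemma green_eigenvector_trivial:
  assumes h: "continuous_on {0..1} h" and orth: "\<And>n. coef h n = 0"
    and eq: "\<And>z. z \<in> {0..1} \<Longrightarrow> green h z = \<mu> * h z" and \<mu>: "\<mu> \<noteq> 0" and z: "z \<in> {0..1}"
  shows "h z = 0"
proof (rule ccontr)
  assume "h z \<noteq> 0"
  from green_eigenfunction[OF h eq \<mu> z this]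
  have e: "sl_eigenfunction p q r a1 a2 b1 b2 (1 / \<mu>) (green h)" by simp
  then have "1 / \<mu> \<in> range lam" using lam_range by (auto simp: sl_eigenvalues_def)
  then obtain n where "1 / \<mu> = lam n" by auto
  with e phi_eigen[of n] obtain c where c: "\<And>z. z \<in> {0..1} \<Longrightarrow> green h z = c * phi n z"
    using eigenfunctions_proportional by metis
  then have hc: "h z = c / \<mu> * phi n z" if "z \<in> {0..1}" for z
    using eq[OF that] that \<mu> by (simp add: field_simps)
  then have "coef h n = ip (\<lambda>z. c / \<mu> * phi n z) (phi n)"
    unfolding coef_def by (intro ip_cong) auto
  also have "\<dots> = c / \<mu>" by (simp only: ip_scale_left ip_phi) simp
  finally have "c = 0" using orth \<mu> by simp
  then show False using hc[OF z] \<open>h z \<noteq> 0\<close> by simp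
qed

text \<open>
  The Green operator maps the orthogonal complement \<open>V\<close> of the eigenfunctions to itself. A maximizing
  sequence for its norm \<open>M\<close> on \<open>V\<close> yields, by compactness, some \<open>g \<noteq> 0\<close> in \<open>V\<close> whose image under the
  square of the operator is \<open>M\<^sup>2 g\<close>, hence an eigenvector in \<open>V\<close> with eigenvalue \<open>M\<close> or \<open>- M\<close>.
\<close>
theorem coef_eq_0_imp_eq_0:
  assumes f0: "continuous_on {0..1} f0" and orth: "\<And>n. coef f0 n = 0" and z: "z \<in> {0..1}"
  shows "f0 z = 0"
proof (rule ccontr)
  assume "f0 z \<noteq> 0"
  define V where "V = {f. continuous_on {0..1} f \<and> (\<forall>n. coef f n = 0)}"
  have Vc: "continuous_on {0..1} f" if "f \<in> V" for f using that by (simp add: V_def)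
  have VT: "green f \<in> V" if "f \<in> V" for f
    using that coef_green green_cont by (simp add: V_def)
  have V_lincomb: "(\<lambda>z. a * f z + b * g z) \<in> V" if "f \<in> V" "g \<in> V" for a b f g
    using that coef_lincomb by (auto simp: V_def intro!: continuous_intros)
  have V_scale: "(\<lambda>z. a * f z) \<in> V" if "f \<in> V" for a f
    using V_lincomb[OF that that, of a 0] by simp
  have nrm_T_scale: "nrm (green (\<lambda>z. a * f z)) = \<bar>a\<bar> * nrm (green f)" if "f \<in> V" for a f
  proof -
    have "green (\<lambda>z. a * f z) z = a * green f z" if "z \<in> {0..1}" for z
      using green_lincomb(1)[OF Vc Vc that, of f f a 0] \<open>f \<in> V\<close> by simp
    then have "nrm (green (\<lambda>z. a * f z)) = nrm (\<lambda>z. a * green f z)" by (rule nrm_cong)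
    then show ?thesis by (simp add: nrm_scale)
  qed
  have pos: "nrm f > 0" if "f \<in> V" "x \<in> {0..1}" "f x \<noteq> 0" for f x
    using nrm_eq_0D[OF Vc[OF that(1)] _ that(2)] that(3) by fastforce

  define A where "A = (\<lambda>f. nrm (green f)) ` {f \<in> V. nrm f = 1}"
  define M where "M = Sup A"
  have f0V: "f0 \<in> V" using f0 orth by (simp add: V_def)
  define f1 where "f1 z = inverse (nrm f0) * f0 z" for z
  have nf0: "nrm f0 > 0" using pos[OF f0V z \<open>f0 z \<noteq> 0\<close>] .
  have f1V: "f1 \<in> V" using V_scale[OF f0V] by (simp add: f1_def[abs_def])
  have f1n: "nrm f1 = 1" using nf0 by (simp add: f1_def[abs_def] nrm_scale)
  have bdd: "bdd_above A"
    by (rule bdd_aboveI[of _ green_opnorm]) (use nrm_green_le Vc in \<open>force simp: A_def\<close>)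
  have A1: "nrm (green f1) \<in> A" using f1V f1n by (auto simp: A_def)
  obtain x where x: "x \<in> {0..1}" "green f1 x \<noteq> 0"
    using green_injective[OF Vc[OF f1V] _ z] \<open>f0 z \<noteq> 0\<close> nf0 by (auto simp: f1_def)
  have M: "M > 0"
    using pos[OF VT[OF f1V] x] cSup_upper[OF A1 bdd] by (simp add: M_def)
  have MB: "nrm (green f) \<le> M * nrm f" if f: "f \<in> V" for f
  proof (cases "nrm f = 0")
    case True
    then show ?thesis using nrm_green_le[OF Vc[OF f]] by simp
  next
    case False
    then have n: "nrm f > 0" using nrm_nonneg[OF Vc[OF f]] by simp
    then have "nrm (green (\<lambda>z. inverse (nrm f) * f z)) \<in> A"
      using V_scale[OF f] by (auto simp: A_def nrm_scale)
    then have "inverse (nrm f) * nrm (green f) \<le> M"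
      using cSup_upper[OF _ bdd] nrm_T_scale[OF f] n by (fastforce simp: M_def)
    then show ?thesis using n by (simp add: field_simps)
  qed
  have "\<exists>f. f \<in> V \<and> nrm f = 1 \<and> M - inverse (real (Suc k)) < nrm (green f)" for k
  proof -
    have "M - inverse (real (Suc k)) < Sup A" by (simp add: M_def)
    then obtain y where "y \<in> A" "M - inverse (real (Suc k)) < y"
      using less_cSup_iff[OF _ bdd] A1 by blast
    then show ?thesis by (auto simp: A_def)
  qed
  then obtain F where F: "\<And>k. F k \<in> V" "\<And>k. nrm (F k) = 1"
    "\<And>k. M - inverse (real (Suc k)) < nrm (green (F k))"
    by metis

  \<comment> \<open>The images of unit vectors are bounded by and Lipschitz with
    \<open>green_const\<close>, so a subsequence converges uniformly.\<close>
  have "\<exists>g k. continuous_on {0..1} g \<and> strict_mono (k :: nat \<Rightarrow> nat) \<and>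
      uniform_limit {0..1} (\<lambda>n. green (F (k n))) g sequentially"
  proof (rule Arzela_Ascoli[of "{0..1::real}" "\<lambda>n. green (F n)" green_const])
    show "compact {0..1::real}" by simp
    show "norm (green (F n) x) \<le> green_const" if "x \<in> {0..1}" for n x
      using green_abs_le(1)[OF Vc[OF F(1)] that] F(2) by simp
    show "\<exists>d. 0 < d \<and> (\<forall>n y. y \<in> {0..1} \<and> norm (x - y) < d \<longrightarrow>
        norm (green (F n) x - green (F n) y) < e)" if "x \<in> {0..1}" "0 < e" for x e
    proof (intro exI conjI allI impI)
      show "0 < e / green_const" using that green_const(1) by simp
      fix n y assume y: "y \<in> {0..1} \<and> norm (x - y) < e / green_const"
      have "\<bar>green (F n) x - green (F n) y\<bar> \<le> green_const * \<bar>x - y\<bar>"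
        using green_lipschitz[OF Vc[OF F(1)] that(1), of y] y F(2) by simp
      also have "\<dots> < e" using y green_const(1) by (simp add: field_simps)
      finally show "norm (green (F n) x - green (F n) y) < e" by simp
    qed
    fix g and k :: "nat \<Rightarrow> nat"
    assume "continuous_on {0..1} g" "strict_mono k"
      "\<And>e. 0 < e \<Longrightarrow> \<exists>N. \<forall>n x. n \<ge> N \<and> x \<in> {0..1} \<longrightarrow> norm (green (F (k n)) x - g x) < e"
    then show "\<exists>g k. continuous_on {0..1} g \<and> strict_mono (k :: nat \<Rightarrow> nat) \<and>
      uniform_limit {0..1} (\<lambda>n. green (F (k n))) g sequentially"
      unfolding uniform_limit_sequentially_iff dist_norm by blast
  qed
  then obtain g and k :: "nat \<Rightarrow> nat" where g: "continuous_on {0..1} g" and k: "strict_mono k"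
    and unif: "uniform_limit {0..1} (\<lambda>n. green (F (k n))) g sequentially" by blast
  define f where "f n = F (k n)" for n
  define h where "h n = green (f n)" for n
  have fV: "f n \<in> V" and fn: "nrm (f n) = 1" for n using F by (simp_all add: f_def)
  have hV: "h n \<in> V" for n using VT fV by (simp add: h_def)
  have unif: "uniform_limit {0..1} h g sequentially" using unif by (simp add: h_def[abs_def] f_def)
  note hg = nrm_uniform_limit(2)[OF unif Vc[OF hV]]
  have "coef g n = 0" for n
  proof (rule LIMSEQ_unique)
    show "(\<lambda>j. coef (h j) n) \<longlonglongrightarrow> coef g n"
      unfolding coef_def by (rule ip_tendsto[OF Vc[OF hV] g phi_cont hg])
    show "(\<lambda>j. coef (h j) n) \<longlonglongrightarrow> 0" using hV by (simp add: V_def)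
  qed
  then have gV: "g \<in> V" using g by (simp add: V_def)
  have nh: "(\<lambda>n. nrm (h n)) \<longlonglongrightarrow> M"
  proof (rule tendsto_sandwich)
    show "(\<lambda>n. M - inverse (real (Suc n))) \<longlonglongrightarrow> M"
      using tendsto_diff[OF tendsto_const LIMSEQ_inverse_real_of_nat] by simp
    show "\<forall>\<^sub>F n in sequentially. M - inverse (real (Suc n)) \<le> nrm (h n)"
    proof (intro always_eventually allI)
      fix n
      have "inverse (real (Suc (k n))) \<le> inverse (real (Suc n))"
        using seq_suble[OF k, of n] by (simp add: le_imp_inverse_le)
      then show "M - inverse (real (Suc n)) \<le> nrm (h n)"
        using F(3)[of "k n"] unfolding h_def f_def by linarith
    qed
    show "\<forall>\<^sub>F n in sequentially. nrm (h n) \<le> M"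
      using MB[OF fV] fn by (intro always_eventually allI) (simp add: h_def)
  qed simp
  have "(\<lambda>n. nrm (h n)) \<longlonglongrightarrow> nrm g"
  proof (rule LIM_zero_cancel, rule Lim_null_comparison[OF _ hg])
    show "\<forall>\<^sub>F n in sequentially. norm (nrm (h n) - nrm g) \<le> nrm (\<lambda>z. h n z - g z)"
      using nrm_le_nrm_diff[OF Vc[OF hV] g] by simp
  qed
  then have ng: "nrm g = M" using nh LIMSEQ_unique by blast

  define d where "d n z = green (h n) z - M\<^sup>2 * f n z" for n z
  have dc: "continuous_on {0..1} (d n)" for n
    unfolding d_def using green_cont[OF Vc[OF hV]] Vc[OF fV] by (intro continuous_intros)
  \<comment> \<open>With T = \<open>green\<close>, symmetry gives <T h, f> = |h|^2, and |f| = 1.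
    Hence |T h - M^2 f|^2 = |T h|^2 - 2 M^2 |h|^2 + M^4, where |T h| <= M |h|. Since |h| tends to M,
    the norms of \<open>d n\<close> tend to 0.\<close>
  have nd: "(nrm (d n))\<^sup>2 \<le> M\<^sup>2 * (M\<^sup>2 - (nrm (h n))\<^sup>2)" for n
  proof -
    note c = green_cont[OF Vc[OF hV]] Vc[OF fV]
    have "ip (green (h n)) (f n) = (nrm (h n))\<^sup>2"
      unfolding green_symmetric[OF Vc[OF hV] Vc[OF fV]] nrm_power2[OF Vc[OF hV]]
      by (simp add: h_def)
    moreover have "ip (\<lambda>z. 1 * green (h n) z + (- M\<^sup>2) * f n z) (\<lambda>z. 1 * green (h n) z + (- M\<^sup>2) * f n z)
        = ip (green (h n)) (green (h n)) - 2 * M\<^sup>2 * ip (green (h n)) (f n) + M\<^sup>2 * M\<^sup>2 * ip (f n) (f n)"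
    proof -
      have cc: "continuous_on {0..1} (\<lambda>z. 1 * green (h n) z + (- M\<^sup>2) * f n z)"
        using c by (intro continuous_intros)
      show ?thesis
        unfolding ip_lincomb_left[OF c cc] ip_lincomb_right[OF c c(1)] ip_lincomb_right[OF c c(2)]
        by (simp add: ip_commute[of "f n" "green (h n)"] algebra_simps)
    qed
    ultimately have "(nrm (d n))\<^sup>2 = (nrm (green (h n)))\<^sup>2 - 2 * M\<^sup>2 * (nrm (h n))\<^sup>2 + M\<^sup>2 * M\<^sup>2"
      using nrm_power2[OF dc] nrm_power2[OF c(1)] nrm_power2[OF c(2), symmetric] fn
      by (simp add: d_def[abs_def])
    moreover have "(nrm (green (h n)))\<^sup>2 \<le> (M * nrm (h n))\<^sup>2"
      using MB[OF hV] nrm_nonneg[OF c(1)] by (intro power_mono)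
    ultimately show ?thesis by (simp add: power_mult_distrib algebra_simps)
  qed
  have "(\<lambda>n. M\<^sup>2 * (M\<^sup>2 - (nrm (h n))\<^sup>2)) \<longlonglongrightarrow> M\<^sup>2 * (M\<^sup>2 - M\<^sup>2)"
    by (intro tendsto_intros nh)
  then have "(\<lambda>n. M\<^sup>2 * (M\<^sup>2 - (nrm (h n))\<^sup>2)) \<longlonglongrightarrow> 0" by simp
  then have "(\<lambda>n. (nrm (d n))\<^sup>2) \<longlonglongrightarrow> 0"
    by (rule tendsto_sandwich[OF _ _ tendsto_const, rotated 2]) (use nd in auto)
  then have d0: "(\<lambda>n. nrm (d n)) \<longlonglongrightarrow> 0"
    using tendsto_real_sqrt[of "\<lambda>n. (nrm (d n))\<^sup>2" 0] nrm_nonneg[OF dc] by simp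
  \<comment> \<open>Convergence of the vectors \<open>f n\<close> themselves is not known; applying
    \<open>green\<close> to \<open>d n\<close> replaces them by \<open>h n\<close>, which do
    converge.\<close>
  have TTg: "green (green g) x = M\<^sup>2 * g x" if x: "x \<in> {0..1}" for x
  proof -
    have Td: "green (d n) x = green (green (h n)) x - M\<^sup>2 * h n x" for n
      unfolding d_def using green_diff(1)[OF green_cont[OF Vc[OF hV]] Vc[OF fV] x] by (simp add: h_def)
    have "(\<lambda>n. green (d n) x) \<longlonglongrightarrow> 0"
    proof (rule Lim_null_comparison)
      show "\<forall>\<^sub>F n in sequentially. norm (green (d n) x) \<le> green_const * nrm (d n)"
        using green_abs_le(1)[OF dc x] by simp
      show "(\<lambda>n. green_const * nrm (d n)) \<longlonglongrightarrow> 0"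
        using tendsto_mult_left[OF d0, of green_const] by simp
    qed
    moreover have "(\<lambda>n. green (green (h n)) x - M\<^sup>2 * h n x) \<longlonglongrightarrow> green (green g) x - M\<^sup>2 * g x"
    proof (intro tendsto_intros)
      show "(\<lambda>n. h n x) \<longlonglongrightarrow> g x" using tendsto_uniform_limitI[OF unif x] .
      show "(\<lambda>n. green (green (h n)) x) \<longlonglongrightarrow> green (green g) x"
      proof (rule LIM_zero_cancel, rule Lim_null_comparison)
        have "\<bar>green (green (h n)) x - green (green g) x\<bar>
            \<le> green_const * (green_opnorm * nrm (\<lambda>z. h n z - g z))" for n
        proof -
          have c: "continuous_on {0..1} (\<lambda>z. h n z - 1 * g z)"
            using Vc[OF hV] g by (intro continuous_intros)
          have "green (green (\<lambda>z. h n z - 1 * g z)) x = green (\<lambda>z. green (h n) z - 1 * green g z) x"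
          proof (rule green_cong[OF green_cont[OF c] _ _ x])
            show "continuous_on {0..1} (\<lambda>z. green (h n) z - 1 * green g z)"
              by (intro continuous_intros green_cont Vc[OF hV] g)
          qed (rule green_diff(1)[OF Vc[OF hV] g])
          also have "\<dots> = green (green (h n)) x - green (green g) x"
            using green_diff(1)[OF green_cont green_cont x, of "h n" g 1] Vc[OF hV] g by simp
          finally have "\<bar>green (green (h n)) x - green (green g) x\<bar>
              \<le> green_const * nrm (green (\<lambda>z. h n z - 1 * g z))"
            using green_abs_le(1)[OF green_cont[OF c] x] by simp
          also have "\<dots> \<le> green_const * (green_opnorm * nrm (\<lambda>z. h n z - 1 * g z))"
            using green_const(1) nrm_green_le[OF c] by (intro mult_left_mono) auto
          finally show ?thesis by simp
        qed
        then show "\<forall>\<^sub>F n in sequentially. norm (green (green (h n)) x - green (green g) x)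
            \<le> green_const * (green_opnorm * nrm (\<lambda>z. h n z - g z))" by simp
        show "(\<lambda>n. green_const * (green_opnorm * nrm (\<lambda>z. h n z - g z))) \<longlonglongrightarrow> 0"
          using tendsto_mult_left[OF tendsto_mult_left[OF hg]] by (metis mult_zero_right)
      qed
    qed
    ultimately show ?thesis unfolding Td using LIMSEQ_unique by fastforce
  qed
  \<comment> \<open>Factor T^2 - M^2 = (T - M)(T + M): \<open>e\<close> = (T + M) g satisfies T e =
    M e, hence is 0, so T g = - M g and g = 0 as well, against \<open>nrm g = M\<close> > 0.\<close>
  define e where "e z = 1 * green g z + M * g z" for z
  have eV: "e \<in> V" unfolding e_def using V_lincomb[OF VT[OF gV] gV] .
  have "green e x = M * e x" if x: "x \<in> {0..1}" for x
    using green_lincomb(1)[OF green_cont[OF g] g x, of 1 M] TTg[OF x]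
    by (simp add: e_def[abs_def] power2_eq_square algebra_simps)
  then have e0: "e x = 0" if "x \<in> {0..1}" for x
    using green_eigenvector_trivial[of e M x] eV M that by (auto simp: V_def)
  have "g x = 0" if "x \<in> {0..1}" for x
    using green_eigenvector_trivial[of g "- M" x] gV M that e0
    by (force simp: V_def e_def)
  then have "nrm g = nrm (\<lambda>_. 0)" by (rule nrm_cong)
  then show False using ng M by (simp add: nrm_def ip_def)
qed

section \<open>Fourier series and Parseval's identity\<close>

definition phi_sup :: "nat \<Rightarrow> real" where
  "phi_sup n = (SUP z\<in>{0..1}. \<bar>phi n z\<bar>)"

lemma abs_phi_le: "z \<in> {0..1} \<Longrightarrow> \<bar>phi n z\<bar> \<le> phi_sup n"
proof -
  assume z: "z \<in> {0..1}"
  obtain B where "\<And>z. z \<in> {0..1} \<Longrightarrow> \<bar>phi n z\<bar> \<le> B"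
    using continuous_on_Icc_bounded[OF phi_cont] by blast
  then have "bdd_above ((\<lambda>z. \<bar>phi n z\<bar>) ` {0..1})" by (intro bdd_aboveI2)
  then show ?thesis unfolding phi_sup_def using z by (intro cSUP_upper)
qed

lemma phi_sup_nonneg: "phi_sup n \<ge> 0"
  using abs_phi_le[of 0 n] by simp

lemma phi_sup_summable: "summable (\<lambda>n. inverse (lam n) * phi_sup n)"
  using phi_summable by (simp add: phi_sup_def)

lemma coef_sum: "coef (\<lambda>z. \<Sum>n<N. a n * phi n z) m = (if m < N then a m else 0)"
proof -
  have "coef (\<lambda>z. \<Sum>n<N. a n * phi n z) m = (\<Sum>n<N. a n * ip (phi n) (phi m))"
    unfolding coef_def using phi_cont by (intro ip_sum_left) auto
  then show ?thesis by (simp add: ip_phi if_distrib[of "(*) _"] sum.delta cong: if_cong)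
qed

lemma partial_sum_cont: "continuous_on {0..1} (\<lambda>z. \<Sum>n<N. a n * phi n z)"
  using phi_cont by (intro continuous_intros)

text \<open>Norm convergence passes to the coefficients, and the m-th coefficient of a partial sum
  is constant once the m-th term is included.\<close>

lemma fourier_series:
  assumes "summable (\<lambda>n. \<bar>a n\<bar> * phi_sup n)"
  shows "uniform_limit {0..1} (\<lambda>N z. \<Sum>n<N. a n * phi n z) (\<lambda>z. \<Sum>n. a n * phi n z) sequentially"
    "continuous_on {0..1} (\<lambda>z. \<Sum>n. a n * phi n z)"
    "coef (\<lambda>z. \<Sum>n. a n * phi n z) m = a m"
proof -
  show unif: "uniform_limit {0..1} (\<lambda>N z. \<Sum>n<N. a n * phi n z) (\<lambda>z. \<Sum>n. a n * phi n z) sequentially"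
    using assms abs_phi_le
    by (intro Weierstrass_m_test[of _ _ "\<lambda>n. \<bar>a n\<bar> * phi_sup n"])
      (auto simp: abs_mult intro!: mult_left_mono)
  note lim = nrm_uniform_limit[OF unif partial_sum_cont]
  show "continuous_on {0..1} (\<lambda>z. \<Sum>n. a n * phi n z)" by (rule lim)
  have "(\<lambda>N. coef (\<lambda>z. \<Sum>n<N. a n * phi n z) m) \<longlonglongrightarrow> coef (\<lambda>z. \<Sum>n. a n * phi n z) m"
    unfolding coef_def by (rule ip_tendsto[OF partial_sum_cont lim(1) phi_cont lim(2)])
  moreover have "(\<lambda>N. coef (\<lambda>z. \<Sum>n<N. a n * phi n z) m) \<longlonglongrightarrow> a m"
    unfolding coef_sum by (rule tendsto_eventually) (auto simp: eventually_sequentially intro!: exI[of _ "Suc m"])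
  ultimately show "coef (\<lambda>z. \<Sum>n. a n * phi n z) m = a m"
    using LIMSEQ_unique by blast
qed

lemma coef_inject:
  assumes f: "continuous_on {0..1} f" and g: "continuous_on {0..1} g"
    and "\<And>n. coef f n = coef g n" and z: "z \<in> {0..1}"
  shows "f z = g z"
proof -
  have "1 * f z + (-1) * g z = 0"
    using coef_lincomb[OF f g, of 1 "-1"] assms(3) f g z
    by (intro coef_eq_0_imp_eq_0[where ?f0.0 = "\<lambda>z. 1 * f z + (-1) * g z"] continuous_intros) auto
  then show ?thesis by simp
qed

text \<open>The function h is A f, continuous up to the endpoints. The coefficients of f thereby
  gain the factor 1/\<lambda>_n.\<close>

lemma dom_eq_green:
  assumes f: "f \<in> dom"
  obtains h where "continuous_on {0..1} h" "\<And>z. z \<in> {0..1} \<Longrightarrow> green h z = f z"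
    "\<And>n. coef f n = coef h n / lam n"
proof -
  define h where "h z = (q z * f z - flux' f z) / r z" for z
  have r0: "r z \<noteq> 0" if "z \<in> {0..1}" for z using r_pos[OF that] by simp
  have h: "continuous_on {0..1} h"
    unfolding h_def using domD[OF f] flux_derivatives(3) q_cont r_cont r0
    by (intro continuous_intros) auto
  have eq: "green h z = f z" if "z \<in> {0..1}" for z
    using r0 by (intro green_unique[OF h f _ that]) (simp add: h_def)
  have "coef f n = coef (green h) n" for n
    unfolding coef_def using eq by (intro ip_cong) auto
  then have "coef f n = coef h n / lam n" for n
    using coef_green[OF h] by simp
  then show thesis using that[OF h eq] by blast
qed

text \<open>The coefficients of A f are bounded by its norm, so those of f are O(1/\<lambda>_n), and
  the assumed series is a majorant.\<close>

lemma summable_coef_dom: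
  assumes "f \<in> dom"
  shows "summable (\<lambda>n. \<bar>coef f n\<bar> * phi_sup n)"
proof -
  obtain h where h: "continuous_on {0..1} h" "\<And>n. coef f n = coef h n / lam n"
    using dom_eq_green[OF assms] by metis
  show ?thesis
  proof (rule summable_comparison_test[OF _ summable_mult[OF phi_sup_summable, of "nrm h"]],
      intro exI allI impI)
    fix n
    show "norm (\<bar>coef f n\<bar> * phi_sup n) \<le> nrm h * (inverse (lam n) * phi_sup n)"
      using abs_coef_le[OF h(1), of n] phi_sup_nonneg[of n] lam_pos[of n]
      by (auto simp: h(2) abs_mult divide_inverse abs_of_pos mult.assoc intro!: mult_right_mono)
  qed
qed

text \<open>The uniform sum has the same coefficients as f; completeness identifies the two.\<close>

lemma fourier_dom:
  assumes f: "f \<in> dom"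
  shows "(\<lambda>N. nrm (\<lambda>z. (\<Sum>n<N. coef f n * phi n z) - f z)) \<longlonglongrightarrow> 0"
    "z \<in> {0..1} \<Longrightarrow> (\<Sum>n. coef f n * phi n z) = f z"
proof -
  note s = fourier_series[OF summable_coef_dom[OF f]]
  show *: "(\<Sum>n. coef f n * phi n z) = f z" if "z \<in> {0..1}" for z
    by (rule coef_inject[OF s(2) domD(4)[OF f] s(3) that])
  have "nrm (\<lambda>z. (\<Sum>n<N. coef f n * phi n z) - f z)
      = nrm (\<lambda>z. (\<Sum>n<N. coef f n * phi n z) - (\<Sum>n. coef f n * phi n z))" for N
    using * by (intro nrm_cong) simp
  then show "(\<lambda>N. nrm (\<lambda>z. (\<Sum>n<N. coef f n * phi n z) - f z)) \<longlonglongrightarrow> 0"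
    using nrm_uniform_limit(2)[OF s(1) partial_sum_cont] by simp
qed

text \<open>Completing the square in the coefficients c. For c = \<open>coef f\<close> it yields
  Bessel's inequality; for general c it says that the Fourier partial sum is the best
  approximation.\<close>

lemma residual:
  assumes f: "continuous_on {0..1} f"
  shows "(nrm (\<lambda>z. f z - (\<Sum>n<N. c n * phi n z)))\<^sup>2
    = ip f f - (\<Sum>n<N. (coef f n)\<^sup>2) + (\<Sum>n<N. (c n - coef f n)\<^sup>2)"
proof -
  let ?S = "\<lambda>z. \<Sum>n<N. c n * phi n z"
  note S = partial_sum_cont[where N = N and a = c]
  have d: "continuous_on {0..1} (\<lambda>z. f z - ?S z)" by (intro continuous_on_diff f S)
  have Sf: "ip ?S f = (\<Sum>n<N. c n * coef f n)"
    by (subst ip_sum_left) (auto simp: phi_cont f coef_def ip_commute)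
  have SS: "ip ?S ?S = (\<Sum>n<N. c n * c n)"
  proof -
    have "ip ?S ?S = (\<Sum>n<N. c n * coef ?S n)"
      by (subst ip_sum_left) (auto simp: phi_cont S coef_def ip_commute[of "phi _" ?S])
    then show ?thesis by (simp add: coef_sum)
  qed
  have "(nrm (\<lambda>z. f z - ?S z))\<^sup>2 = ip f (\<lambda>z. f z - ?S z) - ip ?S (\<lambda>z. f z - ?S z)"
    using nrm_power2[OF d] ip_diff_left[OF f S d] by simp
  also have "\<dots> = ip f f - 2 * ip ?S f + ip ?S ?S"
    using ip_diff_left[OF f S f] ip_diff_left[OF f S S]
    by (simp add: ip_commute[of f ?S] ip_commute[of f "\<lambda>z. f z - ?S z"]
        ip_commute[of ?S "\<lambda>z. f z - ?S z"])
  also have "\<dots> = ip f f - (\<Sum>n<N. (coef f n)\<^sup>2) + (\<Sum>n<N. (c n - coef f n)\<^sup>2)"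
    unfolding Sf SS power2_diff
    by (simp add: sum.distrib sum_subtractf sum_distrib_left power2_eq_square mult_ac)
  finally show ?thesis .
qed

lemma bessel:
  assumes f: "continuous_on {0..1} f"
  shows "(\<Sum>n<N. (coef f n)\<^sup>2) \<le> ip f f"
proof -
  have "0 \<le> (nrm (\<lambda>z. f z - (\<Sum>n<N. coef f n * phi n z)))\<^sup>2" by simp
  then show ?thesis unfolding residual[OF f] by simp
qed

text \<open>
  Multiplication by \<open>1 - (1 - (z * (1 - z))\<^sup>2) ^ k\<close>, which vanishes to second order at the endpoints,
  turns a \<open>C\<^sup>2\<close> function into one satisfying both boundary conditions.
\<close>
lemma dom_dense:
  assumes f: "Ck_on 2 {0..1} f" and e: "e > 0"
  obtains g where "g \<in> dom" "nrm (\<lambda>z. f z - g z) < e"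
proof -
  define c where "c z = 1 - (z * (1 - z))\<^sup>2" for z :: real
  have c01: "0 \<le> c z" "c z \<le> 1" if "z \<in> {0..1}" for z
  proof -
    have "0 \<le> z * (1 - z)" "z * (1 - z) \<le> 1" using that by (auto intro!: mult_le_one)
    then have "(z * (1 - z))\<^sup>2 \<le> 1" by (simp add: power_le_one)
    then show "0 \<le> c z" "c z \<le> 1" by (simp_all add: c_def)
  qed
  have c1: "c z < 1" if "z \<in> {0<..<1}" for z using that by (simp add: c_def)
  have fc: "continuous_on {0..1} f" using Ck_on_2D(3)[OF f] .
  have const: "Ck_on 2 {0..1} (\<lambda>_. a)" for a :: real
    by (rule Ck_on_2I[where f' = "\<lambda>_. 0" and f'' = "\<lambda>_. 0"]) (auto simp: at_within_Icc_neq_bot)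
  have id: "Ck_on 2 {0..1} (\<lambda>z. z :: real)"
    by (rule Ck_on_2I[where f' = "\<lambda>_. 1" and f'' = "\<lambda>_. 0"]) (auto simp: at_within_Icc_neq_bot)
  have id1: "Ck_on 2 {0..1} (\<lambda>z. 1 - z :: real)"
    using lincomb(1)[OF const[of 1] id, of 1 "-1"] by simp
  have "Ck_on 2 {0..1} (\<lambda>z. (z * (1 - z)) * (z * (1 - z)) :: real)"
    by (intro Ck_on_2_mult id id1)
  then have cC: "Ck_on 2 {0..1} c"
    using lincomb(1)[OF const[of 1], of _ 1 "-1"] by (simp add: c_def[abs_def] power2_eq_square)
  have cpC: "Ck_on 2 {0..1} (\<lambda>z. c z ^ k)" for k
    by (induction k) (auto intro: const Ck_on_2_mult cC)
  define g where "g k z = f z * (1 - c z ^ k)" for k z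
  have gC: "Ck_on 2 {0..1} (g k)" for k
    using Ck_on_2_mult[OF f lincomb(1)[OF const[of 1] cpC, of 1 "-1" k]] by (simp add: g_def[abs_def])
  have dg: "deriv_on {0..1} (g k) z = 0" if "z \<in> {0, 1}" for k z
  proof -
    have z: "z \<in> {0..1}" using that by auto
    have "(g k has_real_derivative deriv_on {0..1} f z * (1 - c z ^ k) + 0 * f z) (at z within {0..1})"
      unfolding g_def
    proof (rule DERIV_mult)
      show "((\<lambda>z. 1 - c z ^ k) has_real_derivative 0) (at z within {0..1})"
        unfolding c_def using that by (auto intro!: derivative_eq_intros)
    qed (rule Ck_on_2D(1)[OF f z])
    then have "deriv_on {0..1} (g k) z = deriv_on {0..1} f z * (1 - c z ^ k) + 0 * f z"
      by (rule deriv_on_eqI) (rule at_within_Icc_neq_bot[OF z])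
    then show ?thesis using that by (auto simp: c_def)
  qed
  have g_dom: "g k \<in> dom" for k
    using gC dg by (simp add: sl_domain_def) (simp add: g_def c_def)
  \<comment> \<open>The open interval matters: \<open>c\<close> equals 1 at both endpoints, and its
    powers tend to 0 only inside, not uniformly. Dominated convergence copes with this.\<close>
  have "(\<lambda>k. integral {0<..<1} (\<lambda>z. r z * (f z * c z ^ k) * (f z * c z ^ k)))
      \<longlonglongrightarrow> integral {0<..<1::real} (\<lambda>z. 0::real)"
  proof (rule dominated_convergence(2)[where h = "\<lambda>z. r z * (f z)\<^sup>2"])
    have i: "h integrable_on {0<..<1}" if "continuous_on {0..1} h" for h :: "real \<Rightarrow> real"
      using integrable_continuous_real[OF that] integrable_on_open_interval_real by blast
    show "(\<lambda>z. r z * (f z * c z ^ k) * (f z * c z ^ k)) integrable_on {0<..<1}" for k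
      by (intro i continuous_on_mult fc Ck_on_2D(3)[OF cpC] r_cont)
    show "(\<lambda>z. r z * (f z)\<^sup>2) integrable_on {0<..<1}"
      using r_cont fc by (intro i continuous_intros)
    fix z :: real assume z: "z \<in> {0<..<1}"
    then have z': "z \<in> {0..1}" by auto
    show "norm (r z * (f z * c z ^ k) * (f z * c z ^ k)) \<le> r z * (f z)\<^sup>2" for k
    proof -
      have "c z ^ k * c z ^ k \<le> 1 * 1"
        using c01[OF z'] by (intro mult_mono power_le_one) auto
      then have "r z * (f z)\<^sup>2 * (c z ^ k * c z ^ k) \<le> r z * (f z)\<^sup>2 * 1"
        using r_pos[OF z'] by (intro mult_left_mono) auto
      moreover have "norm (r z * (f z * c z ^ k) * (f z * c z ^ k)) = r z * (f z)\<^sup>2 * (c z ^ k * c z ^ k)"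
        using r_pos[OF z'] c01[OF z'] by (simp add: abs_mult power2_eq_square mult_ac)
      ultimately show ?thesis by simp
    qed
    have 0: "(\<lambda>k. c z ^ k) \<longlonglongrightarrow> 0"
      using c01(1)[OF z'] c1[OF z] by (intro LIMSEQ_realpow_zero)
    have "(\<lambda>k. r z * (f z * c z ^ k) * (f z * c z ^ k)) \<longlonglongrightarrow> r z * (f z * 0) * (f z * 0)"
      by (intro tendsto_mult tendsto_const 0)
    then show "(\<lambda>k. r z * (f z * c z ^ k) * (f z * c z ^ k)) \<longlonglongrightarrow> 0" by simp
  qed
  then have "(\<lambda>k. ip (\<lambda>z. f z * c z ^ k) (\<lambda>z. f z * c z ^ k)) \<longlonglongrightarrow> 0"
    by (simp add: ip_def integral_open_interval_real)
  then have "(\<lambda>k. nrm (\<lambda>z. f z * c z ^ k)) \<longlonglongrightarrow> 0"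
    unfolding nrm_def using tendsto_real_sqrt[where x = 0] by simp
  from LIMSEQ_D[OF this e] obtain k where "\<bar>nrm (\<lambda>z. f z * c z ^ k)\<bar> < e"
    by auto
  moreover have "nrm (\<lambda>z. f z - g k z) = nrm (\<lambda>z. f z * c z ^ k)"
    by (simp add: g_def algebra_simps)
  ultimately show thesis using that[OF g_dom, of k] by simp
qed

text \<open>Choose g in \<open>dom\<close> close to f in norm. The partial sums of g converge to g
  in norm, and those of f approximate f at least as well. Each error gets half of sqrt e, since the
  norm is squared in the end.\<close>

theorem parseval:
  assumes f: "Ck_on 2 {0..1} f"
  shows "(\<lambda>n. (coef f n)\<^sup>2) sums ip f f"
  unfolding sums_def
proof (rule LIMSEQ_I)
  fix e :: real assume e: "e > 0"
  note fc = Ck_on_2D(3)[OF f]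
  obtain g where g: "g \<in> dom" "nrm (\<lambda>z. f z - g z) < sqrt e / 2"
    using dom_dense[OF f, of "sqrt e / 2"] e by auto
  note gc = domD(4)[OF g(1)]
  obtain N0 where N0: "\<And>N. N \<ge> N0 \<Longrightarrow> \<bar>nrm (\<lambda>z. (\<Sum>n<N. coef g n * phi n z) - g z)\<bar> < sqrt e / 2"
    using LIMSEQ_D[OF fourier_dom(1)[OF g(1)], of "sqrt e / 2"] e by auto
  have "norm ((\<Sum>n<N. (coef f n)\<^sup>2) - ip f f) < e" if "N \<ge> N0" for N
  proof -
    let ?S = "\<lambda>z. \<Sum>n<N. coef g n * phi n z"
    have Sc: "continuous_on {0..1} ?S" by (rule partial_sum_cont)
    have d: "continuous_on {0..1} (\<lambda>z. f z - ?S z)" by (intro continuous_on_diff fc Sc)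
    have "nrm (\<lambda>z. f z - ?S z) \<le> nrm (\<lambda>z. f z - g z) + nrm (\<lambda>z. g z - ?S z)"
      by (rule nrm_diff_triangle[OF fc gc Sc])
    also have "nrm (\<lambda>z. g z - ?S z) = nrm (\<lambda>z. ?S z - g z)"
      using nrm_scale[of "-1" "\<lambda>z. ?S z - g z"] by simp
    finally have "nrm (\<lambda>z. f z - ?S z) < sqrt e" using g(2) N0[OF that] by linarith
    then have "(nrm (\<lambda>z. f z - ?S z))\<^sup>2 < (sqrt e)\<^sup>2"
      using nrm_nonneg[OF d] by (intro power_strict_mono) auto
    then have "(nrm (\<lambda>z. f z - ?S z))\<^sup>2 < e" using e by simp
    moreover have "ip f f - (\<Sum>n<N. (coef f n)\<^sup>2) \<le> (nrm (\<lambda>z. f z - ?S z))\<^sup>2"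
      unfolding residual[OF fc] by (simp add: sum_nonneg)
    ultimately show ?thesis using bessel[OF fc, of N] by simp
  qed
  then show "\<exists>N0. \<forall>N\<ge>N0. norm ((\<Sum>n<N. (coef f n)\<^sup>2) - ip f f) < e" by blast
qed

end

section \<open>The stationary problem\<close>

context sl_invertible
begin

text \<open>The function \<open>lift\<close> is \<open>\<tilde>x / sqrt (b\<^sub>1\<^sup>2 + b\<^sub>2\<^sup>2)\<close>.\<close>
definition lift :: "real \<Rightarrow> real" where
  "lift = (SOME y. Ck_on 2 {0..1} y \<and> (\<forall>z\<in>{0..1}. flux' y z = q z * y z) \<and>
     b1 * y 0 + b2 * deriv_on {0..1} y 0 = 1 \<and> a1 * y 1 + a2 * deriv_on {0..1} y 1 = 0)"

lemma lift:
  "Ck_on 2 {0..1} lift" "\<And>z. z \<in> {0..1} \<Longrightarrow> flux' lift z = q z * lift z"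
  "b1 * lift 0 + b2 * deriv_on {0..1} lift 0 = 1"
  "a1 * lift 1 + a2 * deriv_on {0..1} lift 1 = 0"
proof -
  obtain v where v: "Ck_on 2 {0..1} v" "\<And>z. z \<in> {0..1} \<Longrightarrow> flux' v z = q z * v z"
    "a1 * v 1 + a2 * deriv_on {0..1} v 1 = 0" "b1 * v 0 + b2 * deriv_on {0..1} v 0 \<noteq> 0"
    using right_solution by blast
  define c where "c = inverse (b1 * v 0 + b2 * deriv_on {0..1} v 0)"
  have "b1 * (c * v 0) + b2 * (c * deriv_on {0..1} v 0) = c * (b1 * v 0 + b2 * deriv_on {0..1} v 0)"
    "a1 * (c * v 1) + a2 * (c * deriv_on {0..1} v 1) = c * (a1 * v 1 + a2 * deriv_on {0..1} v 1)"
    by (simp_all add: algebra_simps)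
  then have "\<exists>y. Ck_on 2 {0..1} y \<and> (\<forall>z\<in>{0..1}. flux' y z = q z * y z) \<and>
     b1 * y 0 + b2 * deriv_on {0..1} y 0 = 1 \<and> a1 * y 1 + a2 * deriv_on {0..1} y 1 = 0"
    using scale[OF v(1), where c = c] v(2,3,4) by (intro exI[of _ "\<lambda>z. c * v z"]) (simp add: c_def)
  from someI_ex[OF this] show "Ck_on 2 {0..1} lift" "\<And>z. z \<in> {0..1} \<Longrightarrow> flux' lift z = q z * lift z"
    "b1 * lift 0 + b2 * deriv_on {0..1} lift 0 = 1"
    "a1 * lift 1 + a2 * deriv_on {0..1} lift 1 = 0"
    unfolding lift_def[symmetric] by blast+
qed

lemma lift_cont: "continuous_on {0..1} lift"
  using Ck_on_2D(3)[OF lift(1)] .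

text \<open>Makes the left boundary condition homogeneous and keeps the right one; the shape of the
  term is that of \<open>lincomb\<close>.\<close>

lemma X_space_sub_lift:
  assumes "y \<in> X_space a1 a2 b1 b2 \<mu>"
  shows "(\<lambda>z. 1 * y z + (- \<mu>) * lift z) \<in> dom"
proof -
  have y: "Ck_on 2 {0..1} y" "b1 * y 0 + b2 * deriv_on {0..1} y 0 = \<mu>"
    "a1 * y 1 + a2 * deriv_on {0..1} y 1 = 0"
    using assms by (auto simp: X_space_def)
  have "b1 * (1 * y 0 + (- \<mu>) * lift 0) + b2 * (1 * deriv_on {0..1} y 0 + (- \<mu>) * deriv_on {0..1} lift 0)
      = (b1 * y 0 + b2 * deriv_on {0..1} y 0) - \<mu> * (b1 * lift 0 + b2 * deriv_on {0..1} lift 0)"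
    "a1 * (1 * y 1 + (- \<mu>) * lift 1) + a2 * (1 * deriv_on {0..1} y 1 + (- \<mu>) * deriv_on {0..1} lift 1)
      = (a1 * y 1 + a2 * deriv_on {0..1} y 1) - \<mu> * (a1 * lift 1 + a2 * deriv_on {0..1} lift 1)"
    by (simp_all add: algebra_simps)
  then show ?thesis
    using lincomb(1)[OF y(1) lift(1), of 1 "- \<mu>"] deriv_on_lincomb[OF y(1) lift(1), of _ 1 "- \<mu>"] y(2,3) lift(3,4)
    by (simp add: sl_domain_def)
qed

lemma X_space_add_lift:
  assumes "f \<in> dom"
  shows "(\<lambda>z. 1 * f z + \<mu> * lift z) \<in> X_space a1 a2 b1 b2 \<mu>"
proof -
  note f = domD[OF assms]
  have "b1 * (1 * f 0 + \<mu> * lift 0) + b2 * (1 * deriv_on {0..1} f 0 + \<mu> * deriv_on {0..1} lift 0)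
      = (b1 * f 0 + b2 * deriv_on {0..1} f 0) + \<mu> * (b1 * lift 0 + b2 * deriv_on {0..1} lift 0)"
    "a1 * (1 * f 1 + \<mu> * lift 1) + a2 * (1 * deriv_on {0..1} f 1 + \<mu> * deriv_on {0..1} lift 1)
      = (a1 * f 1 + a2 * deriv_on {0..1} f 1) + \<mu> * (a1 * lift 1 + a2 * deriv_on {0..1} lift 1)"
    by (simp_all add: algebra_simps)
  then show ?thesis
    using lincomb(1)[OF f(1) lift(1), of 1 \<mu>] deriv_on_lincomb[OF f(1) lift(1), of _ 1 \<mu>] f(2,3) lift(3,4)
    by (simp add: X_space_def)
qed

lemma X_space_cong:
  assumes "\<And>z. z \<in> {0..1} \<Longrightarrow> f z = g z"
  shows "f \<in> X_space a1 a2 b1 b2 \<mu> \<longleftrightarrow> g \<in> X_space a1 a2 b1 b2 \<mu>"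
  using Ck_on_cong[of "{0..1}" f g 2] deriv_on_cong[of "{0..1}" f g 0]
    deriv_on_cong[of "{0..1}" f g 1] assms
  by (simp add: X_space_def)

lemma bvp_solution_iff:
  "bvp_solution p q a1 a2 b1 b2 y \<longleftrightarrow>
    (\<forall>z\<in>{0..1}. flux' y z = q z * y z) \<and> y \<in> X_space a1 a2 b1 b2 (sqrt (b1\<^sup>2 + b2\<^sup>2))"
  by (auto simp: bvp_solution_def X_space_def flux_def)

lemma bvp_solution_eq_lift:
  assumes "bvp_solution p q a1 a2 b1 b2 y" "z \<in> {0..1}"
  shows "y z = sqrt (b1\<^sup>2 + b2\<^sup>2) * lift z"
proof -
  have y: "y \<in> X_space a1 a2 b1 b2 (sqrt (b1\<^sup>2 + b2\<^sup>2))"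
    "\<And>z. z \<in> {0..1} \<Longrightarrow> flux' y z = q z * y z"
    using assms(1) by (auto simp: bvp_solution_iff)
  have "1 * y z + (- sqrt (b1\<^sup>2 + b2\<^sup>2)) * lift z = 0"
  proof (rule homogeneous_eq_0[OF X_space_sub_lift[OF y(1)] _ assms(2)])
    fix z :: real assume "z \<in> {0<..<1}"
    then have z: "z \<in> {0..1}" by auto
    have "Ck_on 2 {0..1} y" using y(1) by (simp add: X_space_def)
    from lincomb(3)[OF this lift(1) z, of 1 "- sqrt (b1\<^sup>2 + b2\<^sup>2)"]
    show "flux' (\<lambda>z. 1 * y z + - sqrt (b1\<^sup>2 + b2\<^sup>2) * lift z) z
        = q z * (1 * y z + - sqrt (b1\<^sup>2 + b2\<^sup>2) * lift z)"
      using y(2)[OF z] lift(2)[OF z] by (simp add: algebra_simps)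
  qed
  then show ?thesis by simp
qed

lemma lift_bvp_solution:
  "bvp_solution p q a1 a2 b1 b2 (\<lambda>z. sqrt (b1\<^sup>2 + b2\<^sup>2) * lift z)"
proof -
  let ?s = "sqrt (b1\<^sup>2 + b2\<^sup>2)"
  have "b1 * (?s * lift 0) + b2 * (?s * deriv_on {0..1} lift 0)
      = ?s * (b1 * lift 0 + b2 * deriv_on {0..1} lift 0)"
    "a1 * (?s * lift 1) + a2 * (?s * deriv_on {0..1} lift 1)
      = ?s * (a1 * lift 1 + a2 * deriv_on {0..1} lift 1)"
    by (simp_all only: algebra_simps)
  then show ?thesis
    using scale[OF lift(1), where c = ?s] lift by (simp add: bvp_solution_iff X_space_def)
qed

end

section \<open>The modal equations\<close>

text \<open>For s = 1 and s = -1 the function (s y - G/l) exp(l t) is nonincreasing, since its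
  derivative is (s g - G) exp(l t). The level G/l is where decay balances the largest
  forcing.\<close>

lemma linear_ode_bound:
  fixes y g :: "real \<Rightarrow> real"
  assumes l: "l > 0" and y: "continuous_on {0..} y"
    and ode: "\<And>t. t > 0 \<Longrightarrow> (y has_real_derivative - l * y t + g t) (at t)"
    and T: "T \<ge> 0" and G: "\<And>t. t \<in> {0..T} \<Longrightarrow> \<bar>g t\<bar> \<le> G"
  shows "\<bar>y T\<bar> \<le> exp (- l * T) * \<bar>y 0\<bar> + G / l"
proof -
  have G0: "G \<ge> 0" using G[of 0] T by force
  have *: "s * y T \<le> exp (- l * T) * \<bar>y 0\<bar> + G / l" if s: "s \<in> {1, -1}" for s :: real
  proof -
    define F where "F t = (s * y t - G / l) * exp (l * t)" for t
    have "F T \<le> F 0"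
    proof (rule DERIV_nonpos_imp_decreasing_open[OF T])
      show "continuous_on {0..T} F"
        unfolding F_def using continuous_on_subset[OF y, of "{0..T}"]
        by (intro continuous_intros) auto
      fix t assume t: "0 < t" "t < T"
      have "(F has_real_derivative (s * g t - G) * exp (l * t)) (at t)"
        unfolding F_def using l
        by (auto intro!: derivative_eq_intros ode t simp: algebra_simps)
      moreover have "s * g t \<le> G" using G[of t] t s by auto
      ultimately show "\<exists>d. (F has_real_derivative d) (at t) \<and> d \<le> 0"
        by (intro exI conjI) (auto simp: mult_le_0_iff)
    qed
    moreover have "F 0 \<le> \<bar>y 0\<bar>"
    proof -
      have "s * y 0 \<le> \<bar>y 0\<bar>" using s by auto
      moreover have "0 \<le> G / l" using G0 l by simp
      ultimately show ?thesis by (simp add: F_def)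
    qed
    ultimately have "exp (- l * T) * ((s * y T - G / l) * exp (l * T)) \<le> exp (- l * T) * \<bar>y 0\<bar>"
      by (intro mult_left_mono) (auto simp: F_def)
    then show ?thesis by (simp add: mult_exp_exp mult.left_commute algebra_simps flip: exp_add)
  qed
  show ?thesis using *[of 1] *[of "-1"] by (simp add: abs_le_iff)
qed

text \<open>From (\<epsilon> a - b)^2 / \<epsilon> >= 0; \<epsilon> trades the initial data against
  the input in the final estimate.\<close>

lemma young:
  fixes a b \<epsilon> :: real
  assumes "\<epsilon> > 0"
  shows "(a + b)\<^sup>2 \<le> (1 + \<epsilon>) * a\<^sup>2 + (1 + inverse \<epsilon>) * b\<^sup>2"
proof -
  have "0 \<le> (\<epsilon> * a - b)\<^sup>2 / \<epsilon>" using assms by simp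
  also have "\<dots> = \<epsilon> * a\<^sup>2 - 2 * a * b + inverse \<epsilon> * b\<^sup>2"
    using assms by (simp add: power2_eq_square field_simps)
  finally show ?thesis by (simp add: power2_sum algebra_simps)
qed

context sl_basis
begin

text \<open>The strength with which the boundary input drives mode n: in Green's identity the
  boundary terms reduce to \<open>kappa n\<close> times the boundary value.\<close>

definition kappa :: "nat \<Rightarrow> real" where
  "kappa n = p 0 * (b1 * deriv_on {0..1} (phi n) 0 - b2 * phi n 0) / (b1\<^sup>2 + b2\<^sup>2)"

lemma b_norm_pos: "b1\<^sup>2 + b2\<^sup>2 > 0"
  using b_nontrivial by (auto simp: sum_power2_gt_zero_iff)

text \<open>Green's identity against \<open>phi n\<close>: the condition at 1 removes one boundary
  term, and the inhomogeneous condition at 0 leaves the input. For a solution the left-hand side is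
  the time derivative of its coefficient.\<close>

lemma boundary_coef:
  assumes y: "y \<in> X_space a1 a2 b1 b2 \<mu>"
  shows "integral {0..1} (\<lambda>z. (flux' y z - q z * y z) * phi n z) = - lam n * coef y n + kappa n * \<mu>"
proof -
  have yC: "Ck_on 2 {0..1} y" and y0: "b1 * y 0 + b2 * deriv_on {0..1} y 0 = \<mu>"
    and y1: "a1 * y 1 + a2 * deriv_on {0..1} y 1 = 0"
    using y by (auto simp: X_space_def)
  note f = domD[OF phi_dom[of n]]
  let ?\<phi> = "phi n"
  have "integral {0..1} (\<lambda>z. flux' y z * ?\<phi> z - y z * flux' ?\<phi> z)
      = p 0 * (y 0 * deriv_on {0..1} ?\<phi> 0 - deriv_on {0..1} y 0 * ?\<phi> 0)"
    unfolding green_identity[OF yC f(1)] using boundary_wronskian[OF a_nontrivial y1 f(3)]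
    by (simp add: flux_def algebra_simps)
  also have "\<dots> = kappa n * \<mu>"
  proof -
    \<comment> \<open>Determinant of (y, y') and (\<phi>, \<phi>') at 0, expanded in the orthogonal
      frame (b1, b2), (b2, - b1); the product on the right vanishes by the boundary condition of
      \<phi>.\<close>
    have "(b1\<^sup>2 + b2\<^sup>2) * (y 0 * deriv_on {0..1} ?\<phi> 0 - deriv_on {0..1} y 0 * ?\<phi> 0)
        - (b1 * y 0 + b2 * deriv_on {0..1} y 0) * (b1 * deriv_on {0..1} ?\<phi> 0 - b2 * ?\<phi> 0)
        = (b2 * y 0 - b1 * deriv_on {0..1} y 0) * (b1 * ?\<phi> 0 + b2 * deriv_on {0..1} ?\<phi> 0)"
      by (simp add: algebra_simps power2_eq_square)
    then have "(b1\<^sup>2 + b2\<^sup>2) * (y 0 * deriv_on {0..1} ?\<phi> 0 - deriv_on {0..1} y 0 * ?\<phi> 0)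
        = \<mu> * (b1 * deriv_on {0..1} ?\<phi> 0 - b2 * ?\<phi> 0)"
      unfolding y0 f(2) by simp
    then have "y 0 * deriv_on {0..1} ?\<phi> 0 - deriv_on {0..1} y 0 * ?\<phi> 0
        = \<mu> * (b1 * deriv_on {0..1} ?\<phi> 0 - b2 * ?\<phi> 0) / (b1\<^sup>2 + b2\<^sup>2)"
      using b_norm_pos by (intro nonzero_eq_divide_eq[THEN iffD2]) (auto simp: mult.commute)
    then show ?thesis by (simp add: kappa_def)
  qed
  finally have 1: "integral {0..1} (\<lambda>z. flux' y z * ?\<phi> z - y z * flux' ?\<phi> z) = kappa n * \<mu>" .
  have "integral {0..1} (\<lambda>z. flux' y z * ?\<phi> z - y z * flux' ?\<phi> z)
      = integral {0..1} (\<lambda>z. (flux' y z - q z * y z) * ?\<phi> z + lam n * (r z * y z * ?\<phi> z))"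
    by (intro integral_cong) (simp add: eigenfunctionD[OF phi_eigen] algebra_simps)
  also have "\<dots> = integral {0..1} (\<lambda>z. (flux' y z - q z * y z) * ?\<phi> z) + lam n * coef y n"
    unfolding coef_def ip_def
    using Ck_on_2D(3)[OF yC] flux_derivatives(3)[OF yC] f(4) q_cont r_cont
    by (subst integral_add) (auto intro!: integrable_continuous_real continuous_intros)
  finally show ?thesis using 1 by simp
qed

text \<open>\<open>lift\<close> solves the stationary equation with boundary value 1, so the
  integral in \<open>boundary_coef\<close> vanishes.\<close>

lemma coef_lift: "coef lift n = kappa n / lam n"
proof -
  have "lift \<in> X_space a1 a2 b1 b2 1" using lift by (simp add: X_space_def)
  from boundary_coef[OF this, of n]
  have "integral {0..1} (\<lambda>z. (flux' lift z - q z * lift z) * phi n z) = - lam n * coef lift n + kappa n"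
    by simp
  moreover have "integral {0..1} (\<lambda>z. (flux' lift z - q z * lift z) * phi n z) = integral {0..1} (\<lambda>z::real. 0::real)"
    using lift(2) by (intro integral_cong) simp
  ultimately show ?thesis using lam_pos[of n] by (simp add: field_simps)
qed

lemma gain_term_eq: "gain_term b1 b2 lam phi n = ((b1\<^sup>2 + b2\<^sup>2) / p 0 * coef lift n)\<^sup>2"
proof -
  have *: "(b1\<^sup>2 + b2\<^sup>2) / p 0 * coef lift n
      = (b1 * deriv_on {0..1} (phi n) 0 - b2 * phi n 0) / lam n"
    using b_norm_pos p_neq_0[of 0] by (simp add: coef_lift kappa_def)
  show ?thesis unfolding * gain_term_def power_divide by (simp add: divide_inverse mult.commute)
qed

text \<open>Parseval's identity for \<open>lift\<close>, whose coefficients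
  \<open>kappa n / lam n\<close> carry the bracket of \<open>gain_term\<close>; it yields the
  summability too. The solution of the boundary value problem is sqrt(b1^2 + b2^2) times
  \<open>lift\<close>, so this links the two forms of C.\<close>

lemma gain:
  "summable (gain_term b1 b2 lam phi)"
  "gain p b1 b2 lam phi = sqrt (b1\<^sup>2 + b2\<^sup>2) * nrm lift"
proof -
  let ?S = "b1\<^sup>2 + b2\<^sup>2"
  have "gain_term b1 b2 lam phi sums ((?S / p 0)\<^sup>2 * ip lift lift)"
    unfolding gain_term_eq[abs_def] power_mult_distrib by (intro sums_mult parseval lift)
  then have sum: "summable (gain_term b1 b2 lam phi)"
    "(\<Sum>n. gain_term b1 b2 lam phi n) = (?S / p 0)\<^sup>2 * ip lift lift"
    by (auto simp: sums_iff)
  show "summable (gain_term b1 b2 lam phi)" by (rule sum(1))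
  have "gain p b1 b2 lam phi = p 0 / sqrt ?S * (?S / p 0 * nrm lift)"
    unfolding gain_def sum(2) nrm_def real_sqrt_mult real_sqrt_abs
    using p_pos[of 0] b_norm_pos by (simp add: abs_of_pos)
  also have "\<dots> = ?S / sqrt ?S * nrm lift" using p_neq_0[of 0] by simp
  also have "?S / sqrt ?S = sqrt ?S" by (rule real_div_sqrt) simp
  finally show "gain p b1 b2 lam phi = sqrt ?S * nrm lift" .
qed

section \<open>Modal equations, uniqueness and the estimate for arbitrary solutions\<close>

lemma coef_solution:
  assumes y: "pde_solution p q r a1 a2 b1 b2 d x0 y"
  shows "continuous_on {0..} (\<lambda>t. coef (y t) n)"
    "t > 0 \<Longrightarrow> ((\<lambda>t. coef (y t) n) has_real_derivative - lam n * coef (y t) n + kappa n * d t) (at t)"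
proof -
  have yc: "continuous_on ({0..} \<times> {0..1}) (\<lambda>(t, z). y t z)" and C1: "C1_strip y"
    and yX: "\<And>t. t \<ge> 0 \<Longrightarrow> y t \<in> X_space a1 a2 b1 b2 (d t)"
    and pde: "\<And>t z. t > 0 \<Longrightarrow> z \<in> {0<..<1} \<Longrightarrow>
      deriv (\<lambda>s. y s z) t - 1 / r z * flux' (y t) z + q z / r z * y t z = 0"
    using y unfolding pde_solution_def flux_def by simp_all
  have rphi: "continuous_on (U \<times> {0..1}) (\<lambda>p. r (snd p) * phi n (snd p))" for U :: "real set"
    by (intro continuous_on_mult continuous_on_compose2[OF r_cont]
        continuous_on_compose2[OF phi_cont] continuous_on_snd continuous_on_id) auto
  show "continuous_on {0..} (\<lambda>t. coef (y t) n)"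
    unfolding coef_def ip_def box_real(2)[symmetric]
  proof (rule integral_continuous_on_param)
    show "continuous_on ({0..} \<times> cbox 0 1) (\<lambda>(t, z). r z * y t z * phi n z)"
      using continuous_on_mult[OF rphi yc] by (simp add: split_beta mult_ac)
  qed
  assume t: "t > 0"
  \<comment> \<open>Differentiation under the integral rests on joint continuity of the time
    derivative, available for t > 0 and up to z = 0 and z = 1.\<close>
  have "((\<lambda>t. integral (cbox 0 1) (\<lambda>z. r z * y t z * phi n z)) has_real_derivative
      integral (cbox 0 1) (\<lambda>z. r z * deriv (\<lambda>s. y s z) t * phi n z)) (at t within {0<..})"
  proof (rule leibniz_rule_field_derivative)
    fix t z :: real assume tz: "t \<in> {0<..}" "z \<in> cbox 0 1"
    then have "((\<lambda>s. y s z) has_real_derivative deriv (\<lambda>s. y s z) t) (at t)"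
      using C1 unfolding C1_strip_def DERIV_deriv_iff_real_differentiable by simp
    from DERIV_cmult_right[OF DERIV_cmult[OF this, of "r z"], of "phi n z"]
    show "((\<lambda>t. r z * y t z * phi n z) has_real_derivative r z * deriv (\<lambda>s. y s z) t * phi n z)
        (at t within {0<..})"
      by (rule has_field_derivative_at_within)
  next
    fix t :: real assume "t \<in> {0<..}"
    then have "Ck_on 2 {0..1} (y t)" using yX[of t] by (simp add: X_space_def)
    from ip_integrable[OF Ck_on_2D(3)[OF this] phi_cont]
    show "(\<lambda>z. r z * y t z * phi n z) integrable_on cbox 0 1" by simp
  next
    have "continuous_on ({0<..} \<times> {0..1}) (\<lambda>(t, z). deriv (\<lambda>s. y s z) t)"
      using C1 by (simp add: C1_strip_def)
    from continuous_on_mult[OF rphi this]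
    show "continuous_on ({0<..} \<times> cbox 0 1) (\<lambda>(t, z). r z * deriv (\<lambda>s. y s z) t * phi n z)"
      by (simp add: split_beta mult_ac)
  qed (use t in auto)
  \<comment> \<open>The equation holds for interior z only, so both integrals are taken over the
    open interval.\<close>
  moreover have "integral {0..1} (\<lambda>z. r z * deriv (\<lambda>s. y s z) t * phi n z)
      = integral {0..1} (\<lambda>z. (flux' (y t) z - q z * y t z) * phi n z)"
    unfolding integral_open_interval_real
  proof (rule integral_cong)
    fix z :: real assume z: "z \<in> {0<..<1}"
    then have "r z * deriv (\<lambda>s. y s z) t = flux' (y t) z - q z * y t z"
      using pde[OF t z] r_pos[of z] by (simp add: field_simps)
    then show "r z * deriv (\<lambda>s. y s z) t * phi n z = (flux' (y t) z - q z * y t z) * phi n z"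
      by simp
  qed
  ultimately show "((\<lambda>t. coef (y t) n) has_real_derivative - lam n * coef (y t) n + kappa n * d t) (at t)"
    using boundary_coef[OF yX, of t n] t at_within_open[of t "{0<..}"]
    unfolding coef_def ip_def box_real(2) by simp
qed

lemma solution_cont:
  assumes "pde_solution p q r a1 a2 b1 b2 d x0 y" "t \<ge> 0"
  shows "Ck_on 2 {0..1} (y t)" "continuous_on {0..1} (y t)"
  using assms Ck_on_2D(3) by (auto simp: pde_solution_def X_space_def)

text \<open>The difference of the coefficients solves the homogeneous modal equation with initial
  value 0 and stays 0; completeness leads back to the functions.\<close>

theorem solution_unique:
  assumes x: "pde_solution p q r a1 a2 b1 b2 d x0 x" and y: "pde_solution p q r a1 a2 b1 b2 d x0 y"
    and t: "t \<ge> 0" and z: "z \<in> {0..1}"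
  shows "y t z = x t z"
proof (rule coef_inject[OF solution_cont(2)[OF y t] solution_cont(2)[OF x t] _ z])
  fix n
  have "coef (y 0) n = coef (x 0) n"
    unfolding coef_def using x y by (intro ip_cong) (auto simp: pde_solution_def)
  moreover have "\<bar>coef (y t) n - coef (x t) n\<bar>
      \<le> exp (- lam n * t) * \<bar>coef (y 0) n - coef (x 0) n\<bar> + 0 / lam n"
  proof (rule linear_ode_bound[where g = "\<lambda>_. 0", OF lam_pos _ _ t])
    show "continuous_on {0..} (\<lambda>t. coef (y t) n - coef (x t) n)"
      by (intro continuous_on_diff coef_solution(1)[OF x] coef_solution(1)[OF y])
    fix t :: real assume "t > 0"
    from DERIV_diff[OF coef_solution(2)[OF y this, where n = n] coef_solution(2)[OF x this, where n = n]]
    show "((\<lambda>t. coef (y t) n - coef (x t) n) has_real_derivative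
        - lam n * (coef (y t) n - coef (x t) n) + 0) (at t)"
      by (simp add: algebra_simps)
  qed simp
  ultimately show "coef (y t) n = coef (x t) n" by simp
qed

text \<open>In each mode the decay is at least that of the first, and |\<open>kappa n\<close>| /
  \<open>lam n\<close> is the modulus of the coefficient of \<open>lift\<close>. Squaring with
  \<open>young\<close> and summing by Parseval turns the modal bounds into norms.\<close>

theorem solution_estimate:
  assumes x: "pde_solution p q r a1 a2 b1 b2 d x0 x" and d: "continuous_on {0..} d"
    and t: "t \<ge> 0" and \<epsilon>: "\<epsilon> > 0"
  shows "nrm (x t) \<le> sqrt (1 + \<epsilon>) * exp (- lam 0 * t) * nrm (x 0)
    + nrm lift * sqrt (1 + inverse \<epsilon>) * (SUP s\<in>{0..t}. \<bar>d s\<bar>)"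
proof -
  define D where "D = (SUP s\<in>{0..t}. \<bar>d s\<bar>)"
  have "continuous_on {0..t} d" using d by (rule continuous_on_subset) auto
  then obtain B where B: "\<And>s. s \<in> {0..t} \<Longrightarrow> \<bar>d s\<bar> \<le> B" using continuous_on_Icc_bounded by metis
  have D: "\<bar>d s\<bar> \<le> D" if "s \<in> {0..t}" for s
    unfolding D_def using that by (intro cSUP_upper bdd_aboveI2[OF B])
  have D0: "D \<ge> 0" using D[of 0] t by simp
  let ?E = "exp (- lam 0 * t)"
  have bound: "(coef (x t) n)\<^sup>2 \<le> (1 + \<epsilon>) * ?E\<^sup>2 * (coef (x 0) n)\<^sup>2
      + (1 + inverse \<epsilon>) * D\<^sup>2 * (coef lift n)\<^sup>2" for n
  proof -
    let ?a = "?E * \<bar>coef (x 0) n\<bar>" and ?b = "\<bar>coef lift n\<bar> * D"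
    have "\<bar>coef (x t) n\<bar> \<le> exp (- lam n * t) * \<bar>coef (x 0) n\<bar> + \<bar>kappa n\<bar> * D / lam n"
    proof (rule linear_ode_bound[OF lam_pos coef_solution[OF x] t])
      show "\<bar>kappa n * d s\<bar> \<le> \<bar>kappa n\<bar> * D" if "s \<in> {0..t}" for s
        using D[OF that] by (simp add: abs_mult mult_left_mono)
    qed
    also have "exp (- lam n * t) * \<bar>coef (x 0) n\<bar> \<le> ?a"
      using lam_ge[of n] t by (intro mult_right_mono) (auto intro: mult_right_mono)
    also have "\<bar>kappa n\<bar> * D / lam n = ?b"
      using lam_pos[of n] by (simp add: coef_lift abs_divide)
    finally have "\<bar>coef (x t) n\<bar> \<le> ?a + ?b" by simp
    then have "(coef (x t) n)\<^sup>2 \<le> (?a + ?b)\<^sup>2"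
      by (intro abs_le_square_iff[THEN iffD1]) simp
    also have "\<dots> \<le> (1 + \<epsilon>) * ?a\<^sup>2 + (1 + inverse \<epsilon>) * ?b\<^sup>2"
      by (rule young[OF \<epsilon>])
    finally show ?thesis by (simp add: power_mult_distrib mult_ac)
  qed
  have sums: "(\<lambda>n. (coef (x s) n)\<^sup>2) sums ip (x s) (x s)" if "s \<ge> 0" for s
    using parseval[OF solution_cont(1)[OF x that]] .
  have "ip (x t) (x t) \<le> (1 + \<epsilon>) * ?E\<^sup>2 * ip (x 0) (x 0) + (1 + inverse \<epsilon>) * D\<^sup>2 * ip lift lift"
    by (rule sums_le[OF bound sums[OF t]])
      (intro sums_add sums_mult sums parseval lift order_refl)
  then have "nrm (x t) \<le> sqrt ((1 + \<epsilon>) * ?E\<^sup>2 * ip (x 0) (x 0) + (1 + inverse \<epsilon>) * D\<^sup>2 * ip lift lift)"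
    unfolding nrm_def by (rule real_sqrt_le_mono)
  also have "\<dots> \<le> sqrt ((1 + \<epsilon>) * ?E\<^sup>2 * ip (x 0) (x 0)) + sqrt ((1 + inverse \<epsilon>) * D\<^sup>2 * ip lift lift)"
    using \<epsilon> ip_self_nonneg[OF lift_cont] ip_self_nonneg[OF solution_cont(2)[OF x order_refl]]
    by (intro sqrt_add_le_add_sqrt mult_nonneg_nonneg) auto
  also have "\<dots> = sqrt (1 + \<epsilon>) * ?E * nrm (x 0) + nrm lift * sqrt (1 + inverse \<epsilon>) * D"
    using D0 by (simp add: real_sqrt_mult nrm_def)
  finally show ?thesis by (simp add: D_def)
qed

end

section \<open>Existence of solutions\<close>

text \<open>The majorants of the series hold on bounded time intervals, and for the time derivative
  only away from 0; continuity is therefore proved near each t.\<close>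

lemma continuous_on_product_locally:
  fixes f :: "'a::t2_space \<times> 'b::t2_space \<Rightarrow> 'c::topological_space"
  assumes "\<And>t. t \<in> V \<Longrightarrow> \<exists>U. open U \<and> t \<in> U \<and> continuous_on ((V \<inter> U) \<times> B) f"
  shows "continuous_on (V \<times> B) f"
  unfolding continuous_on_eq_continuous_within
proof
  fix x assume x: "x \<in> V \<times> B"
  then obtain U where U: "open U" "fst x \<in> U" "continuous_on ((V \<inter> U) \<times> B) f"
    using assms[of "fst x"] by auto
  then have "continuous (at x within (V \<inter> U) \<times> B) f"
    using x by (auto simp: continuous_on_eq_continuous_within)
  moreover have "at x within (V \<inter> U) \<times> B = at x within V \<times> B"
    using U(1,2) by (intro at_within_nhd[of x "U \<times> UNIV"] open_Times) (auto simp: mem_Times_iff)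
  ultimately show "continuous (at x within V \<times> B) f" by simp
qed

text \<open>The solution of J' = - l J + g with J(0) = 0.\<close>

definition duhamel :: "real \<Rightarrow> (real \<Rightarrow> real) \<Rightarrow> real \<Rightarrow> real" where
  "duhamel l g t = exp (- l * t) * integral {0..t} (\<lambda>s. exp (l * s) * g s)"

lemma duhamel_0 [simp]: "duhamel l g 0 = 0"
  by (simp add: duhamel_def)

lemma duhamel_deriv:
  assumes g: "continuous_on {0..} g" and t: "t \<ge> 0"
  shows "(duhamel l g has_real_derivative g t - l * duhamel l g t) (at t within {0..})"
proof -
  \<comment> \<open>The upper end t + 1 lies beyond t, so the filter within [0, t + 1] agrees with
    the one within [0, \<infinity>).\<close>
  have "((\<lambda>t. integral {0..t} (\<lambda>s. exp (l * s) * g s)) has_real_derivative exp (l * t) * g t)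
      (at t within {0..t + 1})"
    using continuous_on_subset[OF g, of "{0..t + 1}"] t
    by (intro integral_has_real_derivative continuous_intros) auto
  moreover have "at t within {0..t + 1} = at t within {0..}"
    by (rule at_within_nhd[of t "{..<t + 1}"]) auto
  ultimately have *: "((\<lambda>t. integral {0..t} (\<lambda>s. exp (l * s) * g s)) has_real_derivative
      exp (l * t) * g t) (at t within {0..})" by simp
  have "((\<lambda>t. exp (- l * t)) has_real_derivative - l * exp (- l * t)) (at t within {0..})"
    by (auto intro!: derivative_eq_intros)
  from DERIV_mult[OF this *] have "(duhamel l g has_real_derivative
      - l * duhamel l g t + exp (l * t) * exp (- l * t) * g t) (at t within {0..})"
    by (simp add: duhamel_def[abs_def] mult_ac)
  then show ?thesis by (simp flip: exp_add)
qed

context sl_invertible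
begin

text \<open>Split off the change of profile: its effect on the derivative is at most
  \<open>green_const\<close> times the norm of F t - F s, uniformly in z, and that norm is
  continuous in t. For the fixed profile F s the derivative is continuous in z.\<close>

lemma continuous_on_green_deriv:
  fixes F :: "'a::t2_space \<Rightarrow> real \<Rightarrow> real"
  assumes F: "continuous_on (U \<times> {0..1}) (\<lambda>(t, z). F t z)"
  shows "continuous_on (U \<times> {0..1}) (\<lambda>(t, z). deriv_on {0..1} (green (F t)) z)"
  unfolding continuous_on_def
proof
  fix x :: "'a \<times> real" assume x: "x \<in> U \<times> {0..1}"
  obtain s y where sy: "x = (s, y)" "s \<in> U" "y \<in> {0..1}" using x by auto
  have Fc: "continuous_on {0..1} (F t)" if "t \<in> U" for t
  proof -
    have "continuous_on {0..1} (\<lambda>z. (\<lambda>(t, z). F t z) (t, z))"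
      by (rule continuous_on_compose2[OF F]) (use that in \<open>auto intro!: continuous_intros\<close>)
    then show ?thesis by simp
  qed
  let ?G = "\<lambda>t. deriv_on {0..1} (green (F t))"
  define N where "N t = nrm (\<lambda>z. F t z - F s z)" for t
  have "continuous_on U N"
    unfolding N_def nrm_def ip_def box_real(2)[symmetric]
  proof (intro continuous_on_real_sqrt integral_continuous_on_param)
    have r': "continuous_on (U \<times> {0..1}) (\<lambda>x. r (snd x))"
      and F': "continuous_on (U \<times> {0..1}) (\<lambda>x. F s (snd x))"
      by (intro continuous_on_compose2[OF r_cont] continuous_on_compose2[OF Fc[OF sy(2)]]
          continuous_on_snd continuous_on_id; auto)+
    have "continuous_on (U \<times> {0..1})
        (\<lambda>x. r (snd x) * ((\<lambda>(t, z). F t z) x - F s (snd x)) * ((\<lambda>(t, z). F t z) x - F s (snd x)))"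
      by (intro continuous_on_mult continuous_on_diff r' F' F)
    then show "continuous_on (U \<times> cbox 0 1) (\<lambda>(t, z). r z * (F t z - F s z) * (F t z - F s z))"
      by (simp add: split_beta)
  qed
  then have "continuous_on (U \<times> {0..1}) (\<lambda>x. N (fst x))"
    by (rule continuous_on_compose2) (auto intro: continuous_intros)
  moreover have "continuous_on (U \<times> {0..1}) (\<lambda>x. ?G s (snd x))"
    by (rule continuous_on_compose2[OF Ck_on_2D(4)[OF green_C2[OF Fc[OF sy(2)]]]])
      (auto intro: continuous_intros)
  ultimately have C: "continuous_on (U \<times> {0..1})
      (\<lambda>x. green_const * N (fst x) + \<bar>?G s (snd x) - ?G s y\<bar>)"
    by (intro continuous_intros)
  have "((\<lambda>x. green_const * N (fst x) + \<bar>?G s (snd x) - ?G s y\<bar>) \<longlongrightarrow>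
      green_const * N s + \<bar>?G s y - ?G s y\<bar>) (at (s, y) within U \<times> {0..1})"
    using bspec[OF C[unfolded continuous_on_def] x] unfolding sy(1) fst_conv snd_conv .
  moreover have "N s = 0" by (simp add: N_def nrm_def ip_def)
  ultimately have lim: "((\<lambda>x. green_const * N (fst x) + \<bar>?G s (snd x) - ?G s y\<bar>) \<longlongrightarrow> 0)
      (at (s, y) within U \<times> {0..1})" by simp
  have bound: "\<bar>?G t z - ?G s y\<bar> \<le> green_const * N t + \<bar>?G s z - ?G s y\<bar>"
    if "t \<in> U" "z \<in> {0..1}" for t z
  proof -
    have c: "continuous_on {0..1} (\<lambda>z. F t z - 1 * F s z)"
      using Fc that sy by (intro continuous_intros)
    have "\<bar>?G t z - ?G s z\<bar> \<le> green_const * nrm (\<lambda>z. F t z - 1 * F s z)"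
      using green_abs_le(2)[OF c that(2)] green_diff(2)[OF Fc Fc that(2), of t s 1] that(1) sy(2)
      by simp
    then show ?thesis by (simp add: N_def)
  qed
  show "((\<lambda>(t, z). ?G t z) \<longlongrightarrow> (\<lambda>(t, z). ?G t z) x) (at x within U \<times> {0..1})"
    unfolding sy(1) prod.case
  proof (rule LIM_zero_cancel, rule Lim_null_comparison[OF _ lim])
    show "\<forall>\<^sub>F x in at (s, y) within U \<times> {0..1}. norm ((case x of (t, z) \<Rightarrow> ?G t z) - ?G s y)
        \<le> green_const * N (fst x) + \<bar>?G s (snd x) - ?G s y\<bar>"
      unfolding eventually_at_filter by (rule always_eventually) (use bound in auto)
  qed
qed

end

context sl_basis
begin

lemma series_cont:
  assumes a: "\<And>n. continuous_on U (a n)" and m: "\<And>n t. t \<in> U \<Longrightarrow> \<bar>a n t\<bar> \<le> m n"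
    and sm: "summable (\<lambda>n. m n * phi_sup n)"
  shows "continuous_on (U \<times> {0..1}) (\<lambda>(t, z). \<Sum>n. a n t * phi n z)"
proof -
  have "uniform_limit (U \<times> {0..1}) (\<lambda>N x. \<Sum>n<N. a n (fst x) * phi n (snd x))
      (\<lambda>x. \<Sum>n. a n (fst x) * phi n (snd x)) sequentially"
  proof (rule Weierstrass_m_test[OF _ sm])
    fix n x assume "x \<in> U \<times> {0..1::real}"
    then have "\<bar>a n (fst x)\<bar> \<le> m n" "\<bar>phi n (snd x)\<bar> \<le> phi_sup n"
      using m abs_phi_le by auto
    then show "norm (a n (fst x) * phi n (snd x)) \<le> m n * phi_sup n"
      by (auto simp: abs_mult intro!: mult_mono)
  qed
  moreover have "continuous_on (U \<times> {0..1}) (\<lambda>x. \<Sum>n<N. a n (fst x) * phi n (snd x))" for N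
    by (intro continuous_on_sum continuous_on_mult continuous_on_compose2[OF a]
        continuous_on_compose2[OF phi_cont] continuous_on_fst continuous_on_snd continuous_on_id)
      auto
  ultimately have "continuous_on (U \<times> {0..1}) (\<lambda>x. \<Sum>n. a n (fst x) * phi n (snd x))"
    by (intro uniform_limit_theorem) auto
  then show ?thesis by (simp add: split_beta)
qed

lemma series_deriv:
  assumes U: "open U" "convex U" and t: "t \<in> U" and z: "z \<in> {0..1}"
    and a: "\<And>n t. t \<in> U \<Longrightarrow> (a n has_real_derivative a' n t) (at t)"
    and m: "\<And>n t. t \<in> U \<Longrightarrow> \<bar>a n t\<bar> \<le> m n" "summable (\<lambda>n. m n * phi_sup n)"
    and m': "\<And>n t. t \<in> U \<Longrightarrow> \<bar>a' n t\<bar> \<le> m' n" "summable (\<lambda>n. m' n * phi_sup n)"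
  shows "((\<lambda>t. \<Sum>n. a n t * phi n z) has_real_derivative (\<Sum>n. a' n t * phi n z)) (at t)"
proof (rule has_field_derivative_series'(2)[OF U(2) _ _ t])
  have le: "norm (x * phi n z) \<le> y * phi_sup n" if "\<bar>x\<bar> \<le> y" for x y n
    using that abs_phi_le[OF z, of n] by (auto simp: abs_mult intro!: mult_mono)
  show "((\<lambda>t. a n t * phi n z) has_real_derivative a' n t * phi n z) (at t within U)"
    if "t \<in> U" for n t
    using DERIV_cmult_right[OF a[OF that]] by (rule has_field_derivative_at_within)
  show "uniformly_convergent_on U (\<lambda>N t. \<Sum>n<N. a' n t * phi n z)"
    by (rule Weierstrass_m_test'[OF _ m'(2)]) (intro le m'(1))
  show "summable (\<lambda>n. a n t * phi n z)"
    by (rule summable_comparison_test[OF _ m(2)]) (use le m(1)[OF t] in blast)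
  show "t \<in> interior U" using U t by (simp add: interior_open)
qed

theorem solution_exists:
  assumes d: "Ck_on 2 {0..} d" and x0: "x0 \<in> X_space a1 a2 b1 b2 (d 0)"
  shows "\<exists>x. pde_solution p q r a1 a2 b1 b2 d x0 x"
proof -
  define d1 d2 where "d1 = deriv_on {0..} d" and "d2 = deriv_on {0..} d1"
  note d' = Ck_on_2D[OF d, folded d1_def, folded d2_def]
  define w0 where "w0 z = 1 * x0 z + (- d 0) * lift z" for z
  have w0: "w0 \<in> dom" using X_space_sub_lift[OF x0] by (simp add: w0_def[abs_def])
  define c where "c n = coef w0 n" for n
  define h where "h n = coef lift n" for n
  define H where "H = nrm lift"
  have h_le: "\<bar>h n\<bar> \<le> H" for n using abs_coef_le[OF lift_cont] by (simp add: h_def H_def)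
  have H: "H \<ge> 0" using nrm_nonneg[OF lift_cont] by (simp add: H_def)
  define J where "J n = duhamel (lam n) d1" for n
  \<comment> \<open>\<open>K n\<close> is the derivative of \<open>J n\<close>. It solves the same
    modal equation with forcing \<open>d2\<close> and initial value d'(0), and so is
    O(1/\<lambda>_n) away from t = 0, although the formula multiplies \<open>J n\<close> by
    \<lambda>_n.\<close>
  define K where "K n t = d1 t - lam n * J n t" for n t
  \<comment> \<open>Solves a' = - \<lambda>_n a - h_n d' with a(0) = c_n, the modal equation of w =
    x - d(t) \<open>lift\<close>.\<close>
  define a where "a n t = exp (- lam n * t) * c n - h n * J n t" for n t
  define a' where "a' n t = - lam n * exp (- lam n * t) * c n - h n * K n t" for n t

  have J_deriv: "(J n has_real_derivative K n t) (at t within {0..})" if "t \<ge> 0" for n t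
    using duhamel_deriv[OF d'(4) that] by (simp add: J_def K_def)
  have J_cont: "continuous_on {0..} (J n)" for n
    using J_deriv by (intro DERIV_continuous_on) auto
  have K_cont: "continuous_on {0..} (K n)" for n
    unfolding K_def by (intro continuous_intros d' J_cont)
  have K_deriv: "(K n has_real_derivative - lam n * K n t + d2 t) (at t)" if "t > 0" for n t
  proof -
    have "(K n has_real_derivative d2 t - lam n * K n t) (at t within {0..})"
      unfolding K_def[abs_def] using J_deriv[of t n] d'(2)[of t] that
      by (auto intro!: derivative_eq_intros simp: K_def)
    then show ?thesis using at_within_Ici_pos[OF that] by simp
  qed
  have J_le: "\<bar>J n T\<bar> \<le> D / lam n" if "T \<ge> 0" "\<And>t. t \<in> {0..T} \<Longrightarrow> \<bar>d1 t\<bar> \<le> D" for n T D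
  proof -
    have "\<bar>J n T\<bar> \<le> exp (- lam n * T) * \<bar>J n 0\<bar> + D / lam n"
    proof (rule linear_ode_bound[OF lam_pos J_cont _ that])
      show "(J n has_real_derivative - lam n * J n t + d1 t) (at t)" if "t > 0" for t
        using J_deriv[of t n] that at_within_Ici_pos[OF that] by (simp add: K_def)
    qed
    then show ?thesis by (simp add: J_def)
  qed
  have K_le: "\<bar>K n T\<bar> \<le> exp (- lam n * T) * \<bar>d1 0\<bar> + D / lam n"
    if "T \<ge> 0" "\<And>t. t \<in> {0..T} \<Longrightarrow> \<bar>d2 t\<bar> \<le> D" for n T D
    using linear_ode_bound[OF lam_pos K_cont K_deriv that] by (simp add: K_def J_def)

  have a_deriv: "(a n has_real_derivative a' n t) (at t)" if "t > 0" for n t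
    using J_deriv[of t n] that at_within_Ici_pos[OF that] unfolding a_def[abs_def] a'_def
    by (auto intro!: derivative_eq_intros)
  have a_cont: "continuous_on {0..} (a n)" for n
    unfolding a_def by (intro continuous_intros J_cont)
  have a'_cont: "continuous_on {0..} (a' n)" for n
    unfolding a'_def by (intro continuous_intros K_cont)
  have a_eq: "lam n * a n t = - a' n t - d1 t * h n" for n t
    by (simp add: a_def a'_def K_def algebra_simps)

  have sc: "summable (\<lambda>n. \<bar>c n\<bar> * phi_sup n)"
    using summable_coef_dom[OF w0] by (simp add: c_def)
  have a_bound: "\<exists>m. summable (\<lambda>n. m n * phi_sup n) \<and> (\<forall>n. \<forall>t\<in>{0..T}. \<bar>a n t\<bar> \<le> m n)"
    for T
  proof -
    have "continuous_on {0..T} d1" using d'(4) by (rule continuous_on_subset) auto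
    then obtain D where D: "D > 0" "\<And>t. t \<in> {0..T} \<Longrightarrow> \<bar>d1 t\<bar> \<le> D"
      using continuous_on_Icc_bounded by blast
    show ?thesis
    proof (intro exI conjI allI ballI)
      show "summable (\<lambda>n. (\<bar>c n\<bar> + H * (D / lam n)) * phi_sup n)"
        using summable_add[OF sc summable_mult[OF phi_sup_summable, of "H * D"]]
        by (simp add: algebra_simps divide_inverse)
      fix n t assume t: "t \<in> {0..T}"
      have "\<bar>exp (- lam n * t) * c n\<bar> \<le> 1 * \<bar>c n\<bar>"
        unfolding abs_mult using lam_pos[of n] t by (intro mult_right_mono) auto
      moreover have "\<bar>h n * J n t\<bar> \<le> H * (D / lam n)"
        unfolding abs_mult using h_le H J_le[of t D n] D t by (intro mult_mono) auto
      ultimately show "\<bar>a n t\<bar> \<le> \<bar>c n\<bar> + H * (D / lam n)"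
        by (simp add: a_def)
    qed
  qed
  have a'_bound: "\<exists>m. summable (\<lambda>n. m n * phi_sup n) \<and> (\<forall>n. \<forall>t\<in>{t0..T}. \<bar>a' n t\<bar> \<le> m n)"
    if t0: "t0 > 0" for t0 T
  proof -
    have "continuous_on {0..T} d2" using d'(5) by (rule continuous_on_subset) auto
    then obtain D where D: "D > 0" "\<And>t. t \<in> {0..T} \<Longrightarrow> \<bar>d2 t\<bar> \<le> D"
      using continuous_on_Icc_bounded by blast
    define C where "C = \<bar>d1 0\<bar> / t0 + D"
    show ?thesis
    proof (intro exI conjI allI ballI)
      show "summable (\<lambda>n. (\<bar>c n\<bar> / t0 + H * (C / lam n)) * phi_sup n)"
        using summable_add[OF summable_mult[OF sc, of "1 / t0"]
            summable_mult[OF phi_sup_summable, of "H * C"]]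
        by (simp add: algebra_simps divide_inverse)
      fix n t assume t: "t \<in> {t0..T}"
      \<comment> \<open>From x <= exp x. It absorbs the factor \<lambda>_n in front of
        \<open>c n\<close> and, divided by \<lambda>_n, makes the initial term of \<open>K n\<close>
        at most |d'(0)| / (t0 \<lambda>_n).\<close>
      have e: "lam n * exp (- lam n * t) \<le> 1 / t0"
      proof -
        have "lam n * t0 \<le> lam n * t" using t lam_pos[of n] by simp
        also have "\<dots> \<le> exp (lam n * t)" using exp_ge_add_one_self[of "lam n * t"] by linarith
        finally show ?thesis using t0 by (simp add: exp_minus field_simps)
      qed
      then have "lam n * exp (- lam n * t) * \<bar>c n\<bar> \<le> 1 / t0 * \<bar>c n\<bar>"
        by (rule mult_right_mono) simp
      then have 1: "\<bar>- lam n * exp (- lam n * t) * c n\<bar> \<le> \<bar>c n\<bar> / t0"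
        using lam_pos[of n] by (simp add: abs_mult abs_of_pos)
      have "\<bar>K n t\<bar> \<le> exp (- lam n * t) * \<bar>d1 0\<bar> + D / lam n"
        using K_le[of t D n] D t t0 by auto
      also have "exp (- lam n * t) * \<bar>d1 0\<bar> \<le> 1 / t0 / lam n * \<bar>d1 0\<bar>"
        using divide_right_mono[OF e, of "lam n"] lam_pos[of n] by (intro mult_right_mono) auto
      finally have "\<bar>K n t\<bar> \<le> C / lam n" by (simp add: C_def add_divide_distrib)
      then have "\<bar>h n * K n t\<bar> \<le> H * (C / lam n)"
        unfolding abs_mult using h_le H by (intro mult_mono) auto
      with 1 show "\<bar>a' n t\<bar> \<le> \<bar>c n\<bar> / t0 + H * (C / lam n)"
        unfolding a'_def by linarith
    qed
  qed

  define w where "w t z = (\<Sum>n. a n t * phi n z)" for t z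
  define w' where "w' t z = (\<Sum>n. a' n t * phi n z)" for t z
  have w_cont: "continuous_on ({0..} \<times> {0..1}) (\<lambda>(t, z). w t z)"
  proof (rule continuous_on_product_locally)
    fix t :: real assume "t \<in> {0..}"
    obtain m where m: "summable (\<lambda>n. m n * phi_sup n)" "\<forall>n. \<forall>s\<in>{0..t + 1}. \<bar>a n s\<bar> \<le> m n"
      using a_bound by blast
    have "continuous_on (({0..} \<inter> {..<t + 1}) \<times> {0..1}) (\<lambda>(t, z). w t z)"
      unfolding w_def
      by (rule series_cont[OF _ _ m(1)]) (use m(2) in \<open>auto intro: continuous_on_subset[OF a_cont]\<close>)
    then show "\<exists>U. open U \<and> t \<in> U \<and> continuous_on (({0..} \<inter> U) \<times> {0..1}) (\<lambda>(t, z). w t z)"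
      by (intro exI[of _ "{..<t + 1}"]) auto
  qed
  have w'_cont: "continuous_on ({0<..} \<times> {0..1}) (\<lambda>(t, z). w' t z)"
  proof (rule continuous_on_product_locally)
    fix t :: real assume t: "t \<in> {0<..}"
    \<comment> \<open>The lower end t / 2 keeps the interval away from 0, as \<open>a'_bound\<close>
      requires.\<close>
    obtain m where m: "summable (\<lambda>n. m n * phi_sup n)" "\<forall>n. \<forall>s\<in>{t / 2..t + 1}. \<bar>a' n s\<bar> \<le> m n"
      using a'_bound[of "t / 2" "t + 1"] t by auto
    have "continuous_on (({0<..} \<inter> {t / 2<..<t + 1}) \<times> {0..1}) (\<lambda>(t, z). w' t z)"
      unfolding w'_def
      by (rule series_cont[OF _ _ m(1)]) (use m(2) in \<open>auto intro: continuous_on_subset[OF a'_cont]\<close>)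
    then show "\<exists>U. open U \<and> t \<in> U \<and> continuous_on (({0<..} \<inter> U) \<times> {0..1}) (\<lambda>(t, z). w' t z)"
      using t by (intro exI[of _ "{t / 2<..<t + 1}"]) auto
  qed
  have w_deriv: "((\<lambda>t. w t z) has_real_derivative w' t z) (at t)" if t: "t > 0" and z: "z \<in> {0..1}" for t z
  proof -
    obtain m where m: "summable (\<lambda>n. m n * phi_sup n)" "\<forall>n. \<forall>s\<in>{0..t + 1}. \<bar>a n s\<bar> \<le> m n"
      using a_bound by blast
    obtain m' where m': "summable (\<lambda>n. m' n * phi_sup n)" "\<forall>n. \<forall>s\<in>{t / 2..t + 1}. \<bar>a' n s\<bar> \<le> m' n"
      using a'_bound[of "t / 2" "t + 1"] t by auto
    show ?thesis
      unfolding w_def w'_def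
      by (rule series_deriv[of "{t / 2<..<t + 1}", OF _ _ _ z a_deriv _ m(1) _ m'(1)])
        (use t m(2) m'(2) in auto)
  qed
  have w_slice: "continuous_on {0..1} (w t)" "\<And>n. coef (w t) n = a n t" if "t \<ge> 0" for t
  proof -
    obtain m where m: "summable (\<lambda>n. m n * phi_sup n)" "\<forall>n. \<forall>s\<in>{0..t}. \<bar>a n s\<bar> \<le> m n"
      using a_bound by blast
    have s: "summable (\<lambda>n. \<bar>a n t\<bar> * phi_sup n)"
      by (rule summable_comparison_test[OF _ m(1)])
        (use m(2) that phi_sup_nonneg in \<open>auto simp: abs_mult intro!: mult_right_mono\<close>)
    show "continuous_on {0..1} (w t)" "\<And>n. coef (w t) n = a n t"
      using fourier_series(2,3)[OF s] by (simp_all add: w_def[abs_def])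
  qed
  have w'_slice: "continuous_on {0..1} (w' t)" "\<And>n. coef (w' t) n = a' n t" if t: "t > 0" for t
  proof -
    obtain m where m: "summable (\<lambda>n. m n * phi_sup n)" "\<forall>n. \<forall>s\<in>{t..t}. \<bar>a' n s\<bar> \<le> m n"
      using a'_bound[OF t] by blast
    have s: "summable (\<lambda>n. \<bar>a' n t\<bar> * phi_sup n)"
      by (rule summable_comparison_test[OF _ m(1)])
        (use m(2) phi_sup_nonneg in \<open>auto simp: abs_mult intro!: mult_right_mono\<close>)
    show "continuous_on {0..1} (w' t)" "\<And>n. coef (w' t) n = a' n t"
      using fourier_series(2,3)[OF s] by (simp_all add: w'_def[abs_def])
  qed

  \<comment> \<open>Minus the time derivative of x. Since A annihilates \<open>lift\<close>, the
    equation for x reads A w = F, so w[t] has to be \<open>green (F t)\<close>.\<close>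
  define F where "F t z = (-1) * w' t z + (- d1 t) * lift z" for t z
  have F_slice: "continuous_on {0..1} (F t)" if "t > 0" for t
    unfolding F_def by (intro continuous_intros w'_slice that lift_cont)
  have F_cont: "continuous_on ({0<..} \<times> {0..1}) (\<lambda>(t, z). F t z)"
  proof -
    have "continuous_on ({0<..} \<times> {0..1}) (\<lambda>x. d1 (fst x))"
      by (rule continuous_on_compose2[OF d'(4)]) (auto intro: continuous_intros)
    moreover have "continuous_on ({0<..} \<times> {0..1}) (\<lambda>x. lift (snd x))"
      by (rule continuous_on_compose2[OF lift_cont]) (auto intro: continuous_intros)
    ultimately have "continuous_on ({0<..} \<times> {0..1})
        (\<lambda>x. (-1) * (\<lambda>(t, z). w' t z) x + (- d1 (fst x)) * lift (snd x))"
      by (intro continuous_intros w'_cont)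
    then show ?thesis by (simp add: F_def split_beta)
  qed
  have w_green: "w t z = green (F t) z" if t: "t > 0" and z: "z \<in> {0..1}" for t z
  proof (rule coef_inject[OF w_slice(1) green_cont[OF F_slice[OF t]] _ z])
    fix n
    have "coef (F t) n = lam n * a n t"
      unfolding F_def coef_lincomb[OF w'_slice(1)[OF t] lift_cont] w'_slice(2)[OF t] a_eq
      by (simp add: h_def)
    then show "coef (w t) n = coef (green (F t)) n"
      using w_slice(2)[of t n] t lam_pos[of n] by (simp add: coef_green[OF F_slice[OF t]])
  qed (use t in simp)
  have w_0: "w 0 z = w0 z" if "z \<in> {0..1}" for z
    by (rule coef_inject[OF w_slice(1) domD(4)[OF w0] _ that])
      (simp_all add: w_slice a_def J_def c_def)
  \<comment> \<open>The Green representation covers t > 0; at t = 0 the profile is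
    \<open>w0\<close>, which lies in \<open>dom\<close> because the initial data match d(0).\<close>
  have w_dom: "\<exists>g\<in>dom. \<forall>z\<in>{0..1}. w t z = g z" if "t \<ge> 0" for t
  proof (cases "t = 0")
    case True
    then show ?thesis using w0 w_0 by blast
  next
    case False
    then have t: "t > 0" using that by simp
    then show ?thesis using w_green[OF t] green(1)[OF F_slice[OF t]] by blast
  qed

  define x where "x t z = 1 * w t z + d t * lift z" for t z
  have x_green: "x t z = 1 * green (F t) z + d t * lift z" if "t > 0" "z \<in> {0..1}" for t z
    using w_green[OF that] by (simp add: x_def)
  have x_time: "((\<lambda>s. x s z) has_real_derivative - F t z) (at t)" if t: "t > 0" and z: "z \<in> {0..1}" for t z
  proof -
    have "(d has_real_derivative d1 t) (at t)"
      using d'(1)[of t] t at_within_Ici_pos[OF t] by simp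
    then show ?thesis
      unfolding x_def[abs_def] F_def using w_deriv[OF t z] by (auto intro!: derivative_eq_intros)
  qed
  have x_space: "deriv_on {0..1} (x t) z = deriv_on {0..1} (green (F t)) z + d t * deriv_on {0..1} lift z"
    if t: "t > 0" and z: "z \<in> {0..1}" for t z
    using deriv_on_cong[of "{0..1}", OF x_green[OF t] z]
      deriv_on_lincomb[OF green_C2[OF F_slice[OF t]] lift(1) z, of 1 "d t"] by simp
  have x_X: "x t \<in> X_space a1 a2 b1 b2 (d t)" if t: "t \<ge> 0" for t
  proof -
    obtain g where g: "g \<in> dom" "\<And>z. z \<in> {0..1} \<Longrightarrow> w t z = g z" using w_dom[OF t] by blast
    then show ?thesis
      using X_space_add_lift[OF g(1), of "d t"]
        X_space_cong[of "x t" "\<lambda>z. 1 * g z + d t * lift z" "d t"] by (simp add: x_def)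
  qed
  have "pde_solution p q r a1 a2 b1 b2 d x0 x"
    unfolding pde_solution_def C1_strip_def
  proof (intro conjI allI impI ballI)
    have "continuous_on ({0..} \<times> {0..1}) (\<lambda>x. d (fst x))"
      by (rule continuous_on_compose2[OF d'(3)]) (auto intro: continuous_intros)
    moreover have "continuous_on ({0..} \<times> {0..1}) (\<lambda>x. lift (snd x))"
      by (rule continuous_on_compose2[OF lift_cont]) (auto intro: continuous_intros)
    ultimately have "continuous_on ({0..} \<times> {0..1})
        (\<lambda>x. 1 * (\<lambda>(t, z). w t z) x + d (fst x) * lift (snd x))"
      by (intro continuous_intros w_cont)
    then show "continuous_on ({0..} \<times> {0..1}) (\<lambda>(t, z). x t z)"
      by (simp add: x_def split_beta)
  next
    fix t z :: real assume t: "t > 0" and z: "z \<in> {0..1}"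
    show "(\<lambda>s. x s z) differentiable at t"
      using x_time[OF t z] real_differentiable_def by blast
  next
    fix t :: real assume t: "t > 0"
    then have "Ck_on 2 {0..1} (x t)" using x_X[of t] by (simp add: X_space_def)
    then show "x t differentiable_on {0..1}" by (simp add: numeral_2_eq_2)
  next
    have "continuous_on ({0<..} \<times> {0..1}) (\<lambda>x. - (\<lambda>(t, z). F t z) x)"
      by (intro continuous_on_minus F_cont)
    then show "continuous_on ({0<..} \<times> {0..1}) (\<lambda>(t, z). deriv (\<lambda>s. x s z) t)"
      by (rule continuous_on_eq) (auto simp: DERIV_imp_deriv[OF x_time])
  next
    have "continuous_on ({0<..} \<times> {0..1}) (\<lambda>x. d (fst x))"
      by (rule continuous_on_compose2[OF d'(3)]) (auto intro: continuous_intros)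
    moreover have "continuous_on ({0<..} \<times> {0..1}) (\<lambda>x. deriv_on {0..1} lift (snd x))"
      by (rule continuous_on_compose2[OF Ck_on_2D(4)[OF lift(1)]]) (auto intro: continuous_intros)
    ultimately have "continuous_on ({0<..} \<times> {0..1})
        (\<lambda>x. (\<lambda>(t, z). deriv_on {0..1} (green (F t)) z) x + d (fst x) * deriv_on {0..1} lift (snd x))"
      by (intro continuous_intros continuous_on_green_deriv F_cont)
    then show "continuous_on ({0<..} \<times> {0..1}) (\<lambda>(t, z). deriv_on {0..1} (x t) z)"
      by (rule continuous_on_eq) (auto simp: x_space)
  next
    fix t :: real assume "t \<ge> 0"
    then show "x t \<in> X_space a1 a2 b1 b2 (d t)" by (rule x_X)
  next
    fix z :: real assume "z \<in> {0..1}"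
    then show "x 0 z = x0 z" by (simp add: x_def w_0 w0_def)
  next
    fix t z :: real assume t: "t > 0" and z: "z \<in> {0<..<1}"
    then have z': "z \<in> {0..1}" by auto
    note C2 = green_C2[OF F_slice[OF t]]
    have "flux' (x t) z = flux' (\<lambda>z. 1 * green (F t) z + d t * lift z) z"
      by (rule flux_cong(2)[OF x_green[OF t] z'])
    also have "\<dots> = q z * x t z - r z * F t z"
      using lincomb(3)[OF C2 lift(1) z', of 1 "d t"] green(2)[OF F_slice[OF t] z'] lift(2)[OF z']
        x_green[OF t z'] by (simp add: algebra_simps)
    finally have "deriv_on {0..1} (\<lambda>y. p y * deriv_on {0..1} (x t) y) z = q z * x t z - r z * F t z"
      by (simp add: flux_def)
    then show "deriv (\<lambda>s. x s z) t
        - 1 / r z * deriv_on {0..1} (\<lambda>y. p y * deriv_on {0..1} (x t) y) z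
        + q z / r z * x t z = 0"
      using DERIV_imp_deriv[OF x_time[OF t z']] r_pos[OF z'] by (simp add: field_simps)
  qed
  then show ?thesis by blast
qed

end

theorem theorem2p2:
  fixes p q r :: "real \<Rightarrow> real"
    and a1 a2 b1 b2 :: real
    and lam :: "nat \<Rightarrow> real"
    and phi :: "nat \<Rightarrow> real \<Rightarrow> real"
  assumes "Ck_on 1 {0..1} p" and "\<forall>z\<in>{0..1}. p z > 0"
    and "Ck_on 0 {0..1} r" and "\<forall>z\<in>{0..1}. r z > 0"
    and "Ck_on 0 {0..1} q"
    and "\<bar>a1\<bar> + \<bar>a2\<bar> > 0" and "\<bar>b1\<bar> + \<bar>b2\<bar> > 0"
    and "strict_mono lam"
    and "range lam = sl_eigenvalues p q r a1 a2 b1 b2"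
    and "\<forall>n. sl_eigenfunction p q r a1 a2 b1 b2 (lam n) (phi n)"
    and "\<forall>m n. inner_r r (phi m) (phi n) = (if m = n then 1 else 0)"
    and "lam 0 > 0"
    and "summable (\<lambda>n. inverse (lam n) * (SUP z\<in>{0..1}. \<bar>phi n z\<bar>))"
  shows "(\<forall>d x0. Ck_on 2 {0..} d \<and> x0 \<in> X_space a1 a2 b1 b2 (d 0) \<longrightarrow>
           (\<exists>x. pde_solution p q r a1 a2 b1 b2 d x0 x \<and>
                (\<forall>y. pde_solution p q r a1 a2 b1 b2 d x0 y \<longrightarrow>
                     (\<forall>t\<ge>0. \<forall>z\<in>{0..1}. y t z = x t z)) \<and>
                (\<forall>t\<ge>0. \<forall>\<epsilon>>0.
                   norm_r r (x t)
                   \<le> sqrt (1 + \<epsilon>) * exp (- lam 0 * t) * norm_r r (x 0)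
                     + gain p b1 b2 lam phi * sqrt ((1 + inverse \<epsilon>) / (b1\<^sup>2 + b2\<^sup>2))
                       * (SUP s\<in>{0..t}. \<bar>d s\<bar>))))
       \<and> summable (gain_term b1 b2 lam phi)
       \<and> (\<exists>xt. bvp_solution p q a1 a2 b1 b2 xt \<and>
               (\<forall>y. bvp_solution p q a1 a2 b1 b2 y \<longrightarrow> (\<forall>z\<in>{0..1}. y z = xt z)) \<and>
               gain p b1 b2 lam phi = sqrt (LINT z:{0..1}|lebesgue. r z * (xt z)\<^sup>2))"
proof -
  \<comment> \<open>All eigenvalues are positive, so 0 is none of them and the Green operator is
    available.\<close>
  have "lam 0 \<le> lam n" for n using \<open>strict_mono lam\<close> by (simp add: strict_mono_less_eq)
  then have "0 \<notin> range lam" using \<open>lam 0 > 0\<close> by (metis imageE not_less)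
  then interpret sl_basis p q r a1 a2 b1 b2 lam phi
    using assms by unfold_locales auto
  define S where "S = sqrt (b1\<^sup>2 + b2\<^sup>2)"
  have S: "S > 0" using b_norm_pos by (simp add: S_def)
  note gain_S = gain(2)[folded S_def]
  show ?thesis
  proof (intro conjI allI impI)
    fix d :: "real \<Rightarrow> real" and x0 :: "real \<Rightarrow> real"
    assume dx0: "Ck_on 2 {0..} d \<and> x0 \<in> X_space a1 a2 b1 b2 (d 0)"
    then obtain x where x: "pde_solution p q r a1 a2 b1 b2 d x0 x"
      using solution_exists by blast
    have "norm_r r (x t) \<le> sqrt (1 + \<epsilon>) * exp (- lam 0 * t) * norm_r r (x 0)
        + gain p b1 b2 lam phi * sqrt ((1 + inverse \<epsilon>) / (b1\<^sup>2 + b2\<^sup>2)) * (SUP s\<in>{0..t}. \<bar>d s\<bar>)"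
      if t: "t \<ge> 0" and \<epsilon>: "\<epsilon> > 0" for t \<epsilon>
    proof -
      \<comment> \<open>The factor sqrt(b1^2 + b2^2) of the gain cancels the denominator and leaves
        the norm of \<open>lift\<close>, as in \<open>solution_estimate\<close>.\<close>
      have "gain p b1 b2 lam phi * sqrt ((1 + inverse \<epsilon>) / (b1\<^sup>2 + b2\<^sup>2))
          = nrm lift * sqrt (1 + inverse \<epsilon>)"
        unfolding gain_S real_sqrt_divide S_def[symmetric] using S by simp
      then show ?thesis
        using solution_estimate[OF x Ck_on_2D(3) t \<epsilon>] dx0
        by (simp add: norm_r_eq_nrm solution_cont(2)[OF x] t)
    qed
    then show "\<exists>x. pde_solution p q r a1 a2 b1 b2 d x0 x \<and>
        (\<forall>y. pde_solution p q r a1 a2 b1 b2 d x0 y \<longrightarrow>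
             (\<forall>t\<ge>0. \<forall>z\<in>{0..1}. y t z = x t z)) \<and>
        (\<forall>t\<ge>0. \<forall>\<epsilon>>0. norm_r r (x t)
           \<le> sqrt (1 + \<epsilon>) * exp (- lam 0 * t) * norm_r r (x 0)
             + gain p b1 b2 lam phi * sqrt ((1 + inverse \<epsilon>) / (b1\<^sup>2 + b2\<^sup>2))
               * (SUP s\<in>{0..t}. \<bar>d s\<bar>))"
      using x solution_unique[OF x] by blast
  next
    show "summable (gain_term b1 b2 lam phi)" by (rule gain)
  next
    let ?xt = "\<lambda>z. S * lift z"
    have c: "continuous_on {0..1} ?xt" using lift_cont by (intro continuous_intros)
    have "gain p b1 b2 lam phi = nrm ?xt" using S by (simp add: gain_S nrm_scale)
    also have "\<dots> = sqrt (LINT z:{0..1}|lebesgue. r z * (?xt z)\<^sup>2)"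
      unfolding norm_r_eq_nrm[OF c, symmetric] norm_r_def by simp
    finally show "\<exists>xt. bvp_solution p q a1 a2 b1 b2 xt \<and>
        (\<forall>y. bvp_solution p q a1 a2 b1 b2 y \<longrightarrow> (\<forall>z\<in>{0..1}. y z = xt z)) \<and>
        gain p b1 b2 lam phi = sqrt (LINT z:{0..1}|lebesgue. r z * (xt z)\<^sup>2)"
      using lift_bvp_solution[folded S_def] bvp_solution_eq_lift[folded S_def]
      by (intro exI[of _ ?xt]) blast
  qed
qed

end
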